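(* Let $(M,S,g,\{\mathcal{L}_\alpha\})$ be a locally Lagrange space. Then each choice of a normal bundle $N\mathcal{V}$ of the vertical foliation $\mathcal{V}$ defines an almost symplectic structure on $M$, given by the non degenerate $d''$-closed $2$-form $\Theta$ of type $(1,1)$ obtained by gluing up the local forms $d''\theta_{\mathcal{L}_\alpha}$. The first Lagrangian obstruction $\mathcal{G}_1$ vanishes if and only if the form $\Theta$ is $d''$-exact (i.e. $\Theta=d''\lambda$ for a global form $\lambda$ of type $(1,0)$).
   Context: Everything is $C^\infty$. A tangent manifold $(M^{2n},S)$ is a manifold with $S\in\Gamma End(TM)$, $S^2=0$, $im\,S=ker\,S$ and vanishing Nijenhuis tensor; equivalently there is an atlas of adapted coordinates $(x^i,y^i)$ with $S(\partial/\partial x^i)=\partial/\partial y^i$, $S(\partial/\partial y^i)=0$. The vertical foliation $\mathcal{V}$ has $T\mathcal{V}=im\,S$, and $\nu\mathcal{V}=TM/T\mathcal{V}$. For a local function $\mathcal{L}$, $g_\mathcal{L}$ is the section of $\odot^2\nu^*\mathcal{V}$ with components $\partial^2\mathcal{L}/\partial y^i\partial y^j$ in adapted coordinates, and $\theta_\mathcal{L}=\frac{\partial\mathcal{L}}{\partial y^i}dx^i$; $\mathcal{L}$ is regular if $g_\mathcal{L}$ is non degenerate on $\nu\mathcal{V}$. A locally Lagrange space is a tangent manifold with a non degenerate $g\in\Gamma\odot^2\nu^*\mathcal{V}$, an open covering $M=\cup U_\alpha$ (by adapted coordinate neighborhoods) and regular $\mathcal{L}_\alpha\in C^\infty(U_\alpha)$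 with $g|_{U_\alpha}=g_{\mathcal{L}_\alpha}$. On $U_\alpha\cap U_\beta$ the difference $\mathcal{L}_\beta-\mathcal{L}_\alpha$ is locally of the form $\varphi_i(x)y^i+b(x)$. Let $\underline{\Omega}^{(1,0)}_{pr}$ be the sheaf of germs of foliated $1$-forms (locally $\varphi_i(x)dx^i$). The first Lagrangian obstruction $\mathcal{G}_1\in H^1(M,\underline{\Omega}^{(1,0)}_{pr})$ is the class of the cocycle $\{\theta_{\mathcal{L}_\beta}-\theta_{\mathcal{L}_\alpha}\}$. A normal bundle is a distribution $N\mathcal{V}$ with $TM=N\mathcal{V}\oplus T\mathcal{V}$. It induces a bigrading of forms: type $(p,q)$ means $p$ factors in $ann(T\mathcal{V})$ and $q$ factors in $ann(N\mathcal{V})$. The exterior differential decomposes as $d=d'_{(1,0)}+d''_{(0,1)}+\partial_{(2,-1)}$; $d''$ is the component of type $(0,1)$, and $(d'')^2=0$. If $N\mathcal{V}$ is locally spanned by $\partial/\partial x^i-t_i^j\partial/\partial y^j$ and $\vartheta^i=dy^i+t^i_jdx^j$, then $\Theta=\frac{\partial^2\mathcal{L}_\alpha}{\partial y^i\partial y^j}\vartheta^i\wedge dx^j$ on $U_\alpha$. An almost symplectic structure is a non degenerate $2$-form. *)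

theory Defs
  imports "HOL-Analysis.Analysis" "HOL-Combinatorics.Permutations"
begin

section \<open>Smooth maps between Euclidean spaces\<close>

text \<open>Both notions are meant for open \<open>X\<close>.\<close>

primrec Ck_on :: "nat \<Rightarrow> 'a::euclidean_space set \<Rightarrow> ('a \<Rightarrow> 'b::real_normed_vector) \<Rightarrow> bool" where
  "Ck_on 0 X f \<longleftrightarrow> continuous_on X f"
| "Ck_on (Suc k) X f \<longleftrightarrow>
     (\<forall>x\<in>X. f differentiable (at x)) \<and> (\<forall>v. Ck_on k X (\<lambda>x. frechet_derivative f (at x) v))"

definition smooth_on :: "'a::euclidean_space set \<Rightarrow> ('a \<Rightarrow> 'b::real_normed_vector) \<Rightarrow> bool" where
  "smooth_on X f \<longleftrightarrow> (\<forall>k. Ck_on k X f)"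


section \<open>Manifolds\<close>

text \<open>
  A manifold is a whole type \<open>'m\<close> carrying a maximal smooth atlas of charts with values in
  the model space \<open>'e\<close>.  A chart is its domain together with its coordinate map; the values
  of the map outside the domain are irrelevant.
\<close>

type_synonym ('m, 'e) chart = "'m set \<times> ('m \<Rightarrow> 'e)"

abbreviation cdom :: "('m, 'e) chart \<Rightarrow> 'm set" where "cdom \<equiv> fst"
abbreviation cmap :: "('m, 'e) chart \<Rightarrow> 'm \<Rightarrow> 'e" where "cmap \<equiv> snd"

definition cinv :: "('m, 'e) chart \<Rightarrow> 'e \<Rightarrow> 'm" where
  "cinv c = inv_into (cdom c) (cmap c)"

definition is_chart :: "('m::topological_space, 'e::euclidean_space) chart \<Rightarrow> bool" where
  "is_chart c \<longleftrightarrow> open (cdom c) \<and> open (cmap c ` cdom c) \<and>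
     homeomorphism (cdom c) (cmap c ` cdom c) (cmap c) (cinv c)"

definition compatible ::
  "('m, 'e::euclidean_space) chart \<Rightarrow> ('m, 'e) chart \<Rightarrow> bool" where
  "compatible c c' \<longleftrightarrow>
     smooth_on (cmap c ` (cdom c \<inter> cdom c')) (cmap c' \<circ> cinv c) \<and>
     smooth_on (cmap c' ` (cdom c \<inter> cdom c')) (cmap c \<circ> cinv c')"

definition smooth_manifold ::
  "('m::{t2_space, second_countable_topology}, 'e::euclidean_space) chart set \<Rightarrow> bool" where
  "smooth_manifold A \<longleftrightarrow>
     (\<forall>c\<in>A. is_chart c) \<and> (\<Union>c\<in>A. cdom c) = UNIV \<and>
     (\<forall>c\<in>A. \<forall>c'\<in>A. compatible c c') \<and>
     (\<forall>c. is_chart c \<and> (\<forall>c'\<in>A. compatible c c') \<longrightarrow> c \<in> A)"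

definition smooth_function ::
  "('m, 'e::euclidean_space) chart set \<Rightarrow> 'm set \<Rightarrow> ('m \<Rightarrow> real) \<Rightarrow> bool" where
  "smooth_function A W f \<longleftrightarrow> (\<forall>c\<in>A. smooth_on (cmap c ` (cdom c \<inter> W)) (f \<circ> cinv c))"


section \<open>Tangent vectors\<close>

text \<open>
  A tangent vector at \<open>p\<close> is a class of pairs (chart around \<open>p\<close>, component vector in \<open>'e\<close>),
  two pairs being identified when the Jacobian of the transition map relates their components.
  Each class has exactly one representative whose chart is \<open>chart_at A p\<close>, a chart selected
  arbitrarily at every point; this representative identifies the tangent space at \<open>p\<close> with
  the vector space \<open>'e\<close>.  The identification need not depend even continuously on \<open>p\<close>, so
  smoothness of a tensor field is always tested on its components in the charts of the atlas.

  For a chart \<open>c\<close> around \<open>p\<close>, \<open>components A c p v\<close> are the components in \<open>c\<close> of the tangent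
  vector \<open>v\<close> at \<open>p\<close> (the differential of \<open>c\<close> at \<open>p\<close>), and \<open>tangent_vector A c p e\<close> is the
  tangent vector at \<open>p\<close> whose components in \<open>c\<close> are \<open>e\<close>.
\<close>

definition chart_at :: "('m, 'e) chart set \<Rightarrow> 'm \<Rightarrow> ('m, 'e) chart" where
  "chart_at A p = (SOME c. c \<in> A \<and> p \<in> cdom c)"

definition components ::
  "('m, 'e::euclidean_space) chart set \<Rightarrow> ('m, 'e) chart \<Rightarrow> 'm \<Rightarrow> 'e \<Rightarrow> 'e" where
  "components A c p =
     frechet_derivative (cmap c \<circ> cinv (chart_at A p)) (at (cmap (chart_at A p) p))"

definition tangent_vector ::
  "('m, 'e::euclidean_space) chart set \<Rightarrow> ('m, 'e) chart \<Rightarrow> 'm \<Rightarrow> 'e \<Rightarrow> 'e" where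
  "tangent_vector A c p =
     frechet_derivative (cmap (chart_at A p) \<circ> cinv c) (at (cmap c p))"

definition field_rep ::
  "('m, 'e::euclidean_space) chart set \<Rightarrow> ('m, 'e) chart \<Rightarrow> ('m \<Rightarrow> 'e) \<Rightarrow> 'e \<Rightarrow> 'e" where
  "field_rep A c X u = components A c (cinv c u) (X (cinv c u))"

definition vector_field ::
  "('m, 'e::euclidean_space) chart set \<Rightarrow> 'm set \<Rightarrow> ('m \<Rightarrow> 'e) \<Rightarrow> bool" where
  "vector_field A W X \<longleftrightarrow> (\<forall>c\<in>A. smooth_on (cmap c ` (cdom c \<inter> W)) (field_rep A c X))"

text \<open>
  \<open>[X,Y]\<^sup>i = X\<^sup>j \<partial>\<^sub>j Y\<^sup>i - Y\<^sup>j \<partial>\<^sub>j X\<^sup>i\<close>, computed in the selected chart; for smooth fields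
  every chart around \<open>p\<close> gives the same tangent vector.
\<close>

definition lie_bracket ::
  "('m, 'e::euclidean_space) chart set \<Rightarrow> ('m \<Rightarrow> 'e) \<Rightarrow> ('m \<Rightarrow> 'e) \<Rightarrow> 'm \<Rightarrow> 'e" where
  "lie_bracket A X Y p =
     (let c = chart_at A p; u = cmap c p in
      tangent_vector A c p
        (frechet_derivative (field_rep A c Y) (at u) (field_rep A c X u)
         - frechet_derivative (field_rep A c X) (at u) (field_rep A c Y u)))"

definition smooth_distribution ::
  "('m::topological_space, 'e::euclidean_space) chart set \<Rightarrow> nat \<Rightarrow> ('m \<Rightarrow> 'e set) \<Rightarrow> bool" where
  "smooth_distribution A r N \<longleftrightarrow>
     (\<forall>p. subspace (N p) \<and> dim (N p) = r) \<and>
     (\<forall>p. \<exists>W X. open W \<and> p \<in> W \<and> (\<forall>i<r. vector_field A W (X i)) \<and>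
        (\<forall>q\<in>W. N q = span ((\<lambda>i. X i q) ` {..<r})))"


section \<open>Differential forms\<close>

text \<open>
  A \<open>k\<close>-covector takes a list of \<open>k\<close> tangent vectors as arguments, and is \<open>0\<close> on lists of
  any other length.
\<close>

type_synonym ('m, 'e) dform = "'m \<Rightarrow> 'e list \<Rightarrow> real"

definition alternating_form :: "nat \<Rightarrow> ('e::real_vector list \<Rightarrow> real) \<Rightarrow> bool" where
  "alternating_form k \<omega> \<longleftrightarrow>
     (\<forall>vs. length vs \<noteq> k \<longrightarrow> \<omega> vs = 0) \<and>
     (\<forall>vs i. length vs = k \<and> i < k \<longrightarrow> linear (\<lambda>v. \<omega> (vs[i := v]))) \<and>
     (\<forall>vs i j. length vs = k \<and> i < j \<and> j < k \<and> vs ! i = vs ! j \<longrightarrow> \<omega> vs = 0)"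

definition form_rep ::
  "('m, 'e::euclidean_space) chart set \<Rightarrow> ('m, 'e) chart \<Rightarrow> ('m, 'e) dform \<Rightarrow> 'e \<Rightarrow> 'e list \<Rightarrow> real" where
  "form_rep A c \<omega> u es = \<omega> (cinv c u) (map (tangent_vector A c (cinv c u)) es)"

definition differential_form ::
  "('m, 'e::euclidean_space) chart set \<Rightarrow> nat \<Rightarrow> 'm set \<Rightarrow> ('m, 'e) dform \<Rightarrow> bool" where
  "differential_form A k W \<omega> \<longleftrightarrow>
     (\<forall>p\<in>W. alternating_form k (\<omega> p)) \<and>
     (\<forall>c\<in>A. \<forall>es. smooth_on (cmap c ` (cdom c \<inter> W)) (\<lambda>u. form_rep A c \<omega> u es))"

text \<open>
  \<open>(d\<omega>)(v\<^sub>0,\<dots>,v\<^sub>k) = \<Sum>\<^sub>i (-1)\<^sup>i D\<omega>(v\<^sub>i)(v\<^sub>0,\<dots>,v\<^sub>i\<^sub>-\<^sub>1,v\<^sub>i\<^sub>+\<^sub>1,\<dots>,v\<^sub>k)\<close> in coordinates; by naturality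
  of the exterior derivative the selected chart may be replaced by any chart around \<open>p\<close>.
\<close>

definition ext_deriv_coord ::
  "('e::euclidean_space \<Rightarrow> 'e list \<Rightarrow> real) \<Rightarrow> 'e \<Rightarrow> 'e list \<Rightarrow> real" where
  "ext_deriv_coord f u es =
     (\<Sum>i<length es. (-1) ^ i *
        frechet_derivative (\<lambda>x. f x (take i es @ drop (Suc i) es)) (at u) (es ! i))"

definition ext_deriv ::
  "('m, 'e::euclidean_space) chart set \<Rightarrow> ('m, 'e) dform \<Rightarrow> ('m, 'e) dform" where
  "ext_deriv A \<omega> p vs =
     (let c = chart_at A p in
      ext_deriv_coord (form_rep A c \<omega>) (cmap c p) (map (components A c p) vs))"

definition almost_symplectic ::
  "('m, 'e::euclidean_space) chart set \<Rightarrow> ('m, 'e) dform \<Rightarrow> bool" where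
  "almost_symplectic A \<Theta> \<longleftrightarrow>
     differential_form A 2 UNIV \<Theta> \<and> (\<forall>p v. (\<forall>w. \<Theta> p [v, w] = 0) \<longrightarrow> v = 0)"


section \<open>Tangent manifolds\<close>

text \<open>
  The model space of a manifold of dimension \<open>2n\<close> is \<open>real^'n \<times> real^'n\<close>, so that charts are
  pairs \<open>(x, y)\<close>.  An endomorphism field \<open>S\<close> acts on the tangent space at \<open>p\<close> by \<open>S p\<close>.
\<close>

definition endomorphism_field ::
  "('m, 'e::euclidean_space) chart set \<Rightarrow> ('m \<Rightarrow> 'e \<Rightarrow> 'e) \<Rightarrow> bool" where
  "endomorphism_field A S \<longleftrightarrow>
     (\<forall>p. linear (S p)) \<and>
     (\<forall>c\<in>A. \<forall>e. smooth_on (cmap c ` cdom c)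
        (\<lambda>u. components A c (cinv c u) (S (cinv c u) (tangent_vector A c (cinv c u) e))))"

definition nijenhuis ::
  "('m, 'e::euclidean_space) chart set \<Rightarrow> ('m \<Rightarrow> 'e \<Rightarrow> 'e) \<Rightarrow> ('m \<Rightarrow> 'e) \<Rightarrow> ('m \<Rightarrow> 'e) \<Rightarrow> 'm \<Rightarrow> 'e" where
  "nijenhuis A S X Y p =
     lie_bracket A (\<lambda>q. S q (X q)) (\<lambda>q. S q (Y q)) p
     - S p (lie_bracket A (\<lambda>q. S q (X q)) Y p)
     - S p (lie_bracket A X (\<lambda>q. S q (Y q)) p)
     + S p (S p (lie_bracket A X Y p))"

definition tangent_manifold ::
  "('m::{t2_space, second_countable_topology}, (real^'n) \<times> (real^'n)) chart set
    \<Rightarrow> ('m \<Rightarrow> (real^'n) \<times> (real^'n) \<Rightarrow> (real^'n) \<times> (real^'n)) \<Rightarrow> bool" where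
  "tangent_manifold A S \<longleftrightarrow>
     smooth_manifold A \<and> endomorphism_field A S \<and>
     (\<forall>p v. S p (S p v) = 0) \<and>
     (\<forall>p. range (S p) = {v. S p v = 0}) \<and>
     (\<forall>X Y. vector_field A UNIV X \<and> vector_field A UNIV Y \<longrightarrow> (\<forall>p. nijenhuis A S X Y p = 0))"

text \<open>The tangent spaces of the vertical foliation.\<close>

definition vertical :: "('m \<Rightarrow> 'e \<Rightarrow> 'e) \<Rightarrow> 'm \<Rightarrow> 'e set" where
  "vertical S p = range (S p)"

text \<open>\<open>S(\<partial>/\<partial>x\<^sup>i) = \<partial>/\<partial>y\<^sup>i\<close> and \<open>S(\<partial>/\<partial>y\<^sup>i) = 0\<close>.\<close>

definition adapted_chart ::
  "('m, (real^'n) \<times> (real^'n)) chart set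
    \<Rightarrow> ('m \<Rightarrow> (real^'n) \<times> (real^'n) \<Rightarrow> (real^'n) \<times> (real^'n))
    \<Rightarrow> ('m, (real^'n) \<times> (real^'n)) chart \<Rightarrow> bool" where
  "adapted_chart A S c \<longleftrightarrow> c \<in> A \<and>
     (\<forall>p\<in>cdom c. \<forall>i.
        S p (tangent_vector A c p (axis i 1, 0)) = tangent_vector A c p (0, axis i 1) \<and>
        S p (tangent_vector A c p (0, axis i 1)) = 0)"

definition adapted_chart_at ::
  "('m, (real^'n) \<times> (real^'n)) chart set
    \<Rightarrow> ('m \<Rightarrow> (real^'n) \<times> (real^'n) \<Rightarrow> (real^'n) \<times> (real^'n))
    \<Rightarrow> 'm \<Rightarrow> ('m, (real^'n) \<times> (real^'n)) chart" where
  "adapted_chart_at A S p = (SOME c. adapted_chart A S c \<and> p \<in> cdom c)"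

definition dx ::
  "('m, (real^'n) \<times> (real^'n)) chart set \<Rightarrow> ('m, (real^'n) \<times> (real^'n)) chart
    \<Rightarrow> 'n \<Rightarrow> 'm \<Rightarrow> (real^'n) \<times> (real^'n) \<Rightarrow> real" where
  "dx A c i p v = fst (components A c p v) $ i"


section \<open>Locally Lagrange spaces\<close>

definition partial_y ::
  "'n::finite \<Rightarrow> ((real^'n) \<times> (real^'n) \<Rightarrow> real) \<Rightarrow> (real^'n) \<times> (real^'n) \<Rightarrow> real" where
  "partial_y i f u = frechet_derivative f (at u) (0, axis i 1)"

text \<open>
  The next two objects do not depend on the adapted chart around \<open>p\<close> in which they are
  computed.
\<close>

definition theta ::
  "('m, (real^'n) \<times> (real^'n)) chart set
    \<Rightarrow> ('m \<Rightarrow> (real^'n) \<times> (real^'n) \<Rightarrow> (real^'n) \<times> (real^'n))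
    \<Rightarrow> ('m \<Rightarrow> real) \<Rightarrow> ('m, (real^'n) \<times> (real^'n)) dform" where
  "theta A S L p vs =
     (case vs of [v] \<Rightarrow>
        (let c = adapted_chart_at A S p in
         \<Sum>i\<in>UNIV. partial_y i (L \<circ> cinv c) (cmap c p) * dx A c i p v)
      | _ \<Rightarrow> 0)"

definition vertical_hessian ::
  "('m, (real^'n) \<times> (real^'n)) chart set
    \<Rightarrow> ('m \<Rightarrow> (real^'n) \<times> (real^'n) \<Rightarrow> (real^'n) \<times> (real^'n))
    \<Rightarrow> ('m \<Rightarrow> real) \<Rightarrow> 'm \<Rightarrow> (real^'n) \<times> (real^'n) \<Rightarrow> (real^'n) \<times> (real^'n) \<Rightarrow> real" where
  "vertical_hessian A S L p v w =
     (let c = adapted_chart_at A S p in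
      \<Sum>i\<in>UNIV. \<Sum>j\<in>UNIV.
        partial_y i (partial_y j (L \<circ> cinv c)) (cmap c p) * dx A c i p v * dx A c j p w)"

text \<open>
  A bilinear form on the quotient of the tangent space by the vertical space is represented
  by its pullback to the tangent space, i.e. by a bilinear form that vanishes as soon as one
  of its arguments is vertical.
\<close>

definition transverse_nondegenerate ::
  "('m \<Rightarrow> 'e \<Rightarrow> 'e) \<Rightarrow> 'm \<Rightarrow> ('e \<Rightarrow> 'e \<Rightarrow> real) \<Rightarrow> bool" where
  "transverse_nondegenerate S p h \<longleftrightarrow> (\<forall>v. (\<forall>w. h v w = 0) \<longrightarrow> v \<in> vertical S p)"

definition transverse_symmetric_form ::
  "('m, 'e::euclidean_space) chart set \<Rightarrow> ('m \<Rightarrow> 'e \<Rightarrow> 'e) \<Rightarrow> ('m \<Rightarrow> 'e \<Rightarrow> 'e \<Rightarrow> real) \<Rightarrow> bool" where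
  "transverse_symmetric_form A S g \<longleftrightarrow>
     (\<forall>p. bilinear (g p) \<and> (\<forall>v w. g p v w = g p w v) \<and>
          (\<forall>v\<in>vertical S p. \<forall>w. g p v w = 0)) \<and>
     (\<forall>c\<in>A. \<forall>e e'. smooth_on (cmap c ` cdom c)
        (\<lambda>u. g (cinv c u) (tangent_vector A c (cinv c u) e) (tangent_vector A c (cinv c u) e')))"

definition regular_lagrangian ::
  "('m, (real^'n) \<times> (real^'n)) chart set
    \<Rightarrow> ('m \<Rightarrow> (real^'n) \<times> (real^'n) \<Rightarrow> (real^'n) \<times> (real^'n))
    \<Rightarrow> 'm set \<Rightarrow> ('m \<Rightarrow> real) \<Rightarrow> bool" where
  "regular_lagrangian A S W L \<longleftrightarrow>
     smooth_function A W L \<and>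
     (\<forall>p\<in>W. transverse_nondegenerate S p (vertical_hessian A S L p))"

definition locally_lagrange ::
  "('m::{t2_space, second_countable_topology}, (real^'n) \<times> (real^'n)) chart set
    \<Rightarrow> ('m \<Rightarrow> (real^'n) \<times> (real^'n) \<Rightarrow> (real^'n) \<times> (real^'n))
    \<Rightarrow> ('m \<Rightarrow> (real^'n) \<times> (real^'n) \<Rightarrow> (real^'n) \<times> (real^'n) \<Rightarrow> real)
    \<Rightarrow> 'i set \<Rightarrow> ('i \<Rightarrow> 'm set) \<Rightarrow> ('i \<Rightarrow> 'm \<Rightarrow> real) \<Rightarrow> bool" where
  "locally_lagrange A S g I U L \<longleftrightarrow>
     tangent_manifold A S \<and>
     transverse_symmetric_form A S g \<and> (\<forall>p. transverse_nondegenerate S p (g p)) \<and>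
     (\<Union>\<alpha>\<in>I. U \<alpha>) = UNIV \<and>
     (\<forall>\<alpha>\<in>I. \<exists>c. adapted_chart A S c \<and> cdom c = U \<alpha>) \<and>
     (\<forall>\<alpha>\<in>I. regular_lagrangian A S (U \<alpha>) (L \<alpha>) \<and>
        (\<forall>p\<in>U \<alpha>. g p = vertical_hessian A S (L \<alpha>) p))"


section \<open>Normal bundles, bigrading and \<open>d''\<close>\<close>

definition normal_bundle ::
  "('m::topological_space, (real^'n) \<times> (real^'n)) chart set
    \<Rightarrow> ('m \<Rightarrow> (real^'n) \<times> (real^'n) \<Rightarrow> (real^'n) \<times> (real^'n))
    \<Rightarrow> ('m \<Rightarrow> ((real^'n) \<times> (real^'n)) set) \<Rightarrow> bool" where
  "normal_bundle A S N \<longleftrightarrow>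
     smooth_distribution A CARD('n) N \<and>
     (\<forall>p. N p \<inter> vertical S p = {0} \<and> {a + b | a b. a \<in> N p \<and> b \<in> vertical S p} = UNIV)"

definition normal_part ::
  "('m \<Rightarrow> 'e::real_vector \<Rightarrow> 'e) \<Rightarrow> ('m \<Rightarrow> 'e set) \<Rightarrow> 'm \<Rightarrow> 'e \<Rightarrow> 'e" where
  "normal_part S N p v = (THE a. a \<in> N p \<and> v - a \<in> vertical S p)"

definition vertical_part ::
  "('m \<Rightarrow> 'e::real_vector \<Rightarrow> 'e) \<Rightarrow> ('m \<Rightarrow> 'e set) \<Rightarrow> 'm \<Rightarrow> 'e \<Rightarrow> 'e" where
  "vertical_part S N p v = v - normal_part S N p v"

definition annihilator :: "'e::real_vector set \<Rightarrow> ('e \<Rightarrow> real) set" where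
  "annihilator B = {\<alpha>. linear \<alpha> \<and> (\<forall>v\<in>B. \<alpha> v = 0)}"

definition wedge :: "nat \<Rightarrow> (nat \<Rightarrow> 'e \<Rightarrow> real) \<Rightarrow> 'e list \<Rightarrow> real" where
  "wedge k \<alpha> vs =
     (if length vs = k
      then \<Sum>\<pi> | \<pi> permutes {..<k}. of_int (sign \<pi>) * (\<Prod>i<k. \<alpha> i (vs ! \<pi> i))
      else 0)"

text \<open>
  Type \<open>(p,q)\<close>: at each point a sum of products of \<open>p\<close> covectors that annihilate the vertical
  space and \<open>q\<close> covectors that annihilate the normal space.
\<close>

definition has_type ::
  "('m \<Rightarrow> 'e::real_vector \<Rightarrow> 'e) \<Rightarrow> ('m \<Rightarrow> 'e set) \<Rightarrow> nat \<Rightarrow> nat \<Rightarrow> 'm set \<Rightarrow> ('m, 'e) dform \<Rightarrow> bool" where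
  "has_type S N p q W \<omega> \<longleftrightarrow>
     (\<forall>x\<in>W. \<exists>(m::nat) \<alpha>.
        (\<forall>r<m. (\<forall>i<p. \<alpha> r i \<in> annihilator (vertical S x)) \<and>
               (\<forall>i\<in>{p..<p + q}. \<alpha> r i \<in> annihilator (N x))) \<and>
        \<omega> x = (\<lambda>vs. \<Sum>r<m. wedge (p + q) (\<alpha> r) vs))"

text \<open>
  The projection of a form of degree \<open>p + q\<close> to its component of type \<open>(p,q)\<close>: split every
  argument into its normal and vertical parts, expand, and keep the terms with exactly \<open>p\<close>
  normal arguments.
\<close>

definition type_component ::
  "('m \<Rightarrow> 'e::real_vector \<Rightarrow> 'e) \<Rightarrow> ('m \<Rightarrow> 'e set) \<Rightarrow> nat \<Rightarrow> nat \<Rightarrow> ('m, 'e) dform \<Rightarrow> ('m, 'e) dform" where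
  "type_component S N p q \<omega> x vs =
     (if length vs = p + q
      then \<Sum>J | J \<subseteq> {..<p + q} \<and> card J = p.
             \<omega> x (map (\<lambda>i. if i \<in> J then normal_part S N x (vs ! i)
                                     else vertical_part S N x (vs ! i)) [0..<p + q])
      else 0)"

text \<open>
  The component of type \<open>(0,1)\<close> of the exterior derivative, on forms of degree \<open>k\<close>: a form
  of type \<open>(p,q)\<close> is sent to the component of type \<open>(p,q+1)\<close> of its exterior derivative.
\<close>

definition d_vert ::
  "('m, 'e::euclidean_space) chart set \<Rightarrow> ('m \<Rightarrow> 'e \<Rightarrow> 'e) \<Rightarrow> ('m \<Rightarrow> 'e set)
    \<Rightarrow> nat \<Rightarrow> ('m, 'e) dform \<Rightarrow> ('m, 'e) dform" where
  "d_vert A S N k \<omega> x vs =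
     (\<Sum>p\<le>k. type_component S N p (k - p + 1)
        (ext_deriv A (type_component S N p (k - p) \<omega>)) x vs)"


section \<open>First cohomology of a sheaf of forms\<close>

text \<open>
  The first cohomology of a sheaf is taken in the sense of Cech, i.e. as the direct limit
  over all open coverings.  A sheaf of forms is given by its sections \<open>F W\<close> over the open sets \<open>W\<close>;
  restriction is the identity on the underlying functions, and sections over \<open>W\<close> are equal
  if they agree at the points of \<open>W\<close>.  A covering may be indexed by an arbitrary type.
  As every covering is refined by one indexed by its own members, the elements of the direct
  limit are represented by cocycles on such self-indexed coverings.
\<close>

definition open_covering :: "'i set \<Rightarrow> ('i \<Rightarrow> 'm::topological_space set) \<Rightarrow> bool" where
  "open_covering I U \<longleftrightarrow> (\<forall>i\<in>I. open (U i)) \<and> (\<Union>i\<in>I. U i) = UNIV"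

definition cocycle ::
  "('m set \<Rightarrow> ('m, 'e) dform set) \<Rightarrow> 'i set \<Rightarrow> ('i \<Rightarrow> 'm set) \<Rightarrow> ('i \<Rightarrow> 'i \<Rightarrow> ('m, 'e) dform) \<Rightarrow> bool" where
  "cocycle F I U z \<longleftrightarrow>
     (\<forall>i\<in>I. \<forall>j\<in>I. z i j \<in> F (U i \<inter> U j)) \<and>
     (\<forall>i\<in>I. \<forall>j\<in>I. \<forall>k\<in>I. \<forall>x\<in>U i \<inter> U j \<inter> U k. \<forall>vs. z j k x vs - z i k x vs + z i j x vs = 0)"

text \<open>Two cocycles on two coverings differ by a coboundary on a common refinement \<open>K\<close>.\<close>

definition cohomologous ::
  "('m::topological_space set \<Rightarrow> ('m, 'e) dform set)
    \<Rightarrow> 'i set \<Rightarrow> ('i \<Rightarrow> 'm set) \<Rightarrow> ('i \<Rightarrow> 'i \<Rightarrow> ('m, 'e) dform)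
    \<Rightarrow> 'j set \<Rightarrow> ('j \<Rightarrow> 'm set) \<Rightarrow> ('j \<Rightarrow> 'j \<Rightarrow> ('m, 'e) dform) \<Rightarrow> bool" where
  "cohomologous F I U z J V y \<longleftrightarrow>
     (\<exists>(K :: 'm set set) \<sigma> \<tau> b.
        open_covering K (\<lambda>W. W) \<and>
        (\<forall>W\<in>K. \<sigma> W \<in> I \<and> W \<subseteq> U (\<sigma> W) \<and> \<tau> W \<in> J \<and> W \<subseteq> V (\<tau> W)) \<and>
        (\<forall>W\<in>K. b W \<in> F W) \<and>
        (\<forall>W\<in>K. \<forall>W'\<in>K. \<forall>x\<in>W \<inter> W'. \<forall>vs.
           z (\<sigma> W) (\<sigma> W') x vs - y (\<tau> W) (\<tau> W') x vs = b W' x vs - b W x vs))"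

definition cohomology_class ::
  "('m::topological_space set \<Rightarrow> ('m, 'e) dform set)
    \<Rightarrow> 'i set \<Rightarrow> ('i \<Rightarrow> 'm set) \<Rightarrow> ('i \<Rightarrow> 'i \<Rightarrow> ('m, 'e) dform)
    \<Rightarrow> ('m set set \<times> ('m set \<Rightarrow> 'm set \<Rightarrow> ('m, 'e) dform)) set" where
  "cohomology_class F I U z =
     {(K, y). open_covering K (\<lambda>W. W) \<and> cocycle F K (\<lambda>W. W) y \<and>
              cohomologous F I U z K (\<lambda>W. W) y}"

definition trivial_class ::
  "('m::topological_space set \<Rightarrow> ('m, 'e) dform set)
    \<Rightarrow> ('m set set \<times> ('m set \<Rightarrow> 'm set \<Rightarrow> ('m, 'e) dform)) set" where
  "trivial_class F = cohomology_class F {UNIV :: 'm set} (\<lambda>W. W) (\<lambda>_ _ _ _. 0)"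

text \<open>Sections over \<open>W\<close> of the sheaf of foliated 1-forms, locally \<open>\<phi>\<^sub>i(x) dx\<^sup>i\<close>.\<close>

definition foliated_forms ::
  "('m, (real^'n) \<times> (real^'n)) chart set
    \<Rightarrow> ('m \<Rightarrow> (real^'n) \<times> (real^'n) \<Rightarrow> (real^'n) \<times> (real^'n))
    \<Rightarrow> 'm set \<Rightarrow> ('m, (real^'n) \<times> (real^'n)) dform set" where
  "foliated_forms A S W =
     {\<omega>. differential_form A 1 W \<omega> \<and>
         (\<forall>p\<in>W. \<exists>c \<phi>. adapted_chart A S c \<and> p \<in> cdom c \<and> cdom c \<subseteq> W \<and>
            (\<forall>q\<in>cdom c. \<forall>v.
               \<omega> q [v] = (\<Sum>i\<in>UNIV. \<phi> i (fst (cmap c q)) * dx A c i q v)))}"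

definition first_obstruction ::
  "('m::topological_space, (real^'n) \<times> (real^'n)) chart set
    \<Rightarrow> ('m \<Rightarrow> (real^'n) \<times> (real^'n) \<Rightarrow> (real^'n) \<times> (real^'n))
    \<Rightarrow> 'i set \<Rightarrow> ('i \<Rightarrow> 'm set) \<Rightarrow> ('i \<Rightarrow> 'm \<Rightarrow> real)
    \<Rightarrow> ('m set set \<times> ('m set \<Rightarrow> 'm set \<Rightarrow> ('m, (real^'n) \<times> (real^'n)) dform)) set" where
  "first_obstruction A S I U L =
     cohomology_class (foliated_forms A S) I U
       (\<lambda>\<alpha> \<beta> p vs. theta A S (L \<beta>) p vs - theta A S (L \<alpha>) p vs)"

end

(*
  On a form omega = phi_i dx^i of type (1,0), d'' is the derivative of the coefficients in the
  vertical directions: (d'' omega)(v,w) = D_{Vv} omega(w) - D_{Vw} omega(v), with V the projection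
  to the vertical space along the normal bundle.  For omega = theta_L these derivatives are the
  vertical Hessian of L.  Hence d'' theta_L depends on g and the normal bundle only, so that the
  local forms glue, and it is non degenerate because g is; d'' d'' = 0 is the symmetry of second
  derivatives.  The kernel of d'' on forms of type (1,0) is the sheaf of foliated forms.  Thus a
  cochain b with theta_beta - theta_alpha = b_beta - b_alpha is the same thing as a global form
  lambda = theta_alpha - b_alpha with d'' lambda = Theta, and no partition of unity is involved.
*)
theory Submission
  imports Defs
begin

section \<open>Smooth maps\<close>

text \<open>Tangent vectors, \<open>ext_deriv\<close>, \<open>theta\<close> and
  \<open>vertical_hessian\<close> are defined through charts selected independently at each point,
  so an object has to be moved to one fixed chart before it can be differentiated. The delicate
  transfer is that of \<open>ext_deriv\<close>, where the second derivative of the transition map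
  must cancel. A second obstacle is that forms are known to be smooth on arguments with constant
  components, whereas a change of chart and the projection \<open>vert\<close> insert moving
  arguments; expansion in a finite basis bridges this gap. In an adapted chart a vector with
  constant components that is vertical at one point is vertical everywhere. So a form of type (1,0)
  vanishes identically on it, which removes all derivatives along normal directions from d'', and a
  component of d'' omega with a vertical argument does not involve the position of the normal
  bundle. If two of three arguments are vertical, every pair of them contains a vertical one; for
  this reason d'' d'' = 0 can be checked without differentiating the normal bundle.\<close>

lemma has_derivative_frechet_derivative:
  "f differentiable (at x) \<Longrightarrow> (f has_derivative frechet_derivative f (at x)) (at x)"
  by (simp add: frechet_derivative_works)

lemma frechet_derivative_cong_open:
  assumes "open X" "x \<in> X" "\<And>y. y \<in> X \<Longrightarrow> f y = g y"
  shows "frechet_derivative f (at x) = frechet_derivative g (at x)"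
proof -
  have "(f has_derivative D) (at x) \<longleftrightarrow> (g has_derivative D) (at x)" for D
    using assms has_derivative_transform_within_open[of _ D x UNIV X] by metis
  then show ?thesis by (simp add: frechet_derivative_def)
qed

lemma differentiable_cong_open:
  assumes "open X" "x \<in> X" "\<And>y. y \<in> X \<Longrightarrow> f y = g y" "f differentiable (at x)"
  shows "g differentiable (at x)"
  using assms unfolding differentiable_def
  by (metis has_derivative_transform_within_open)

section \<open>Maps of class C^k: locality, sums, products, composition and reciprocals\<close>

lemma Ck_on_imp_continuous_on: "Ck_on k X f \<Longrightarrow> continuous_on X f"
  by (cases k) (auto intro!: continuous_at_imp_continuous_on differentiable_imp_continuous_within)

lemma Ck_on_Suc_imp: "Ck_on (Suc k) X f \<Longrightarrow> Ck_on k X f"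
proof (induction k arbitrary: f)
  case 0
  then show ?case using Ck_on_imp_continuous_on[of "Suc 0"] by simp
next
  case (Suc k)
  show ?case
    unfolding Ck_on.simps(2)[of k]
  proof (intro conjI allI)
    show "\<forall>x\<in>X. f differentiable at x" using Suc.prems by simp
    fix v
    have "Ck_on (Suc k) X (\<lambda>x. frechet_derivative f (at x) v)"
      using Suc.prems Ck_on.simps(2)[of "Suc k" X f] by blast
    then show "Ck_on k X (\<lambda>x. frechet_derivative f (at x) v)" by (rule Suc.IH)
  qed
qed

lemma Ck_on_cong:
  assumes "open X" "Ck_on k X f" "\<And>x. x \<in> X \<Longrightarrow> f x = g x"
  shows "Ck_on k X g"
  using assms(2,3)
proof (induction k arbitrary: f g)
  case 0
  then show ?case by (simp cong: continuous_on_cong)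
next
  case (Suc k)
  have eq: "frechet_derivative f (at x) = frechet_derivative g (at x)" if "x \<in> X" for x
    using frechet_derivative_cong_open[OF assms(1) that] Suc.prems(2) by blast
  have "g differentiable at x" if "x \<in> X" for x
    using differentiable_cong_open[OF assms(1) that, of f g] Suc.prems that by auto
  moreover have "Ck_on k X (\<lambda>x. frechet_derivative g (at x) v)" for v
    using Suc.IH[of "\<lambda>x. frechet_derivative f (at x) v"] Suc.prems eq by simp
  ultimately show ?case by simp
qed

lemma Ck_on_local:
  assumes "\<And>x. x \<in> X \<Longrightarrow> \<exists>Y. open Y \<and> x \<in> Y \<and> Ck_on k Y f"
  shows "Ck_on k X f"
  using assms
proof (induction k arbitrary: f)
  case 0
  show ?case
    unfolding Ck_on.simps
  proof (intro continuous_at_imp_continuous_on ballI)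
    fix x assume "x \<in> X"
    then obtain Y where "open Y" "x \<in> Y" "continuous_on Y f" using 0 by auto
    then show "isCont f x" by (simp add: continuous_on_eq_continuous_at)
  qed
next
  case (Suc k)
  have "f differentiable (at x)" if "x \<in> X" for x
    using Suc.prems[OF that] by auto
  moreover have "Ck_on k X (\<lambda>x. frechet_derivative f (at x) v)" for v
  proof (rule Suc.IH)
    fix x assume "x \<in> X"
    then obtain Y where "open Y" "x \<in> Y" "Ck_on (Suc k) Y f" using Suc.prems by blast
    then show "\<exists>Y. open Y \<and> x \<in> Y \<and> Ck_on k Y (\<lambda>x. frechet_derivative f (at x) v)" by auto
  qed
  ultimately show ?case by simp
qed

lemma Ck_on_subset: "Ck_on k X f \<Longrightarrow> Y \<subseteq> X \<Longrightarrow> Ck_on k Y f"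
  by (induction k arbitrary: f) (auto intro: continuous_on_subset)

lemma Ck_on_const: "Ck_on k X (\<lambda>x. c)"
  by (induction k arbitrary: c) simp_all

lemma Ck_on_add:
  assumes "open X" "Ck_on k X f" "Ck_on k X g"
  shows "Ck_on k X (\<lambda>x. f x + g x)"
  using assms(2,3)
proof (induction k arbitrary: f g)
  case 0
  then show ?case by (simp add: continuous_on_add)
next
  case (Suc k)
  have eq: "frechet_derivative (\<lambda>x. f x + g x) (at x) = (\<lambda>v. frechet_derivative f (at x) v + frechet_derivative g (at x) v)"
    if "x \<in> X" for x
    using that Suc.prems
    by (intro frechet_derivative_at[symmetric] has_derivative_add) (auto simp: has_derivative_frechet_derivative)
  have "Ck_on k X (\<lambda>x. frechet_derivative (\<lambda>x. f x + g x) (at x) v)" for v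
    by (rule Ck_on_cong[OF assms(1)], rule Suc.IH[of "\<lambda>x. frechet_derivative f (at x) v" "\<lambda>x. frechet_derivative g (at x) v"])
       (use Suc.prems eq in auto)
  then show ?case using Suc.prems by simp
qed

lemma (in bounded_linear) Ck_on:
  fixes h :: "'c::euclidean_space \<Rightarrow> 'a"
  assumes "open X" "Ck_on k X h"
  shows "Ck_on k X (\<lambda>x. f (h x))"
  using assms(2)
proof (induction k arbitrary: h)
  case 0
  then show ?case by (simp add: continuous_on)
next
  case (Suc k)
  have eq: "frechet_derivative (\<lambda>x. f (h x)) (at x) = (\<lambda>v. f (frechet_derivative h (at x) v))"
    and df: "(\<lambda>x. f (h x)) differentiable (at x)"
    if "x \<in> X" for x
  proof -
    have "((\<lambda>x. f (h x)) has_derivative (\<lambda>v. f (frechet_derivative h (at x) v))) (at x)"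
      using that Suc.prems by (intro has_derivative) (auto simp: has_derivative_frechet_derivative)
    then show "frechet_derivative (\<lambda>x. f (h x)) (at x) = (\<lambda>v. f (frechet_derivative h (at x) v))"
      "(\<lambda>x. f (h x)) differentiable (at x)"
      by (auto intro: frechet_derivative_at[symmetric] differentiableI)
  qed
  have "Ck_on k X (\<lambda>x. frechet_derivative (\<lambda>x. f (h x)) (at x) v)" for v
    by (rule Ck_on_cong[OF assms(1)], rule Suc.IH[of "\<lambda>x. frechet_derivative h (at x) v"])
       (use Suc.prems eq in auto)
  then show ?case using df by simp
qed

lemma (in bounded_bilinear) Ck_on:
  fixes f :: "'d::euclidean_space \<Rightarrow> 'a" and g :: "'d \<Rightarrow> 'b"
  assumes "open X" "Ck_on k X f" "Ck_on k X g"
  shows "Ck_on k X (\<lambda>x. prod (f x) (g x))"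
  using assms(2,3)
proof (induction k arbitrary: f g)
  case 0
  then show ?case by (simp add: continuous_on)
next
  case (Suc k)
  have der: "((\<lambda>x. prod (f x) (g x)) has_derivative
      (\<lambda>v. prod (f x) (frechet_derivative g (at x) v) + prod (frechet_derivative f (at x) v) (g x))) (at x)"
    if "x \<in> X" for x
    using that Suc.prems by (intro FDERIV) (auto simp: has_derivative_frechet_derivative)
  have eq: "frechet_derivative (\<lambda>x. prod (f x) (g x)) (at x) =
      (\<lambda>v. prod (f x) (frechet_derivative g (at x) v) + prod (frechet_derivative f (at x) v) (g x))"
    if "x \<in> X" for x
    using der[OF that] by (rule frechet_derivative_at[symmetric])
  \<comment> \<open>In the Leibniz rule each product keeps one undifferentiated factor, whose order
    has to be lowered before the induction hypothesis applies.\<close>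
  have "Ck_on k X f" "Ck_on k X g" using Suc.prems Ck_on_Suc_imp by blast+
  moreover have "Ck_on k X (\<lambda>x. frechet_derivative f (at x) v)" "Ck_on k X (\<lambda>x. frechet_derivative g (at x) v)" for v
    using Suc.prems by auto
  ultimately have "Ck_on k X (\<lambda>x. prod (f x) (frechet_derivative g (at x) v) + prod (frechet_derivative f (at x) v) (g x))" for v
    by (intro Ck_on_add[OF assms(1)] Suc.IH)
  then have "Ck_on k X (\<lambda>x. frechet_derivative (\<lambda>x. prod (f x) (g x)) (at x) v)" for v
    by (rule Ck_on_cong[OF assms(1)]) (simp add: eq)
  then show ?case using der by (auto intro: differentiableI)
qed

lemma Ck_on_sum:
  assumes "open X" "\<And>i. i \<in> I \<Longrightarrow> Ck_on k X (f i)"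
  shows "Ck_on k X (\<lambda>x. \<Sum>i\<in>I. f i x)"
  using assms(2) by (induction I rule: infinite_finite_induct) (auto simp: Ck_on_const Ck_on_add[OF assms(1)])

lemma frechet_derivative_eq_sum_Basis:
  fixes f :: "'a::euclidean_space \<Rightarrow> 'b::real_normed_vector"
  assumes "f differentiable (at x)"
  shows "frechet_derivative f (at x) v = (\<Sum>b\<in>Basis. (v \<bullet> b) *\<^sub>R frechet_derivative f (at x) b)"
proof -
  interpret linear "frechet_derivative f (at x)" using assms by (rule linear_frechet_derivative)
  show ?thesis by (subst (1) euclidean_representation[of v, symmetric]) (simp only: sum scale)
qed

text \<open>\<open>Ck_on\<close> controls derivatives in fixed directions, while the chain rule
  differentiates \<open>f\<close> in the moving direction
  \<open>frechet_derivative T (at x) v\<close>. Expanding this direction in the basis leaves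
  derivatives of \<open>f\<close> in fixed directions composed with \<open>T\<close>, to which the
  induction hypothesis applies.\<close>

lemma Ck_on_compose:
  fixes f :: "'a::euclidean_space \<Rightarrow> 'b::real_normed_vector" and T :: "'c::euclidean_space \<Rightarrow> 'a"
  assumes "open X" "Ck_on k Y f" "Ck_on k X T" "T ` X \<subseteq> Y"
  shows "Ck_on k X (\<lambda>x. f (T x))"
  using assms(2,3)
proof (induction k arbitrary: f)
  case 0
  then show ?case using assms(4) by (auto intro: continuous_on_compose2)
next
  case (Suc k)
  have der: "((\<lambda>x. f (T x)) has_derivative (\<lambda>v. frechet_derivative f (at (T x)) (frechet_derivative T (at x) v))) (at x)"
    if "x \<in> X" for x
    using that Suc.prems assms(4) diff_chain_at[of T "frechet_derivative T (at x)" x f]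
    by (auto simp: has_derivative_frechet_derivative o_def)
  have eq: "frechet_derivative (\<lambda>x. f (T x)) (at x) v =
      (\<Sum>b\<in>Basis. (frechet_derivative T (at x) v \<bullet> b) *\<^sub>R frechet_derivative f (at (T x)) b)"
    if "x \<in> X" for x v
  proof -
    have "f differentiable (at (T x))" using Suc.prems assms(4) that by auto
    then show ?thesis
      unfolding frechet_derivative_at[OF der[OF that], symmetric] by (rule frechet_derivative_eq_sum_Basis)
  qed
  have "Ck_on k X (\<lambda>x. \<Sum>b\<in>Basis. (frechet_derivative T (at x) v \<bullet> b) *\<^sub>R frechet_derivative f (at (T x)) b)" for v
  proof (intro Ck_on_sum[OF assms(1)] bounded_bilinear.Ck_on[OF bounded_bilinear_scaleR assms(1)])
    fix b :: 'a
    show "Ck_on k X (\<lambda>x. frechet_derivative T (at x) v \<bullet> b)"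
      using Suc.prems by (intro bounded_linear.Ck_on[OF bounded_linear_inner_left assms(1)]) auto
    show "Ck_on k X (\<lambda>x. frechet_derivative f (at (T x)) b)"
      using Suc.prems by (intro Suc.IH[of "\<lambda>y. frechet_derivative f (at y) b"]) (auto intro: Ck_on_Suc_imp)
  qed
  then have "Ck_on k X (\<lambda>x. frechet_derivative (\<lambda>x. f (T x)) (at x) v)" for v
    by (rule Ck_on_cong[OF assms(1)]) (simp add: eq)
  then show ?case using der by (auto intro: differentiableI)
qed

lemma Ck_on_inverse:
  fixes f :: "'a::euclidean_space \<Rightarrow> real"
  assumes "open X" "Ck_on k X f" "\<And>x. x \<in> X \<Longrightarrow> f x \<noteq> 0"
  shows "Ck_on k X (\<lambda>x. inverse (f x))"
  using assms(2)
proof (induction k)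
  case 0
  then show ?case using assms(3) by (simp add: Limits.continuous_on_inverse)
next
  case (Suc k)
  have der: "((\<lambda>x. inverse (f x)) has_derivative
      (\<lambda>v. - (inverse (f x) * frechet_derivative f (at x) v * inverse (f x)))) (at x)" if "x \<in> X" for x
    using that Suc.prems assms(3) by (intro Deriv.has_derivative_inverse) (auto simp: has_derivative_frechet_derivative)
  have IH: "Ck_on k X (\<lambda>x. inverse (f x))" using Suc Ck_on_Suc_imp by blast
  note mult = bounded_bilinear.Ck_on[OF bounded_bilinear_mult assms(1)]
  have "Ck_on k X (\<lambda>x. inverse (f x) * frechet_derivative f (at x) v * inverse (f x))" for v
    by (rule mult[OF mult[OF IH] IH]) (use Suc.prems in simp)
  then have "Ck_on k X (\<lambda>x. - (inverse (f x) * frechet_derivative f (at x) v * inverse (f x)))" for v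
    by (rule bounded_linear.Ck_on[OF bounded_linear_minus[OF bounded_linear_ident] assms(1)])
  then have "Ck_on k X (\<lambda>x. frechet_derivative (\<lambda>x. inverse (f x)) (at x) v)" for v
    by (rule Ck_on_cong[OF assms(1)]) (subst frechet_derivative_at[OF der, symmetric], auto)
  then show ?case using der by (auto intro: differentiableI)
qed

section \<open>Smooth maps, and families of linear maps evaluated at moving vectors\<close>

lemma smooth_on_differentiable: "smooth_on X f \<Longrightarrow> x \<in> X \<Longrightarrow> f differentiable (at x)"
  unfolding smooth_on_def by (auto dest!: spec[of _ "Suc 0"])

lemma smooth_on_frechet_derivative: "smooth_on X f \<Longrightarrow> smooth_on X (\<lambda>x. frechet_derivative f (at x) v)"
  unfolding smooth_on_def
proof
  fix k assume "\<forall>k. Ck_on k X f"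
  then have "Ck_on (Suc k) X f" by blast
  then show "Ck_on k X (\<lambda>x. frechet_derivative f (at x) v)" by simp
qed

lemma smooth_on_imp_continuous_on: "smooth_on X f \<Longrightarrow> continuous_on X f"
  unfolding smooth_on_def by (auto dest!: spec[of _ 0])

lemma smooth_on_cong: "open X \<Longrightarrow> smooth_on X f \<Longrightarrow> (\<And>x. x \<in> X \<Longrightarrow> f x = g x) \<Longrightarrow> smooth_on X g"
  unfolding smooth_on_def by (auto intro: Ck_on_cong)

lemma smooth_on_local:
  "(\<And>x. x \<in> X \<Longrightarrow> \<exists>Y. open Y \<and> x \<in> Y \<and> smooth_on Y f) \<Longrightarrow> smooth_on X f"
  unfolding smooth_on_def by (intro allI Ck_on_local) blast

lemma smooth_on_subset: "smooth_on X f \<Longrightarrow> Y \<subseteq> X \<Longrightarrow> smooth_on Y f"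
  unfolding smooth_on_def by (auto intro: Ck_on_subset)

lemma smooth_on_const: "smooth_on X (\<lambda>x. c)"
  unfolding smooth_on_def by (simp add: Ck_on_const)

lemma smooth_on_add: "open X \<Longrightarrow> smooth_on X f \<Longrightarrow> smooth_on X g \<Longrightarrow> smooth_on X (\<lambda>x. f x + g x)"
  unfolding smooth_on_def by (simp add: Ck_on_add)

lemma smooth_on_sum:
  "open X \<Longrightarrow> (\<And>i. i \<in> I \<Longrightarrow> smooth_on X (f i)) \<Longrightarrow> smooth_on X (\<lambda>x. \<Sum>i\<in>I. f i x)"
  unfolding smooth_on_def by (simp add: Ck_on_sum)

lemma smooth_on_linear:
  "open X \<Longrightarrow> bounded_linear f \<Longrightarrow> smooth_on X h \<Longrightarrow> smooth_on X (\<lambda>x. f (h x))"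
  unfolding smooth_on_def by (simp add: bounded_linear.Ck_on)

lemma smooth_on_minus: "open X \<Longrightarrow> smooth_on X f \<Longrightarrow> smooth_on X (\<lambda>x. - f x)"
  by (rule smooth_on_linear[OF _ bounded_linear_minus[OF bounded_linear_ident]])

lemma smooth_on_diff:
  "open X \<Longrightarrow> smooth_on X f \<Longrightarrow> smooth_on X g \<Longrightarrow> smooth_on X (\<lambda>x. f x - g x)"
  using smooth_on_add[of X f "\<lambda>x. - g x"] smooth_on_minus[of X g] by simp

lemma smooth_on_inner_left: "open X \<Longrightarrow> smooth_on X f \<Longrightarrow> smooth_on X (\<lambda>x. f x \<bullet> b)"
  by (rule smooth_on_linear[OF _ bounded_linear_inner_left])

lemma smooth_on_scaleR:
  "open X \<Longrightarrow> smooth_on X f \<Longrightarrow> smooth_on X g \<Longrightarrow> smooth_on X (\<lambda>x. f x *\<^sub>R g x)"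
  unfolding smooth_on_def by (simp add: bounded_bilinear.Ck_on[OF bounded_bilinear_scaleR])

lemma smooth_on_mult:
  fixes f g :: "'a::euclidean_space \<Rightarrow> real"
  shows "open X \<Longrightarrow> smooth_on X f \<Longrightarrow> smooth_on X g \<Longrightarrow> smooth_on X (\<lambda>x. f x * g x)"
  unfolding smooth_on_def by (simp add: bounded_bilinear.Ck_on[OF bounded_bilinear_mult])

lemma smooth_on_prod:
  fixes f :: "'i \<Rightarrow> 'a::euclidean_space \<Rightarrow> real"
  assumes "open X" "\<And>i. i \<in> I \<Longrightarrow> smooth_on X (f i)"
  shows "smooth_on X (\<lambda>x. \<Prod>i\<in>I. f i x)"
  using assms(2)
  by (induction I rule: infinite_finite_induct) (auto simp: smooth_on_const smooth_on_mult[OF assms(1)])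

lemma smooth_on_divide:
  fixes f g :: "'a::euclidean_space \<Rightarrow> real"
  assumes "open X" "smooth_on X f" "smooth_on X g" "\<And>x. x \<in> X \<Longrightarrow> g x \<noteq> 0"
  shows "smooth_on X (\<lambda>x. f x / g x)"
  unfolding divide_inverse using assms
  by (intro smooth_on_mult) (auto simp: smooth_on_def Ck_on_inverse)

lemma smooth_on_compose:
  "open X \<Longrightarrow> smooth_on Y f \<Longrightarrow> smooth_on X T \<Longrightarrow> T ` X \<subseteq> Y \<Longrightarrow> smooth_on X (\<lambda>x. f (T x))"
  unfolding smooth_on_def using Ck_on_compose by blast

lemma linear_eq_sum_Basis:
  fixes f :: "'a::euclidean_space \<Rightarrow> 'b::real_vector"
  assumes "linear f"
  shows "f v = (\<Sum>b\<in>Basis. (v \<bullet> b) *\<^sub>R f b)"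
proof -
  interpret linear f by fact
  show ?thesis by (subst (1) euclidean_representation[of v, symmetric]) (simp only: sum scale)
qed

text \<open>Coefficients of forms and derivatives are known to be smooth on fixed vectors; linearity
  and a finite basis extend this to smoothly varying vectors.\<close>

lemma smooth_on_linear_family:
  fixes w :: "'a::euclidean_space \<Rightarrow> 'b::euclidean_space"
  assumes "open X" "\<And>u. u \<in> X \<Longrightarrow> linear (f u)" "\<And>v. smooth_on X (\<lambda>u. f u v)" "smooth_on X w"
  shows "smooth_on X (\<lambda>u. f u (w u))"
proof (rule smooth_on_cong[OF assms(1)])
  show "smooth_on X (\<lambda>u. \<Sum>b\<in>Basis. (w u \<bullet> b) *\<^sub>R f u b)"
    by (intro smooth_on_sum smooth_on_scaleR smooth_on_inner_left assms)
qed (simp add: linear_eq_sum_Basis[OF assms(2), symmetric])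

text \<open>This is the product rule for the evaluation pairing. Differentiability is asked for each
  fixed vector separately, which suffices because finitely many basis vectors generate the
  family.\<close>

lemma has_derivative_linear_family:
  fixes w :: "'a::euclidean_space \<Rightarrow> 'b::euclidean_space"
  assumes "open X" "x \<in> X" "\<And>u. u \<in> X \<Longrightarrow> linear (f u)"
    and "\<And>v. (\<lambda>u. f u v) differentiable (at x)" "(w has_derivative w') (at x)"
  shows "((\<lambda>u. f u (w u)) has_derivative
           (\<lambda>h. frechet_derivative (\<lambda>u. f u (w x)) (at x) h + f x (w' h))) (at x)"
proof -
  define D where "D v = frechet_derivative (\<lambda>u. f u v) (at x)" for v
  have D: "((\<lambda>u. f u v) has_derivative D v) (at x)" for v
    unfolding D_def by (rule has_derivative_frechet_derivative) (rule assms(4))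
  have rep: "(\<Sum>b\<in>Basis. (v \<bullet> b) *\<^sub>R f u b) = f u v" if "u \<in> X" for u v
    using linear_eq_sum_Basis[OF assms(3)[OF that]] by (rule sym)
  \<comment> \<open>The same expansion at the constant vector \<open>w x\<close> shows, by
    uniqueness of derivatives, that the basis derivatives recombine to the derivative at
    \<open>w x\<close>.\<close>
  have Dw: "(\<Sum>b\<in>Basis. (w x \<bullet> b) *\<^sub>R D b h) = D (w x) h" for h
  proof -
    have "((\<lambda>u. \<Sum>b\<in>Basis. (w x \<bullet> b) *\<^sub>R f u b) has_derivative (\<lambda>h. \<Sum>b\<in>Basis. (w x \<bullet> b) *\<^sub>R D b h)) (at x)"
      by (intro has_derivative_sum has_derivative_scaleR_right D)
    then have "((\<lambda>u. f u (w x)) has_derivative (\<lambda>h. \<Sum>b\<in>Basis. (w x \<bullet> b) *\<^sub>R D b h)) (at x)"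
      by (rule has_derivative_transform_within_open[OF _ assms(1,2)])
         (rule rep)
    from has_derivative_unique[OF this D] show ?thesis by (rule fun_cong)
  qed
  have "((\<lambda>u. \<Sum>b\<in>Basis. (w u \<bullet> b) *\<^sub>R f u b) has_derivative
      (\<lambda>h. \<Sum>b\<in>Basis. (w x \<bullet> b) *\<^sub>R D b h + (w' h \<bullet> b) *\<^sub>R f x b)) (at x)"
    by (intro has_derivative_sum has_derivative_scaleR has_derivative_inner_left D assms(5))
  then have "((\<lambda>u. f u (w u)) has_derivative
      (\<lambda>h. \<Sum>b\<in>Basis. (w x \<bullet> b) *\<^sub>R D b h + (w' h \<bullet> b) *\<^sub>R f x b)) (at x)"
    by (rule has_derivative_transform_within_open[OF _ assms(1,2)])
       (rule rep)
  then show ?thesis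
    by (simp add: sum.distrib Dw rep[OF assms(2)] flip: D_def)
qed

section \<open>Symmetry of second derivatives\<close>

lemma frechet_derivative_along_line:
  fixes f :: "'a::euclidean_space \<Rightarrow> real"
  assumes "f differentiable (at (x + s *\<^sub>R a))"
  shows "((\<lambda>s. f (x + s *\<^sub>R a)) has_real_derivative frechet_derivative f (at (x + s *\<^sub>R a)) a) (at s)"
proof -
  let ?D = "frechet_derivative f (at (x + s *\<^sub>R a))"
  interpret linear ?D using assms by (rule linear_frechet_derivative)
  have "((\<lambda>s. x + s *\<^sub>R a) has_derivative (\<lambda>t. t *\<^sub>R a)) (at s)"
    by (auto intro!: derivative_eq_intros)
  from diff_chain_at[OF this has_derivative_frechet_derivative[OF assms]]
  have "((\<lambda>s. f (x + s *\<^sub>R a)) has_derivative (\<lambda>t. ?D (t *\<^sub>R a))) (at s)" by (simp add: o_def)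
  then show ?thesis by (simp add: has_field_derivative_def scale mult_commute_abs)
qed

text \<open>Mean value theorem twice: in \<open>s\<close> for the difference \<open>?\<phi>\<close>
  of \<open>f\<close> along two opposite sides of the parallelogram, then in \<open>t\<close> for
  the derivative along \<open>a\<close>.\<close>

lemma second_difference_eq:
  fixes f :: "'a::euclidean_space \<Rightarrow> real"
  assumes "0 < h" "smooth_on X f"
    and X: "\<And>s t. 0 \<le> s \<Longrightarrow> s \<le> h \<Longrightarrow> 0 \<le> t \<Longrightarrow> t \<le> h \<Longrightarrow> x + s *\<^sub>R a + t *\<^sub>R b \<in> X"
  shows "\<exists>s t. 0 < s \<and> s < h \<and> 0 < t \<and> t < h \<and>
    f (x + h *\<^sub>R a + h *\<^sub>R b) - f (x + h *\<^sub>R a) - f (x + h *\<^sub>R b) + f x =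
    h * h * frechet_derivative (\<lambda>u. frechet_derivative f (at u) a) (at (x + s *\<^sub>R a + t *\<^sub>R b)) b"
proof -
  let ?f' = "\<lambda>u. frechet_derivative f (at u) a"
  let ?\<phi> = "\<lambda>s. f (x + h *\<^sub>R b + s *\<^sub>R a) - f (x + s *\<^sub>R a)"
  have d: "g differentiable (at (x + s *\<^sub>R a + t *\<^sub>R b))"
    if "0 \<le> s" "s \<le> h" "0 \<le> t" "t \<le> h" "smooth_on X g" for s t and g :: "'a \<Rightarrow> real"
    using smooth_on_differentiable[OF that(5) X] that by blast
  have "\<exists>s>0. s < h \<and> ?\<phi> h - ?\<phi> 0 = (h - 0) * (?f' (x + h *\<^sub>R b + s *\<^sub>R a) - ?f' (x + s *\<^sub>R a))"
  proof (rule MVT2[OF assms(1)])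
    fix s assume s: "0 \<le> s" "s \<le> h"
    show "(?\<phi> has_real_derivative ?f' (x + h *\<^sub>R b + s *\<^sub>R a) - ?f' (x + s *\<^sub>R a)) (at s)"
      using d[OF s, of h f] d[OF s, of 0 f] assms
      by (intro DERIV_diff frechet_derivative_along_line) (auto simp: algebra_simps)
  qed
  then obtain s where s: "0 < s" "s < h"
    "?\<phi> h - ?\<phi> 0 = h * (?f' (x + h *\<^sub>R b + s *\<^sub>R a) - ?f' (x + s *\<^sub>R a))" by auto
  have "\<exists>t>0. t < h \<and> ?f' (x + s *\<^sub>R a + h *\<^sub>R b) - ?f' (x + s *\<^sub>R a + 0 *\<^sub>R b) =
      (h - 0) * frechet_derivative ?f' (at (x + s *\<^sub>R a + t *\<^sub>R b)) b"
    using d s smooth_on_frechet_derivative[OF assms(2)]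
    by (intro MVT2[OF assms(1)] frechet_derivative_along_line) auto
  then obtain t where t: "0 < t" "t < h"
    "?f' (x + s *\<^sub>R a + h *\<^sub>R b) - ?f' (x + s *\<^sub>R a) = h * frechet_derivative ?f' (at (x + s *\<^sub>R a + t *\<^sub>R b)) b"
    by auto
  have "?\<phi> h - ?\<phi> 0 = h * (?f' (x + s *\<^sub>R a + h *\<^sub>R b) - ?f' (x + s *\<^sub>R a))"
    using s(3) by (simp add: algebra_simps)
  then have "f (x + h *\<^sub>R a + h *\<^sub>R b) - f (x + h *\<^sub>R a) - f (x + h *\<^sub>R b) + f x =
    h * h * frechet_derivative ?f' (at (x + s *\<^sub>R a + t *\<^sub>R b)) b"
    unfolding t(3) by (simp add: algebra_simps)
  with s t show ?thesis by blast
qed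

text \<open>The second difference is symmetric in \<open>a\<close> and \<open>b\<close>. Hence each
  mixed derivative takes the same value at some point of the same small parallelogram, and by
  continuity the two cannot differ at \<open>x\<close>.\<close>

lemma frechet_derivative_commute_real:
  fixes f :: "'a::euclidean_space \<Rightarrow> real"
  assumes "open X" "x \<in> X" "smooth_on X f"
  shows "frechet_derivative (\<lambda>u. frechet_derivative f (at u) a) (at x) b =
         frechet_derivative (\<lambda>u. frechet_derivative f (at u) b) (at x) a" (is "?G x = ?H x")
proof (rule ccontr)
  assume ne: "?G x \<noteq> ?H x"
  define \<epsilon> where "\<epsilon> = \<bar>?G x - ?H x\<bar> / 2"
  have "0 < \<epsilon>" using ne by (simp add: \<epsilon>_def)
  have "continuous_on X ?G" "continuous_on X ?H"
    using assms(3) by (simp_all add: smooth_on_frechet_derivative smooth_on_imp_continuous_on)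
  then have "isCont ?G x" "isCont ?H x" using assms(1,2) by (simp_all add: continuous_on_eq_continuous_at)
  then obtain d1 d2 where d: "d1 > 0" "d2 > 0"
    "\<And>u. dist u x < d1 \<Longrightarrow> dist (?G u) (?G x) < \<epsilon>" "\<And>u. dist u x < d2 \<Longrightarrow> dist (?H u) (?H x) < \<epsilon>"
    using \<open>0 < \<epsilon>\<close> unfolding continuous_at_eps_delta by metis
  obtain d3 where d3: "d3 > 0" "ball x d3 \<subseteq> X" using assms(1,2) openE by blast
  define d where "d = min d1 (min d2 d3)"
  \<comment> \<open>The summand 1 keeps the denominator positive when \<open>a\<close> and
    \<open>b\<close> vanish; the factor 2 keeps the parallelogram within distance
    \<open>d / 2\<close> of \<open>x\<close>.\<close>
  define h where "h = d / (2 * (norm a + norm b + 1))"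
  have pos: "norm a + norm b + 1 > 0" by (smt (verit) norm_ge_zero)
  have "d > 0" using d d3 by (simp add: d_def)
  then have "h > 0" using pos by (simp add: h_def)
  have bound: "dist (x + s *\<^sub>R a + t *\<^sub>R b) x < d" if "0 \<le> s" "s \<le> h" "0 \<le> t" "t \<le> h" for s t
  proof -
    have "dist (x + s *\<^sub>R a + t *\<^sub>R b) x \<le> norm (s *\<^sub>R a) + norm (t *\<^sub>R b)"
      using norm_triangle_ineq[of "s *\<^sub>R a" "t *\<^sub>R b"] by (simp add: dist_norm add.assoc)
    also have "\<dots> \<le> h * norm a + h * norm b"
      using that by (intro add_mono) (auto intro!: mult_right_mono)
    also have "\<dots> \<le> h * (norm a + norm b + 1)" using \<open>h > 0\<close> by (simp add: algebra_simps)
    also have "\<dots> = d / 2" using pos by (simp add: h_def field_simps)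
    also have "\<dots> < d" using \<open>d > 0\<close> by simp
    finally show ?thesis .
  qed
  have inX: "x + s *\<^sub>R a + t *\<^sub>R b \<in> X" if "0 \<le> s" "s \<le> h" "0 \<le> t" "t \<le> h" for s t
    using bound[OF that] d3 by (auto simp: d_def dist_commute)
  then have inX': "x + s *\<^sub>R b + t *\<^sub>R a \<in> X" if "0 \<le> s" "s \<le> h" "0 \<le> t" "t \<le> h" for s t
    using inX[OF that(3,4,1,2)] by (simp add: algebra_simps)
  obtain s t where st: "0 < s" "s < h" "0 < t" "t < h"
    "f (x + h *\<^sub>R a + h *\<^sub>R b) - f (x + h *\<^sub>R a) - f (x + h *\<^sub>R b) + f x = h * h * ?G (x + s *\<^sub>R a + t *\<^sub>R b)"
    using second_difference_eq[OF \<open>h > 0\<close> assms(3) inX] by blast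
  obtain s' t' where st': "0 < s'" "s' < h" "0 < t'" "t' < h"
    "f (x + h *\<^sub>R b + h *\<^sub>R a) - f (x + h *\<^sub>R b) - f (x + h *\<^sub>R a) + f x = h * h * ?H (x + s' *\<^sub>R b + t' *\<^sub>R a)"
    using second_difference_eq[OF \<open>h > 0\<close> assms(3) inX'] by blast
  have "h * h * ?G (x + s *\<^sub>R a + t *\<^sub>R b) = h * h * ?H (x + t' *\<^sub>R a + s' *\<^sub>R b)"
    using st(5) st'(5) by (simp add: algebra_simps)
  then have "?G (x + s *\<^sub>R a + t *\<^sub>R b) = ?H (x + t' *\<^sub>R a + s' *\<^sub>R b)" using \<open>h > 0\<close> by simp
  moreover have "dist (?G (x + s *\<^sub>R a + t *\<^sub>R b)) (?G x) < \<epsilon>"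
    using st bound[of s t] by (intro d) (auto simp: d_def)
  moreover have "dist (?H (x + t' *\<^sub>R a + s' *\<^sub>R b)) (?H x) < \<epsilon>"
    using st' bound[of t' s'] by (intro d) (auto simp: d_def)
  ultimately show False unfolding \<epsilon>_def dist_real_def
    by (smt (verit) field_sum_of_halves)
qed

lemma frechet_derivative_inner_left:
  fixes f :: "'a::real_normed_vector \<Rightarrow> 'b::real_inner"
  assumes "f differentiable (at x)"
  shows "frechet_derivative (\<lambda>u. f u \<bullet> c) (at x) h = frechet_derivative f (at x) h \<bullet> c"
  using frechet_derivative_at[OF has_derivative_inner_left[OF has_derivative_frechet_derivative[OF assms]], of c] by metis

lemma frechet_derivative_commute:
  fixes f :: "'a::euclidean_space \<Rightarrow> 'b::euclidean_space"
  assumes "open X" "x \<in> X" "smooth_on X f"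
  shows "frechet_derivative (\<lambda>u. frechet_derivative f (at u) a) (at x) b =
         frechet_derivative (\<lambda>u. frechet_derivative f (at u) b) (at x) a"
proof (rule euclidean_eqI)
  fix c :: 'b
  have 1: "frechet_derivative (\<lambda>u. frechet_derivative (\<lambda>u. f u \<bullet> c) (at u) v) (at x) w =
      frechet_derivative (\<lambda>u. frechet_derivative f (at u) v) (at x) w \<bullet> c" for v w
  proof -
    have "frechet_derivative (\<lambda>u. frechet_derivative (\<lambda>u. f u \<bullet> c) (at u) v) (at x) =
      frechet_derivative (\<lambda>u. frechet_derivative f (at u) v \<bullet> c) (at x)"
      by (rule frechet_derivative_cong_open[OF assms(1,2)])
         (simp add: frechet_derivative_inner_left smooth_on_differentiable[OF assms(3)])
    then show ?thesis
      using frechet_derivative_inner_left[OF smooth_on_differentiable[OF smooth_on_frechet_derivative[OF assms(3)] assms(2)]]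
      by simp
  qed
  show "frechet_derivative (\<lambda>u. frechet_derivative f (at u) a) (at x) b \<bullet> c =
         frechet_derivative (\<lambda>u. frechet_derivative f (at u) b) (at x) a \<bullet> c"
    using frechet_derivative_commute_real[OF assms(1,2) smooth_on_inner_left[OF assms(1,3)], of c a b]
    by (simp add: 1)
qed

section \<open>Pull-back and exterior derivative in coordinates\<close>

lemma length_eq_2_conv: "length xs = 2 \<longleftrightarrow> (\<exists>a b. xs = [a, b])"
  by (auto simp: numeral_2_eq_2 length_Suc_conv)

lemma length_eq_3_conv: "length xs = 3 \<longleftrightarrow> (\<exists>a b c. xs = [a, b, c])"
  by (auto simp: numeral_3_eq_3 length_Suc_conv)

lemma ext_deriv_coord_1:
  "ext_deriv_coord f u [a, b] =
    frechet_derivative (\<lambda>x. f x [b]) (at u) a - frechet_derivative (\<lambda>x. f x [a]) (at u) b"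
  by (simp add: ext_deriv_coord_def lessThan_Suc)

lemma ext_deriv_coord_2:
  "ext_deriv_coord f u [a, b, c] =
    frechet_derivative (\<lambda>x. f x [b, c]) (at u) a - frechet_derivative (\<lambda>x. f x [a, c]) (at u) b
    + frechet_derivative (\<lambda>x. f x [a, b]) (at u) c"
  by (simp add: ext_deriv_coord_def lessThan_Suc numeral_2_eq_2)

lemma alternating_form_1D: "alternating_form 1 \<omega> \<Longrightarrow> linear (\<lambda>v. \<omega> [v])"
  unfolding alternating_form_def by (elim conjE allE[of _ "[0]"] allE[of _ "0::nat"]) simp

lemma alternating_form_1_iff:
  "alternating_form 1 \<omega> \<longleftrightarrow> (\<forall>vs. length vs \<noteq> 1 \<longrightarrow> \<omega> vs = 0) \<and> linear (\<lambda>v. \<omega> [v])"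
proof
  assume "alternating_form 1 \<omega>"
  then show "(\<forall>vs. length vs \<noteq> 1 \<longrightarrow> \<omega> vs = 0) \<and> linear (\<lambda>v. \<omega> [v])"
    using alternating_form_1D by (auto simp: alternating_form_def)
next
  assume "(\<forall>vs. length vs \<noteq> 1 \<longrightarrow> \<omega> vs = 0) \<and> linear (\<lambda>v. \<omega> [v])"
  then show "alternating_form 1 \<omega>"
    by (auto simp: alternating_form_def length_Suc_conv)
qed

lemma alternating_form_2_iff:
  "alternating_form 2 \<omega> \<longleftrightarrow> (\<forall>vs. length vs \<noteq> 2 \<longrightarrow> \<omega> vs = 0) \<and>
    (\<forall>b. linear (\<lambda>a. \<omega> [a, b])) \<and> (\<forall>a. linear (\<lambda>b. \<omega> [a, b])) \<and> (\<forall>a. \<omega> [a, a] = 0)" (is "?l \<longleftrightarrow> ?r")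
proof
  assume l: ?l
  have lin: "linear (\<lambda>v. \<omega> (vs[i := v]))" if "length vs = 2" "i < 2" for vs i
    using l that by (auto simp: alternating_form_def)
  have "linear (\<lambda>a. \<omega> [a, b])" "linear (\<lambda>b. \<omega> [a, b])" for a b
    using lin[of "[a, b]" 0] lin[of "[a, b]" 1] by simp_all
  moreover have "\<omega> [a, a] = 0" for a
    using l unfolding alternating_form_def
    by (elim conjE allE[of _ "[a, a]"] allE[of _ "0::nat"] allE[of _ "1::nat"]) simp
  moreover have "\<forall>vs. length vs \<noteq> 2 \<longrightarrow> \<omega> vs = 0" using l by (simp add: alternating_form_def)
  ultimately show ?r by blast
next
  assume r: ?r
  have "i = 0 \<or> i = 1" if "i < 2" for i :: nat using that by auto
  with r show ?l by (fastforce simp: alternating_form_def length_eq_2_conv)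
qed

lemma alternating_form_2_swap:
  assumes "alternating_form 2 \<omega>"
  shows "\<omega> [a, b] = - \<omega> [b, a]"
proof -
  have lin: "linear (\<lambda>a. \<omega> [a, c])" "linear (\<lambda>b. \<omega> [c, b])" and diag: "\<omega> [c, c] = 0" for c
    using assms by (auto simp: alternating_form_2_iff)
  have "0 = \<omega> [a + b, a + b]" by (rule diag[symmetric])
  also have "\<dots> = \<omega> [a, a] + \<omega> [a, b] + (\<omega> [b, a] + \<omega> [b, b])"
    unfolding linear_add[OF lin(1)] linear_add[OF lin(2)] by simp
  finally show ?thesis by (simp add: diag)
qed

lemma has_derivative_frechet_compose:
  assumes "T differentiable (at x)" "f differentiable (at (T x))"
  shows "((\<lambda>u. f (T u)) has_derivative (\<lambda>h. frechet_derivative f (at (T x)) (frechet_derivative T (at x) h))) (at x)"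
  using diff_chain_at[OF has_derivative_frechet_derivative[OF assms(1)] has_derivative_frechet_derivative[OF assms(2)]] by (simp add: o_def)

text \<open>
  The second derivative of \<open>T\<close> enters the derivative of a pulled back form, but drops out of the
  exterior derivative by its symmetry.
\<close>

lemma ext_deriv_coord_pullback_1:
  fixes T :: "'a::euclidean_space \<Rightarrow> 'b::euclidean_space"
  assumes X: "open X" "u \<in> X" "smooth_on X T" and Y: "T ` X \<subseteq> Y"
    and lin: "\<And>y. y \<in> Y \<Longrightarrow> linear (\<lambda>v. f y [v])"
    and sm: "\<And>v. smooth_on Y (\<lambda>y. f y [v])"
    and eq: "\<And>x v. x \<in> X \<Longrightarrow> f0 x [v] = f (T x) [frechet_derivative T (at x) v]"
  shows "ext_deriv_coord f0 u [a, b] =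
    ext_deriv_coord f (T u) [frechet_derivative T (at u) a, frechet_derivative T (at u) b]"
proof -
  let ?T' = "\<lambda>v u. frechet_derivative T (at u) v"
  have dT: "T differentiable (at u)" "\<And>v. ?T' v differentiable (at u)"
    using smooth_on_differentiable[OF X(3,2)]
      smooth_on_differentiable[OF smooth_on_frechet_derivative[OF X(3)] X(2)] by blast+
  have df: "(\<lambda>y. f y [v]) differentiable (at (T u))" for v
    using smooth_on_differentiable[OF sm] X(2) Y by blast
  have 1: "frechet_derivative (\<lambda>x. f0 x [b]) (at u) a =
    frechet_derivative (\<lambda>y. f y [?T' b u]) (at (T u)) (?T' a u) +
    f (T u) [frechet_derivative (?T' b) (at u) a]" for a b
  proof -
    have "((\<lambda>x. f (T x) [?T' b x]) has_derivative
      (\<lambda>h. frechet_derivative (\<lambda>x. f (T x) [?T' b u]) (at u) h + f (T u) [frechet_derivative (?T' b) (at u) h])) (at u)"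
    proof (rule has_derivative_linear_family[OF X(1,2)])
      show "linear (\<lambda>v. f (T x) [v])" if "x \<in> X" for x using lin that Y by blast
      show "(\<lambda>x. f (T x) [v]) differentiable (at u)" for v
        using has_derivative_frechet_compose[OF dT(1) df] by (rule differentiableI)
    qed (rule has_derivative_frechet_derivative[OF dT(2)])
    then have "((\<lambda>x. f0 x [b]) has_derivative
      (\<lambda>h. frechet_derivative (\<lambda>x. f (T x) [?T' b u]) (at u) h + f (T u) [frechet_derivative (?T' b) (at u) h])) (at u)"
      by (rule has_derivative_transform_within_open[OF _ X(1,2)]) (simp add: eq)
    from frechet_derivative_at[OF this, symmetric]
      frechet_derivative_at[OF has_derivative_frechet_compose[OF dT(1) df[of "?T' b u"]], symmetric]
    show ?thesis by simp
  qed
  show ?thesis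
    unfolding ext_deriv_coord_1 1 frechet_derivative_commute[OF X, of a b] by simp
qed

lemma ext_deriv_coord_pullback_2:
  fixes T :: "'a::euclidean_space \<Rightarrow> 'b::euclidean_space"
  assumes X: "open X" "u \<in> X" "smooth_on X T" and Y: "T ` X \<subseteq> Y"
    and alt: "\<And>y. y \<in> Y \<Longrightarrow> alternating_form 2 (f y)"
    and sm: "\<And>v w. smooth_on Y (\<lambda>y. f y [v, w])"
    and eq: "\<And>x v w. x \<in> X \<Longrightarrow> f0 x [v, w] = f (T x) [frechet_derivative T (at x) v, frechet_derivative T (at x) w]"
  shows "ext_deriv_coord f0 u [a, b, c] =
    ext_deriv_coord f (T u) [frechet_derivative T (at u) a, frechet_derivative T (at u) b, frechet_derivative T (at u) c]"
proof -
  let ?T' = "\<lambda>v u. frechet_derivative T (at u) v"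
  have dT: "T differentiable (at u)" "\<And>v. ?T' v differentiable (at u)"
    using smooth_on_differentiable[OF X(3,2)]
      smooth_on_differentiable[OF smooth_on_frechet_derivative[OF X(3)] X(2)] by blast+
  have df: "(\<lambda>y. f y [v, w]) differentiable (at (T u))" for v w
    using smooth_on_differentiable[OF sm] X(2) Y by blast
  have lin: "linear (\<lambda>v. f (T x) [v, w])" "linear (\<lambda>v. f (T x) [w, v])" if "x \<in> X" for x w
    using alt[of "T x"] that Y by (auto simp: alternating_form_2_iff)
  have 1: "frechet_derivative (\<lambda>x. f0 x [b, c]) (at u) a =
    frechet_derivative (\<lambda>y. f y [?T' b u, ?T' c u]) (at (T u)) (?T' a u) +
    f (T u) [frechet_derivative (?T' b) (at u) a, ?T' c u] +
    f (T u) [?T' b u, frechet_derivative (?T' c) (at u) a]" for a b c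
  proof -
    \<comment> \<open>The slots are set in motion one at a time: here the second argument is frozen,
      and afterwards the first one already moves.\<close>
    have d1: "((\<lambda>x. f (T x) [?T' b x, w]) has_derivative
      (\<lambda>h. frechet_derivative (\<lambda>x. f (T x) [?T' b u, w]) (at u) h + f (T u) [frechet_derivative (?T' b) (at u) h, w])) (at u)" for w
    proof (rule has_derivative_linear_family[OF X(1,2)])
      show "linear (\<lambda>v. f (T x) [v, w])" if "x \<in> X" for x using lin that Y by blast
      show "(\<lambda>x. f (T x) [v, w]) differentiable (at u)" for v
        using has_derivative_frechet_compose[OF dT(1) df] by (rule differentiableI)
    qed (rule has_derivative_frechet_derivative[OF dT(2)])
    have "((\<lambda>x. f (T x) [?T' b x, ?T' c x]) has_derivative
      (\<lambda>h. frechet_derivative (\<lambda>x. f (T x) [?T' b x, ?T' c u]) (at u) h + f (T u) [?T' b u, frechet_derivative (?T' c) (at u) h])) (at u)"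
    proof (rule has_derivative_linear_family[OF X(1,2)])
      show "linear (\<lambda>v. f (T x) [?T' b x, v])" if "x \<in> X" for x using lin that Y by blast
      show "(\<lambda>x. f (T x) [?T' b x, v]) differentiable (at u)" for v
        using d1 by (rule differentiableI)
    qed (rule has_derivative_frechet_derivative[OF dT(2)])
    then have "((\<lambda>x. f0 x [b, c]) has_derivative
      (\<lambda>h. frechet_derivative (\<lambda>x. f (T x) [?T' b x, ?T' c u]) (at u) h + f (T u) [?T' b u, frechet_derivative (?T' c) (at u) h])) (at u)"
      by (rule has_derivative_transform_within_open[OF _ X(1,2)]) (simp add: eq)
    from frechet_derivative_at[OF this, symmetric] frechet_derivative_at[OF d1[of "?T' c u"], symmetric]
      frechet_derivative_at[OF has_derivative_frechet_compose[OF dT(1) df[of "?T' b u" "?T' c u"]], symmetric]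
    show ?thesis by simp
  qed
  \<comment> \<open>Of the six terms with a second derivative of \<open>T\<close>, two pairs cancel
    by its symmetry. In the pair for \<open>a\<close> and \<open>c\<close> the second derivative
    sits in different slots, so antisymmetry of \<open>f\<close> is used as well.\<close>
  have swap: "f (T u) [v, w] = - f (T u) [w, v]" for v w
    using X(2) Y by (intro alternating_form_2_swap alt) blast
  show ?thesis
    unfolding ext_deriv_coord_2 1
    using frechet_derivative_commute[OF X, of a b] frechet_derivative_commute[OF X, of a c]
      frechet_derivative_commute[OF X, of b c]
      swap[of "frechet_derivative (?T' c) (at u) a" "?T' b u"]
    by simp
qed

section \<open>Charts, tangent vectors and forms\<close>

locale manifold =
  fixes A :: "('m::{t2_space, second_countable_topology}, 'e::euclidean_space) chart set"
  assumes smooth_manifold: "smooth_manifold A"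
begin

abbreviation transition :: "('m, 'e) chart \<Rightarrow> ('m, 'e) chart \<Rightarrow> 'e \<Rightarrow> 'e" where
  "transition c c' u \<equiv> cmap c' (cinv c u)"

abbreviation jacobian :: "('m, 'e) chart \<Rightarrow> ('m, 'e) chart \<Rightarrow> 'e \<Rightarrow> 'e \<Rightarrow> 'e" where
  "jacobian c c' u \<equiv> frechet_derivative (\<lambda>x. cmap c' (cinv c x)) (at u)"

lemma is_chartD:
  assumes "c \<in> A"
  shows "open (cdom c)" "open (cmap c ` cdom c)"
    "homeomorphism (cdom c) (cmap c ` cdom c) (cmap c) (cinv c)"
  using assms smooth_manifold by (auto simp: smooth_manifold_def is_chart_def)

lemma cinv_cmap: "c \<in> A \<Longrightarrow> p \<in> cdom c \<Longrightarrow> cinv c (cmap c p) = p"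
  using is_chartD(3) by (auto simp: homeomorphism_def)

lemma cinv_in: "c \<in> A \<Longrightarrow> u \<in> cmap c ` cdom c \<Longrightarrow> cinv c u \<in> cdom c"
  by (auto simp: cinv_cmap)

lemma in_image_iff:
  "c \<in> A \<Longrightarrow> u \<in> cmap c ` (cdom c \<inter> W) \<longleftrightarrow> u \<in> cmap c ` cdom c \<and> cinv c u \<in> W"
  by (auto simp: cinv_cmap)

lemma open_image:
  assumes "c \<in> A" "open W"
  shows "open (cmap c ` (cdom c \<inter> W))"
proof -
  have "cmap c ` (cdom c \<inter> W) = cmap c ` cdom c \<inter> cinv c -` W"
    using in_image_iff[OF assms(1)] by blast
  moreover have "open (cmap c ` cdom c \<inter> cinv c -` W)"
    using is_chartD[OF assms(1)] assms(2) by (auto simp: homeomorphism_def intro: continuous_open_preimage)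
  ultimately show ?thesis by simp
qed

lemma smooth_on_transition:
  assumes "c \<in> A" "c' \<in> A"
  shows "smooth_on (cmap c ` (cdom c \<inter> cdom c')) (transition c c')"
  using assms smooth_manifold by (auto simp: smooth_manifold_def compatible_def o_def)

lemma transition_differentiable:
  assumes "c \<in> A" "c' \<in> A" "p \<in> cdom c" "p \<in> cdom c'"
  shows "transition c c' differentiable (at (cmap c p))"
  using smooth_on_differentiable[OF smooth_on_transition] assms by blast

lemma linear_jacobian:
  "c \<in> A \<Longrightarrow> c' \<in> A \<Longrightarrow> p \<in> cdom c \<Longrightarrow> p \<in> cdom c' \<Longrightarrow> linear (jacobian c c' (cmap c p))"
  by (rule linear_frechet_derivative) (rule transition_differentiable)

lemma jacobian_chain:
  assumes "c \<in> A" "c' \<in> A" "c'' \<in> A" "p \<in> cdom c" "p \<in> cdom c'" "p \<in> cdom c''"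
  shows "jacobian c' c'' (cmap c' p) (jacobian c c' (cmap c p) v) = jacobian c c'' (cmap c p) v"
proof -
  have T: "transition c c' (cmap c p) = cmap c' p" using assms cinv_cmap by simp
  have "((\<lambda>u. transition c' c'' (transition c c' u)) has_derivative
      (\<lambda>h. jacobian c' c'' (transition c c' (cmap c p)) (jacobian c c' (cmap c p) h))) (at (cmap c p))"
    using transition_differentiable assms T by (intro has_derivative_frechet_compose) auto
  then have "(transition c c'' has_derivative
      (\<lambda>h. jacobian c' c'' (cmap c' p) (jacobian c c' (cmap c p) h))) (at (cmap c p))"
    unfolding T
    by (rule has_derivative_transform_within_open[OF _ open_image[OF assms(1), of "cdom c'"]])
       (use assms is_chartD(1)[OF assms(2)] in \<open>auto simp: cinv_cmap\<close>)
  from frechet_derivative_at[OF this, symmetric] show ?thesis by simp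
qed

lemma jacobian_self:
  assumes "c \<in> A" "p \<in> cdom c"
  shows "jacobian c c (cmap c p) v = v"
proof -
  have "jacobian c c (cmap c p) = frechet_derivative (\<lambda>x. x) (at (cmap c p))"
    by (rule frechet_derivative_cong_open[OF is_chartD(2)[OF assms(1)]]) (use assms in \<open>auto simp: cinv_cmap\<close>)
  then show ?thesis by simp
qed

lemma chart_at: "chart_at A p \<in> A" "p \<in> cdom (chart_at A p)"
proof -
  have "p \<in> (\<Union>c\<in>A. cdom c)" using smooth_manifold by (simp add: smooth_manifold_def)
  then have "\<exists>c. c \<in> A \<and> p \<in> cdom c" by blast
  from someI_ex[OF this] show "chart_at A p \<in> A" "p \<in> cdom (chart_at A p)"
    by (simp_all add: chart_at_def)
qed

lemma components_eq: "components A c p = jacobian (chart_at A p) c (cmap (chart_at A p) p)"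
  by (simp add: components_def o_def)

lemma tangent_vector_eq: "tangent_vector A c p = jacobian c (chart_at A p) (cmap c p)"
  by (simp add: tangent_vector_def o_def)

lemma linear_components: "c \<in> A \<Longrightarrow> p \<in> cdom c \<Longrightarrow> linear (components A c p)"
  unfolding components_eq using chart_at by (intro linear_jacobian)

lemma linear_tangent_vector: "c \<in> A \<Longrightarrow> p \<in> cdom c \<Longrightarrow> linear (tangent_vector A c p)"
  unfolding tangent_vector_eq using chart_at by (intro linear_jacobian)

lemma components_tangent_vector:
  "c \<in> A \<Longrightarrow> p \<in> cdom c \<Longrightarrow> components A c p (tangent_vector A c p e) = e"
  using jacobian_chain[of c "chart_at A p" c p e] chart_at jacobian_self
  by (simp add: components_eq tangent_vector_eq)

lemma tangent_vector_components:
  "c \<in> A \<Longrightarrow> p \<in> cdom c \<Longrightarrow> tangent_vector A c p (components A c p v) = v"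
  using jacobian_chain[of "chart_at A p" c "chart_at A p" p v] chart_at jacobian_self
  by (simp add: components_eq tangent_vector_eq)

lemma components_change:
  assumes "c \<in> A" "c' \<in> A" "p \<in> cdom c" "p \<in> cdom c'"
  shows "jacobian c c' (cmap c p) (components A c p v) = components A c' p v"
  unfolding components_eq using assms chart_at by (intro jacobian_chain)

lemma tangent_vector_change:
  assumes "c \<in> A" "c' \<in> A" "p \<in> cdom c" "p \<in> cdom c'"
  shows "tangent_vector A c' p (jacobian c c' (cmap c p) e) = tangent_vector A c p e"
  unfolding tangent_vector_eq using assms chart_at by (intro jacobian_chain)

lemma form_rep_change:
  assumes "c \<in> A" "c' \<in> A" "u \<in> cmap c ` (cdom c \<inter> cdom c')"
  shows "form_rep A c \<omega> u es = form_rep A c' \<omega> (transition c c' u) (map (jacobian c c' u) es)"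
proof -
  obtain p where p: "p \<in> cdom c" "p \<in> cdom c'" "u = cmap c p" using assms(3) by blast
  show ?thesis
    using tangent_vector_change[OF assms(1,2) p(1,2)] assms p
    by (simp add: form_rep_def cinv_cmap o_def)
qed

lemma form_rep_components:
  assumes "c \<in> A" "p \<in> cdom c"
  shows "form_rep A c \<omega> (cmap c p) (map (components A c p) vs) = \<omega> p vs"
  using assms by (simp add: form_rep_def cinv_cmap o_def tangent_vector_components)

lemma alternating_form_rep:
  assumes "differential_form A k W \<omega>" "c \<in> A" "u \<in> cmap c ` (cdom c \<inter> W)"
  shows "alternating_form k (form_rep A c \<omega> u)"
proof -
  obtain p where p: "p \<in> cdom c" "p \<in> W" "u = cmap c p" using assms(3) by blast
  let ?t = "tangent_vector A c p"
  have alt: "alternating_form k (\<omega> p)" using assms p by (auto simp: differential_form_def)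
  have lt: "linear ?t" using linear_tangent_vector assms p by blast
  have rep: "form_rep A c \<omega> u = (\<lambda>es. \<omega> p (map ?t es))"
    using assms p by (simp add: form_rep_def cinv_cmap fun_eq_iff)
  show ?thesis
    unfolding alternating_form_def rep
  proof (intro conjI allI impI)
    fix es :: "'e list" and i
    assume "length es = k \<and> i < k"
    then have "linear (\<lambda>v. \<omega> p ((map ?t es)[i := v]))"
      using alt unfolding alternating_form_def by auto
    from linear_compose[OF lt this] show "linear (\<lambda>v. \<omega> p (map ?t (es[i := v])))"
      by (simp add: o_def map_update)
  next
    fix es :: "'e list" and i j
    assume "length es = k \<and> i < j \<and> j < k \<and> es ! i = es ! j"
    then show "\<omega> p (map ?t es) = 0"
      using alt unfolding alternating_form_def
      by (elim conjE allE[of _ "map ?t es"] allE[of _ i] allE[of _ j]) auto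
  next
    fix es :: "'e list"
    assume "length es \<noteq> k"
    then show "\<omega> p (map ?t es) = 0" using alt by (auto simp: alternating_form_def)
  qed
qed

section \<open>Differential forms: restriction, gluing, and smoothness from a single chart\<close>

lemma smooth_form_rep:
  "differential_form A k W \<omega> \<Longrightarrow> c \<in> A \<Longrightarrow> smooth_on (cmap c ` (cdom c \<inter> W)) (\<lambda>u. form_rep A c \<omega> u es)"
  by (auto simp: differential_form_def)

lemma differential_form_subset:
  "differential_form A k W \<omega> \<Longrightarrow> W' \<subseteq> W \<Longrightarrow> differential_form A k W' \<omega>"
  unfolding differential_form_def by (blast intro: smooth_on_subset)

lemma differential_form_diff:
  assumes "open W" "differential_form A 1 W \<omega>" "differential_form A 1 W \<omega>'"
  shows "differential_form A 1 W (\<lambda>p vs. \<omega> p vs - \<omega>' p vs)"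
  unfolding differential_form_def
proof (intro conjI ballI allI)
  fix p assume "p \<in> W"
  then have "alternating_form 1 (\<omega> p)" "alternating_form 1 (\<omega>' p)"
    using assms by (auto simp: differential_form_def)
  then show "alternating_form 1 (\<lambda>vs. \<omega> p vs - \<omega>' p vs)"
    unfolding alternating_form_1_iff by (simp add: linear_compose_sub)
next
  fix c es assume c: "c \<in> A"
  from smooth_on_diff[OF open_image[OF c assms(1)] smooth_form_rep[OF assms(2) c] smooth_form_rep[OF assms(3) c]]
  show "smooth_on (cmap c ` (cdom c \<inter> W)) (\<lambda>u. form_rep A c (\<lambda>p vs. \<omega> p vs - \<omega>' p vs) u es)"
    by (simp add: form_rep_def)
qed

lemma differential_form_local:
  assumes "\<And>p. p \<in> W \<Longrightarrow> \<exists>W'. open W' \<and> p \<in> W' \<and> differential_form A k W' \<omega>"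
  shows "differential_form A k W \<omega>"
  unfolding differential_form_def
proof (intro conjI ballI allI)
  fix p assume "p \<in> W"
  then show "alternating_form k (\<omega> p)" using assms by (auto simp: differential_form_def)
next
  fix c es assume c: "c \<in> A"
  show "smooth_on (cmap c ` (cdom c \<inter> W)) (\<lambda>u. form_rep A c \<omega> u es)"
  proof (rule smooth_on_local)
    fix u assume "u \<in> cmap c ` (cdom c \<inter> W)"
    then obtain p where p: "p \<in> cdom c" "p \<in> W" "u = cmap c p" by blast
    then obtain W' where W': "open W'" "p \<in> W'" "differential_form A k W' \<omega>" using assms by blast
    then show "\<exists>Y. open Y \<and> u \<in> Y \<and> smooth_on Y (\<lambda>u. form_rep A c \<omega> u es)"
      using open_image[OF c W'(1)] smooth_form_rep[OF W'(3) c] p by blast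
  qed
qed

lemma differential_form_cong:
  assumes "open W" "differential_form A k W \<omega>" "\<And>p. p \<in> W \<Longrightarrow> \<omega> p = \<omega>' p"
  shows "differential_form A k W \<omega>'"
  unfolding differential_form_def
proof (intro conjI ballI allI)
  fix p assume "p \<in> W"
  then show "alternating_form k (\<omega>' p)" using assms(2) assms(3)[of p] by (auto simp: differential_form_def)
next
  fix c es assume c: "c \<in> A"
  show "smooth_on (cmap c ` (cdom c \<inter> W)) (\<lambda>u. form_rep A c \<omega>' u es)"
    by (rule smooth_on_cong[OF open_image[OF c assms(1)] smooth_form_rep[OF assms(2) c, of es]])
       (simp add: form_rep_def in_image_iff[OF c] assms(3))
qed

text \<open>The definition tests all charts of the atlas. In another chart \<open>c0\<close> the
  coefficients are those of \<open>c\<close> evaluated on the moving vectors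
  \<open>jacobian c0 c u v\<close>, so smoothness carries over one slot at a time by
  \<open>smooth_on_linear_family\<close>.\<close>

lemma differential_form_2I:
  assumes c: "c \<in> A" and W: "open W" "W \<subseteq> cdom c"
    and alt: "\<And>p. p \<in> W \<Longrightarrow> alternating_form 2 (\<omega> p)"
    and sm: "\<And>v w. smooth_on (cmap c ` W) (\<lambda>u. form_rep A c \<omega> u [v, w])"
  shows "differential_form A 2 W \<omega>"
  unfolding differential_form_def
proof (intro conjI ballI allI)
  fix p assume "p \<in> W"
  then show "alternating_form 2 (\<omega> p)" by (rule alt)
next
  fix c0 :: "('m, 'e) chart" and es :: "'e list"
  assume c0: "c0 \<in> A"
  let ?X = "cmap c0 ` (cdom c0 \<inter> W)"
  have X: "open ?X" using open_image c0 W by blast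
  have W_eq: "cdom c \<inter> W = W" using W by blast
  show "smooth_on ?X (\<lambda>u. form_rep A c0 \<omega> u es)"
  proof (cases "length es = 2")
    case False
    show ?thesis
    proof (rule smooth_on_cong[OF X smooth_on_const[of _ 0]])
      fix u assume "u \<in> ?X"
      then have "alternating_form 2 (\<omega> (cinv c0 u))" using alt in_image_iff[OF c0] by blast
      then show "0 = form_rep A c0 \<omega> u es" using False by (simp add: form_rep_def alternating_form_2_iff)
    qed
  next
    case True
    then obtain v w where es: "es = [v, w]" by (auto simp: length_eq_2_conv)
    let ?T = "transition c0 c" and ?f = "form_rep A c \<omega>"
    have smT: "smooth_on ?X ?T"
      using smooth_on_transition[OF c0 c] W by (elim smooth_on_subset) blast
    have TX: "?T ` ?X \<subseteq> cmap c ` W" using cinv_cmap[OF c0] by auto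
    have lin: "linear (\<lambda>v. ?f (?T u) [v, w])" "linear (\<lambda>w. ?f (?T u) [v, w])" if "u \<in> ?X" for u v w
    proof -
      have Tu: "cinv c (?T u) = cinv c0 u" "cinv c0 u \<in> W"
        using that W cinv_cmap[OF c] in_image_iff[OF c0] by auto
      then have "alternating_form 2 (\<omega> (cinv c0 u))" "linear (tangent_vector A c (cinv c0 u))"
        using alt linear_tangent_vector[OF c] W by auto
      then show "linear (\<lambda>v. ?f (?T u) [v, w])" "linear (\<lambda>w. ?f (?T u) [v, w])"
        by (auto simp: form_rep_def Tu alternating_form_2_iff intro: linear_compose[unfolded o_def])
    qed
    have sm1: "smooth_on ?X (\<lambda>u. ?f (?T u) [jacobian c0 c u v, w])" for w
      by (rule smooth_on_linear_family[OF X lin(1) smooth_on_compose[OF X sm smT TX]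
            smooth_on_frechet_derivative[OF smT]])
    have "smooth_on ?X (\<lambda>u. ?f (?T u) [jacobian c0 c u v, jacobian c0 c u w])"
      by (rule smooth_on_linear_family[OF X lin(2) sm1 smooth_on_frechet_derivative[OF smT]])
    then show ?thesis
    proof (rule smooth_on_cong[OF X])
      fix u assume "u \<in> ?X"
      then have "u \<in> cmap c0 ` (cdom c0 \<inter> cdom c)" using W by blast
      from form_rep_change[OF c0 c this]
      show "?f (?T u) [jacobian c0 c u v, jacobian c0 c u w] = form_rep A c0 \<omega> u es"
        by (simp add: es)
    qed
  qed
qed

section \<open>Locality of the exterior derivative and its independence of the chart\<close>

lemma ext_deriv_cong:
  assumes "open W" "p \<in> W" "\<And>q. q \<in> W \<Longrightarrow> \<omega> q = \<omega>' q"
  shows "ext_deriv A \<omega> p vs = ext_deriv A \<omega>' p vs"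
proof -
  let ?c = "chart_at A p"
  have "frechet_derivative (\<lambda>x. form_rep A ?c \<omega> x es) (at (cmap ?c p)) =
    frechet_derivative (\<lambda>x. form_rep A ?c \<omega>' x es) (at (cmap ?c p))" for es
    by (rule frechet_derivative_cong_open[OF open_image[OF chart_at(1)[of p] assms(1)]])
       (use assms chart_at in \<open>auto simp: form_rep_def cinv_cmap\<close>)
  then show ?thesis by (simp add: ext_deriv_def ext_deriv_coord_def)
qed

text \<open>The chart selected at \<open>p\<close> need not be adapted. Naturality under the
  transition map from it to \<open>c\<close> moves the computation to \<open>c\<close>.\<close>

lemma ext_deriv_chart_1:
  assumes "open W" "differential_form A 1 W \<omega>" "c \<in> A" "p \<in> cdom c" "p \<in> W"
  shows "ext_deriv A \<omega> p [v, w] =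
    ext_deriv_coord (form_rep A c \<omega>) (cmap c p) [components A c p v, components A c p w]"
proof -
  let ?c0 = "chart_at A p"
  let ?X = "cmap ?c0 ` (cdom ?c0 \<inter> (cdom c \<inter> W))" and ?Y = "cmap c ` (cdom c \<inter> W)"
  note c0 = chart_at[of p]
  have T: "transition ?c0 c (cmap ?c0 p) = cmap c p" using c0 cinv_cmap by simp
  have "ext_deriv_coord (form_rep A ?c0 \<omega>) (cmap ?c0 p) [components A ?c0 p v, components A ?c0 p w] =
    ext_deriv_coord (form_rep A c \<omega>) (transition ?c0 c (cmap ?c0 p))
      [jacobian ?c0 c (cmap ?c0 p) (components A ?c0 p v), jacobian ?c0 c (cmap ?c0 p) (components A ?c0 p w)]"
  proof (rule ext_deriv_coord_pullback_1[where X = ?X and Y = ?Y])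
    show "open ?X" using open_image[OF c0(1) open_Int[OF is_chartD(1)[OF assms(3)] assms(1)]] .
    show "cmap ?c0 p \<in> ?X" using c0 assms by blast
    show "smooth_on ?X (transition ?c0 c)"
      using smooth_on_transition[OF c0(1) assms(3)] by (rule smooth_on_subset) auto
    show "transition ?c0 c ` ?X \<subseteq> ?Y" using cinv_cmap[OF c0(1)] by auto
    show "linear (\<lambda>v. form_rep A c \<omega> y [v])" if "y \<in> ?Y" for y
      using alternating_form_rep[OF assms(2,3) that] by (rule alternating_form_1D)
    show "smooth_on ?Y (\<lambda>y. form_rep A c \<omega> y [v])" for v using smooth_form_rep[OF assms(2,3)] .
    show "form_rep A ?c0 \<omega> x [v] = form_rep A c \<omega> (transition ?c0 c x) [jacobian ?c0 c x v]"
      if "x \<in> ?X" for x v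
      using form_rep_change[OF c0(1) assms(3), of x \<omega> "[v]"] that by auto
  qed
  then show ?thesis
    using components_change[OF c0(1) assms(3) c0(2) assms(4)] by (simp add: ext_deriv_def T)
qed

lemma ext_deriv_chart_2:
  assumes "open W" "differential_form A 2 W \<omega>" "c \<in> A" "p \<in> cdom c" "p \<in> W"
  shows "ext_deriv A \<omega> p [v, w, z] =
    ext_deriv_coord (form_rep A c \<omega>) (cmap c p) [components A c p v, components A c p w, components A c p z]"
proof -
  let ?c0 = "chart_at A p"
  let ?X = "cmap ?c0 ` (cdom ?c0 \<inter> (cdom c \<inter> W))" and ?Y = "cmap c ` (cdom c \<inter> W)"
  let ?J = "\<lambda>v. jacobian ?c0 c (cmap ?c0 p) (components A ?c0 p v)"
  note c0 = chart_at[of p]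
  have T: "transition ?c0 c (cmap ?c0 p) = cmap c p" using c0 cinv_cmap by simp
  have "ext_deriv_coord (form_rep A ?c0 \<omega>) (cmap ?c0 p)
      [components A ?c0 p v, components A ?c0 p w, components A ?c0 p z] =
    ext_deriv_coord (form_rep A c \<omega>) (transition ?c0 c (cmap ?c0 p)) [?J v, ?J w, ?J z]"
  proof (rule ext_deriv_coord_pullback_2[where X = ?X and Y = ?Y])
    show "open ?X" using open_image[OF c0(1) open_Int[OF is_chartD(1)[OF assms(3)] assms(1)]] .
    show "cmap ?c0 p \<in> ?X" using c0 assms by blast
    show "smooth_on ?X (transition ?c0 c)"
      using smooth_on_transition[OF c0(1) assms(3)] by (rule smooth_on_subset) auto
    show "transition ?c0 c ` ?X \<subseteq> ?Y" using cinv_cmap[OF c0(1)] by auto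
    show "alternating_form 2 (form_rep A c \<omega> y)" if "y \<in> ?Y" for y
      using alternating_form_rep[OF assms(2,3) that] .
    show "smooth_on ?Y (\<lambda>y. form_rep A c \<omega> y [v, w])" for v w using smooth_form_rep[OF assms(2,3)] .
    show "form_rep A ?c0 \<omega> x [v, w] =
        form_rep A c \<omega> (transition ?c0 c x) [jacobian ?c0 c x v, jacobian ?c0 c x w]"
      if "x \<in> ?X" for x v w
      using form_rep_change[OF c0(1) assms(3), of x \<omega> "[v, w]"] that by auto
  qed
  then show ?thesis
    using components_change[OF c0(1) assms(3) c0(2) assms(4)] by (simp add: ext_deriv_def T)
qed

text \<open>\<open>cinv\<close> is an \<open>inv_into\<close> over the chart domain, so shrinking
  the domain may change it as a total function; agreement has to be shown on the smaller
  image.\<close>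

lemma cinv_restrict:
  assumes "c \<in> A" "u \<in> cmap c ` (cdom c \<inter> W)"
  shows "cinv (cdom c \<inter> W, cmap c) u = cinv c u"
proof -
  obtain p where p: "p \<in> cdom c" "p \<in> W" "u = cmap c p" using assms(2) by blast
  have "inj_on (cmap c) (cdom c)" using cinv_cmap[OF assms(1)] by (metis inj_onI)
  then have "inj_on (cmap c) (cdom c \<inter> W)" by (rule inj_on_subset) blast
  then show ?thesis using p cinv_cmap[OF assms(1)] by (simp add: cinv_def inv_into_f_f)
qed

text \<open>Maximality of the atlas. A foliated form asks for adapted charts whose domain lies in a
  given open set, and these arise by restriction.\<close>

lemma restrict_chart:
  assumes "c \<in> A" "open W"
  shows "(cdom c \<inter> W, cmap c) \<in> A"
proof -
  let ?r = "(cdom c \<inter> W, cmap c)"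
  have hom: "homeomorphism (cdom c) (cmap c ` cdom c) (cmap c) (cinv c)" using is_chartD assms by blast
  have "homeomorphism (cdom c \<inter> W) (cmap c ` (cdom c \<inter> W)) (cmap c) (cinv c)"
    by (rule homeomorphism_of_subsets[OF hom]) auto
  then have "homeomorphism (cdom c \<inter> W) (cmap c ` (cdom c \<inter> W)) (cmap c) (cinv ?r)"
    by (rule homeomorphism_cong[OF _ refl refl refl]) (use cinv_restrict[OF assms(1)] in auto)
  then have "is_chart ?r"
    using is_chartD[OF assms(1)] assms open_image by (auto simp: is_chart_def)
  moreover have "compatible ?r c'" if c': "c' \<in> A" for c'
  proof -
    have s: "smooth_on (cmap c ` (cdom c \<inter> cdom c')) (transition c c')"
      "smooth_on (cmap c' ` (cdom c' \<inter> cdom c)) (transition c' c)"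
      using smooth_on_transition assms c' by blast+
    have o: "open (cmap c ` (cdom c \<inter> (W \<inter> cdom c')))"
      using open_image assms c' is_chartD by blast
    have "smooth_on (cmap c ` (cdom c \<inter> (W \<inter> cdom c'))) (transition c c')"
      by (rule smooth_on_subset[OF s(1)]) auto
    then have "smooth_on (cmap c ` (cdom c \<inter> (W \<inter> cdom c'))) (cmap c' \<circ> cinv ?r)"
      by (rule smooth_on_cong[OF o]) (use cinv_restrict[OF assms(1), of _ W] in auto)
    moreover have "smooth_on (cmap c' ` (cdom c \<inter> (W \<inter> cdom c'))) (cmap c \<circ> cinv c')"
      unfolding o_def by (rule smooth_on_subset[OF s(2)]) auto
    ultimately show ?thesis by (simp add: compatible_def Int_assoc)
  qed
  ultimately show ?thesis using smooth_manifold unfolding smooth_manifold_def by blast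
qed

lemma restrict_chart_vectors:
  assumes "c \<in> A" "open W" "p \<in> cdom c" "p \<in> W"
  shows "tangent_vector A (cdom c \<inter> W, cmap c) p = tangent_vector A c p"
    "components A (cdom c \<inter> W, cmap c) p = components A c p"
proof -
  show "tangent_vector A (cdom c \<inter> W, cmap c) p = tangent_vector A c p"
    unfolding tangent_vector_eq snd_conv
    by (rule frechet_derivative_cong_open[OF open_image[OF assms(1,2)]])
       (use assms cinv_restrict[OF assms(1)] in auto)
  show "components A (cdom c \<inter> W, cmap c) p = components A c p"
    by (simp add: components_eq)
qed

end

section \<open>Adapted charts\<close>

lemma Pair_0_eq_sum_axis: "(0, x) = (\<Sum>i\<in>UNIV. (x $ i) *\<^sub>R (0 :: real^'n, axis i 1 :: real^'n))"
proof -
  have "x = (\<Sum>i\<in>UNIV. (x $ i) *\<^sub>R axis i 1)"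
    using basis_expansion[of x] by (simp add: scalar_mult_eq_scaleR)
  then show ?thesis by (simp add: prod_eq_iff fst_sum snd_sum)
qed

lemma sum_partial_y:
  assumes "f differentiable (at u)"
  shows "(\<Sum>i\<in>UNIV. partial_y i f u * x $ i) = frechet_derivative f (at u) (0, x)"
proof -
  interpret linear "frechet_derivative f (at u)" using assms by (rule linear_frechet_derivative)
  show ?thesis
    by (subst Pair_0_eq_sum_axis) (simp only: sum scale partial_y_def real_scaleR_def mult.commute)
qed

text \<open>Adapted charts around every point are part of the locale; in the theorem they come from
  the covering sets \<open>U \<alpha>\<close>, which are adapted chart domains.\<close>

locale tangent_mfd = manifold A
  for A :: "('m::{t2_space, second_countable_topology}, (real^'n) \<times> (real^'n)) chart set" +
  fixes S :: "'m \<Rightarrow> (real^'n) \<times> (real^'n) \<Rightarrow> (real^'n) \<times> (real^'n)"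
  assumes endomorphism: "endomorphism_field A S"
    and adapted_cover: "\<exists>c. adapted_chart A S c \<and> p \<in> cdom c"
begin

lemma linear_S: "linear (S p)"
  using endomorphism by (simp add: endomorphism_field_def)

lemma adapted_in_atlas: "adapted_chart A S c \<Longrightarrow> c \<in> A"
  by (simp add: adapted_chart_def)

lemma adapted_chart_at:
  "adapted_chart A S (adapted_chart_at A S p)" "p \<in> cdom (adapted_chart_at A S p)"
  using someI_ex[OF adapted_cover[of p]] by (simp_all add: adapted_chart_at_def)

lemma S_tangent_vector:
  assumes c: "adapted_chart A S c" and p: "p \<in> cdom c"
  shows "S p (tangent_vector A c p e) = tangent_vector A c p (0, fst e)"
proof -
  note t = linear_tangent_vector[OF adapted_in_atlas[OF c] p]
  have "(\<lambda>e. S p (tangent_vector A c p e)) = (\<lambda>e. tangent_vector A c p (0, fst e))"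
  proof (rule linear_eq_stdbasis)
    show "linear (\<lambda>e. S p (tangent_vector A c p e))"
      using linear_compose[OF t linear_S] by (simp add: o_def)
    have "linear (\<lambda>e. (0, fst e))" by (rule linearI) simp_all
    from linear_compose[OF this t] show "linear (\<lambda>e. tangent_vector A c p (0, fst e))" by (simp add: o_def)
    fix b :: "(real^'n) \<times> (real^'n)" assume "b \<in> Basis"
    then obtain i where "b = (axis i 1, 0) \<or> b = (0, axis i 1)"
      by (auto simp: Basis_prod_def Basis_vec_def)
    then show "S p (tangent_vector A c p b) = tangent_vector A c p (0, fst b)"
      using c p linear_0[OF t] by (auto simp: adapted_chart_def zero_prod_def)
  qed
  then show ?thesis by (rule fun_cong)
qed

lemma components_S:
  assumes "adapted_chart A S c" "p \<in> cdom c"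
  shows "components A c p (S p v) = (0, fst (components A c p v))"
  using S_tangent_vector[OF assms, of "components A c p v"] adapted_in_atlas[OF assms(1)] assms(2)
  by (simp add: tangent_vector_components components_tangent_vector)

lemma vertical_iff:
  assumes "adapted_chart A S c" "p \<in> cdom c"
  shows "v \<in> vertical S p \<longleftrightarrow> fst (components A c p v) = 0"
proof
  assume "v \<in> vertical S p"
  then show "fst (components A c p v) = 0"
    using components_S[OF assms] by (auto simp: vertical_def)
next
  assume "fst (components A c p v) = 0"
  then have "S p (tangent_vector A c p (snd (components A c p v), 0)) = v"
    using S_tangent_vector[OF assms, of "(snd (components A c p v), 0)"]
      tangent_vector_components[OF adapted_in_atlas[OF assms(1)] assms(2), of v]
    by (cases "components A c p v") simp
  then show "v \<in> vertical S p" by (metis vertical_def rangeI)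
qed

lemma tangent_vector_vertical_iff:
  assumes "adapted_chart A S c" "p \<in> cdom c"
  shows "tangent_vector A c p e \<in> vertical S p \<longleftrightarrow> fst e = 0"
  using vertical_iff[OF assms] components_tangent_vector[OF adapted_in_atlas[OF assms(1)] assms(2)]
  by simp

lemma subspace_vertical: "subspace (vertical S p)"
  unfolding vertical_def using linear_subspace_image[OF linear_S subspace_UNIV] .

lemma adapted_restrict:
  assumes "adapted_chart A S c" "open W"
  shows "adapted_chart A S (cdom c \<inter> W, cmap c)"
  using assms restrict_chart[OF adapted_in_atlas[OF assms(1)] assms(2)]
    restrict_chart_vectors(1)[OF adapted_in_atlas[OF assms(1)] assms(2)]
  by (auto simp: adapted_chart_def)

section \<open>Smooth functions and the forms \<open>theta A S L\<close>\<close>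

lemma smooth_functionD:
  "smooth_function A W f \<Longrightarrow> c \<in> A \<Longrightarrow> smooth_on (cmap c ` (cdom c \<inter> W)) (\<lambda>u. f (cinv c u))"
  by (simp add: smooth_function_def o_def)

lemma smooth_function_change:
  assumes W: "open W" "smooth_function A W f" and c: "c \<in> A" "c' \<in> A"
    and p: "p \<in> cdom c" "p \<in> cdom c'" "p \<in> W"
  shows "frechet_derivative (\<lambda>u. f (cinv c u)) (at (cmap c p)) e =
    frechet_derivative (\<lambda>u. f (cinv c' u)) (at (cmap c' p)) (jacobian c c' (cmap c p) e)"
proof -
  have T: "transition c c' (cmap c p) = cmap c' p" using c p cinv_cmap by simp
  have "((\<lambda>u. f (cinv c' (transition c c' u))) has_derivative
      (\<lambda>h. frechet_derivative (\<lambda>u. f (cinv c' u)) (at (transition c c' (cmap c p))) (jacobian c c' (cmap c p) h)))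
      (at (cmap c p))"
    using transition_differentiable[OF c p(1,2)] smooth_on_differentiable[OF smooth_functionD[OF W(2) c(2)]] p
    by (intro has_derivative_frechet_compose) (auto simp: T)
  then have "((\<lambda>u. f (cinv c u)) has_derivative
      (\<lambda>h. frechet_derivative (\<lambda>u. f (cinv c' u)) (at (cmap c' p)) (jacobian c c' (cmap c p) h)))
      (at (cmap c p))"
    unfolding T
    by (rule has_derivative_transform_within_open[OF _ open_image[OF c(1) is_chartD(1)[OF c(2)]]])
       (use c p in \<open>auto simp: cinv_cmap\<close>)
  from frechet_derivative_at[OF this, symmetric] show ?thesis by simp
qed

text \<open>
  \<open>\<theta>\<^sub>L(v) = dL(S v)\<close> makes sense in every chart, adapted or not; this gives the smoothness of
  \<open>\<theta>\<^sub>L\<close> in all charts.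
\<close>

lemma theta_chart:
  assumes W: "open W" "smooth_function A W L" and c: "c \<in> A" and p: "p \<in> cdom c" "p \<in> W"
  shows "theta A S L p [v] = frechet_derivative (\<lambda>u. L (cinv c u)) (at (cmap c p)) (components A c p (S p v))"
proof -
  let ?a = "adapted_chart_at A S p"
  have a: "?a \<in> A" "p \<in> cdom ?a" using adapted_chart_at adapted_in_atlas by blast+
  have "(\<lambda>u. L (cinv ?a u)) differentiable (at (cmap ?a p))"
    using smooth_on_differentiable[OF smooth_functionD[OF W(2) a(1)]] a p by blast
  from sum_partial_y[OF this]
  have "theta A S L p [v] = frechet_derivative (\<lambda>u. L (cinv ?a u)) (at (cmap ?a p)) (components A ?a p (S p v))"
    by (simp add: theta_def Let_def dx_def o_def components_S[OF adapted_chart_at])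
  also have "\<dots> = frechet_derivative (\<lambda>u. L (cinv c u)) (at (cmap c p))
      (jacobian ?a c (cmap ?a p) (components A ?a p (S p v)))"
    by (rule smooth_function_change[OF W a(1) c a(2) p])
  finally show ?thesis by (simp add: components_change[OF a(1) c a(2) p(1)])
qed

lemma theta_length: "length vs \<noteq> 1 \<Longrightarrow> theta A S L p vs = 0"
  by (auto simp: theta_def split: list.split)

lemma linear_theta: "linear (\<lambda>v. theta A S L p [v])"
proof -
  let ?a = "adapted_chart_at A S p"
  have "linear (components A ?a p)"
    using linear_components adapted_chart_at adapted_in_atlas by blast
  then show ?thesis
    by (intro linearI) (simp_all add: theta_def Let_def dx_def linear_add linear_scale sum.distrib
        distrib_left sum_distrib_left mult.left_commute)
qed

lemma theta_vertical: "v \<in> vertical S p \<Longrightarrow> theta A S L p [v] = 0"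
  using vertical_iff[OF adapted_chart_at] by (simp add: theta_def Let_def dx_def)

lemma differential_form_theta:
  assumes W: "open W" "smooth_function A W L"
  shows "differential_form A 1 W (theta A S L)"
  unfolding differential_form_def alternating_form_1_iff
proof (intro conjI ballI allI)
  fix c es assume c: "c \<in> A"
  let ?X = "cmap c ` (cdom c \<inter> W)"
  have X: "open ?X" using open_image c W by blast
  show "smooth_on ?X (\<lambda>u. form_rep A c (theta A S L) u es)"
  proof (cases "length es = 1")
    case False
    then show ?thesis by (simp add: form_rep_def theta_length smooth_on_const)
  next
    case True
    then obtain e where es: "es = [e]" by (auto simp: length_Suc_conv)
    let ?s = "\<lambda>u. components A c (cinv c u) (S (cinv c u) (tangent_vector A c (cinv c u) e))"
    have "smooth_on (cmap c ` cdom c) ?s"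
      using endomorphism c unfolding endomorphism_field_def by blast
    then have s: "smooth_on ?X ?s" by (rule smooth_on_subset) blast
    note L = smooth_functionD[OF W(2) c]
    have "smooth_on ?X (\<lambda>u. frechet_derivative (\<lambda>u. L (cinv c u)) (at u) (?s u))"
      by (rule smooth_on_linear_family[OF X linear_frechet_derivative[OF smooth_on_differentiable[OF L]]
            smooth_on_frechet_derivative[OF L] s])
    then show ?thesis
    proof (rule smooth_on_cong[OF X])
      fix u assume "u \<in> ?X"
      then obtain p where "p \<in> cdom c" "p \<in> W" "u = cmap c p" by blast
      then show "frechet_derivative (\<lambda>u. L (cinv c u)) (at u) (?s u) = form_rep A c (theta A S L) u es"
        by (simp add: es form_rep_def cinv_cmap[OF c] theta_chart[OF W c])
    qed
  qed
qed (simp_all add: theta_length linear_theta)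

lemma form_rep_theta:
  assumes "open W" "smooth_function A W L" "adapted_chart A S c" "u \<in> cmap c ` (cdom c \<inter> W)"
  shows "form_rep A c (theta A S L) u [e] = frechet_derivative (\<lambda>u. L (cinv c u)) (at u) (0, fst e)"
proof -
  have c: "c \<in> A" using adapted_in_atlas assms by blast
  obtain p where p: "p \<in> cdom c" "p \<in> W" "u = cmap c p" using assms by blast
  then show ?thesis
    using theta_chart[OF assms(1,2) c p(1,2), of "tangent_vector A c p e"]
    by (simp add: form_rep_def cinv_cmap[OF c] components_S[OF assms(3)] components_tangent_vector[OF c])
qed

end

section \<open>Normal bundles\<close>

locale normal_bundle_mfd = tangent_mfd A S
  for A :: "('m::{t2_space, second_countable_topology}, (real^'n) \<times> (real^'n)) chart set"
    and S :: "'m \<Rightarrow> (real^'n) \<times> (real^'n) \<Rightarrow> (real^'n) \<times> (real^'n)" +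
  fixes N :: "'m \<Rightarrow> ((real^'n) \<times> (real^'n)) set"
  assumes normal_bundle: "normal_bundle A S N"
begin

abbreviation "normal \<equiv> normal_part S N"
abbreviation "vert \<equiv> vertical_part S N"

lemma subspace_N: "subspace (N p)"
  using normal_bundle by (simp add: normal_bundle_def smooth_distribution_def)

lemma N_Int_vertical: "v \<in> N p \<Longrightarrow> v \<in> vertical S p \<Longrightarrow> v = 0"
  using normal_bundle unfolding normal_bundle_def by blast

lemma normal_unique:
  assumes "a \<in> N p" "v - a \<in> vertical S p"
  shows "normal p v = a"
  unfolding normal_part_def
proof (rule the_equality)
  fix b assume b: "b \<in> N p \<and> v - b \<in> vertical S p"
  have "b - a \<in> N p" using b assms subspace_diff[OF subspace_N] by blast
  moreover have "(v - a) - (v - b) \<in> vertical S p" using b assms subspace_diff[OF subspace_vertical] by blast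
  ultimately show "b = a" using N_Int_vertical[of "b - a" p] by simp
qed (use assms in simp)

lemma normal_in: "normal p v \<in> N p" and vert_in: "vert p v \<in> vertical S p"
proof -
  have "v \<in> {a + b | a b. a \<in> N p \<and> b \<in> vertical S p}"
    using normal_bundle unfolding normal_bundle_def by blast
  then obtain a b where "v = a + b" "a \<in> N p" "b \<in> vertical S p" by blast
  then have "normal p v = a" by (intro normal_unique) auto
  with \<open>v = a + b\<close> \<open>a \<in> N p\<close> \<open>b \<in> vertical S p\<close> show "normal p v \<in> N p" "vert p v \<in> vertical S p"
    by (simp_all add: vertical_part_def)
qed

lemma normal_vertical: "v \<in> vertical S p \<Longrightarrow> normal p v = 0"
  using subspace_0[OF subspace_N] by (intro normal_unique) auto

lemma vert_vertical: "v \<in> vertical S p \<Longrightarrow> vert p v = v"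
  by (simp add: vertical_part_def normal_vertical)

lemma vert_N: "v \<in> N p \<Longrightarrow> vert p v = 0"
  using normal_unique[of v p v] subspace_0[OF subspace_vertical] by (simp add: vertical_part_def)

lemma linear_normal: "linear (normal p)"
proof (rule linearI)
  fix v w r
  have "(v - normal p v) + (w - normal p w) \<in> vertical S p" "r *\<^sub>R (v - normal p v) \<in> vertical S p"
    using vert_in subspace_add[OF subspace_vertical] subspace_scale[OF subspace_vertical]
    by (simp_all add: vertical_part_def)
  then show "normal p (v + w) = normal p v + normal p w" "normal p (r *\<^sub>R v) = r *\<^sub>R normal p v"
    using normal_in subspace_add[OF subspace_N] subspace_scale[OF subspace_N]
    by (intro normal_unique; simp add: algebra_simps)+
qed

lemma linear_vert: "linear (vert p)"
  unfolding vertical_part_def using linear_compose_sub[OF linear_id linear_normal[of p]] by (simp add: id_def)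

text \<open>
  A local frame of the normal bundle projects to a frame of the transversal space, so the
  coefficients of the normal part are given by Cramer's rule.
\<close>

lemma smooth_normal:
  assumes c: "adapted_chart A S c"
  shows "smooth_on (cmap c ` cdom c)
    (\<lambda>u. components A c (cinv c u) (normal (cinv c u) (tangent_vector A c (cinv c u) e)))"
proof (rule smooth_on_local)
  note cA = adapted_in_atlas[OF c]
  fix u0 assume "u0 \<in> cmap c ` cdom c"
  then obtain p0 where p0: "p0 \<in> cdom c" "u0 = cmap c p0" by blast
  obtain W X where W: "open W" "p0 \<in> W" and X: "\<And>i. i < CARD('n) \<Longrightarrow> vector_field A W (X i)"
    and span: "\<And>q. q \<in> W \<Longrightarrow> N q = span ((\<lambda>i. X i q) ` {..<CARD('n)})"
    using normal_bundle unfolding normal_bundle_def smooth_distribution_def by meson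
  \<comment> \<open>The frame is numbered by naturals; \<open>f\<close> renumbers it by the index
    type, so that its x-components form a square matrix.\<close>
  obtain f :: "'n \<Rightarrow> nat" where f: "bij_betw f UNIV {..<CARD('n)}"
    using ex_bij_betw_finite_nat[of "UNIV :: 'n set"] by (auto simp: atLeast0LessThan)
  let ?U = "cmap c ` (cdom c \<inter> W)"
  have U: "open ?U" "u0 \<in> ?U" using open_image[OF cA W(1)] p0 W by auto
  define \<xi> where "\<xi> k u = field_rep A c (X (f k)) u" for k u
  have f_less: "f k < CARD('n)" for k using f by (auto simp: bij_betw_def)
  have \<xi>: "smooth_on ?U (\<xi> k)" for k
    using X[OF f_less] cA unfolding vector_field_def \<xi>_def by blast
  \<comment> \<open>Column \<open>k\<close> holds the x-components of the \<open>k\<close>-th frame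
    vector, that is, its class modulo the vertical space.\<close>
  define M :: "_ \<Rightarrow> real^'n^'n" where "M u = (\<chi> i k. fst (\<xi> k u) $ i)" for u
  have entry: "smooth_on ?U (\<lambda>u. M u $ i $ k)" for i k
  proof -
    have "bounded_linear (\<lambda>z :: (real^'n) \<times> (real^'n). fst z $ i)"
      using bounded_linear_compose[OF bounded_linear_vec_nth bounded_linear_fst] .
    from smooth_on_linear[OF U(1) this \<xi>] show ?thesis by (simp add: M_def)
  qed
  have smooth_det: "smooth_on ?U (\<lambda>u. det (B u))" if "\<And>i k. smooth_on ?U (\<lambda>u. B u $ i $ k)" for B :: "_ \<Rightarrow> real^'n^'n"
    unfolding det_def
    by (intro smooth_on_sum[OF U(1)] smooth_on_mult[OF U(1)] smooth_on_prod[OF U(1)] smooth_on_const that)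
  have comb: "components A c q (\<Sum>k\<in>UNIV. (a $ k) *\<^sub>R X (f k) q) = (\<Sum>k\<in>UNIV. (a $ k) *\<^sub>R \<xi> k (cmap c q))"
    if "q \<in> cdom c" for q a
  proof -
    interpret linear "components A c q" using linear_components cA that by blast
    show ?thesis using that by (simp add: sum scale \<xi>_def field_rep_def cinv_cmap[OF cA])
  qed
  have fst_comb: "fst (\<Sum>k\<in>UNIV. (a $ k) *\<^sub>R \<xi> k u) = M u *v a" for a u
    by (simp add: fst_sum vec_eq_iff matrix_vector_mult_def M_def mult.commute)
  have in_N: "(\<Sum>k\<in>UNIV. (a $ k) *\<^sub>R X (f k) q) \<in> N q" if "q \<in> W" for q a
    unfolding span[OF that] using f_less by (intro span_sum span_scale span_base) auto
  have N_comb: "\<exists>a. v = (\<Sum>k\<in>UNIV. (a $ k) *\<^sub>R X (f k) q)" if "q \<in> W" "v \<in> N q" for q v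
  proof -
    let ?F = "\<lambda>a. \<Sum>k\<in>UNIV. (a $ k) *\<^sub>R X (f k) q"
    have "linear ?F" by (rule linearI) (simp_all add: sum.distrib scaleR_add_left scaleR_sum_right)
    then have "subspace (range ?F)" using linear_subspace_image[OF _ subspace_UNIV] by blast
    moreover have "X i q \<in> range ?F" if "i < CARD('n)" for i
    proof -
      have "i \<in> range f" using f that by (simp add: bij_betw_def)
      then obtain k where k: "i = f k" by blast
      have "?F (axis k 1) = (\<Sum>j\<in>UNIV. if j = k then X (f k) q else 0)"
        by (rule sum.cong) (auto simp: axis_def)
      also have "\<dots> = X i q" by (simp add: k)
      finally show ?thesis by (rule range_eqI[OF sym])
    qed
    ultimately have "N q \<subseteq> range ?F" unfolding span[OF \<open>q \<in> W\<close>] by (intro span_minimal) auto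
    then show ?thesis using that by blast
  qed
  have det: "det (M u) \<noteq> 0" if "u \<in> ?U" for u
  proof -
    obtain q where q: "q \<in> cdom c" "q \<in> W" "u = cmap c q" using \<open>u \<in> ?U\<close> by blast
    \<comment> \<open>The normal part of the vector with components \<open>(x, 0)\<close> is a
      combination of the frame and has the same x-components, so its coefficients solve
      \<open>M u *v a = x\<close>.\<close>
    have "surj ((*v) (M u))"
      unfolding surj_def
    proof
      fix x :: "real^'n"
      let ?v = "tangent_vector A c q (x, 0)"
      obtain a where a: "normal q ?v = (\<Sum>k\<in>UNIV. (a $ k) *\<^sub>R X (f k) q)"
        using N_comb[OF q(2) normal_in] by blast
      have "fst (components A c q (vert q ?v)) = 0"
        using vert_in vertical_iff[OF c q(1)] by blast
      then have "fst (components A c q (normal q ?v)) = fst (components A c q ?v)"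
        using linear_diff[OF linear_components[OF cA q(1)]] by (simp add: vertical_part_def)
      then have "fst (components A c q (\<Sum>k\<in>UNIV. (a $ k) *\<^sub>R X (f k) q)) = x"
        unfolding a components_tangent_vector[OF cA q(1)] by simp
      then have "x = M u *v a" unfolding comb[OF q(1)] q(3)[symmetric] fst_comb by (rule sym)
      then show "\<exists>a. x = M u *v a" by blast
    qed
    then show ?thesis
      using matrix_right_invertible_surjective[of "M u"] invertible_right_inverse[of "M u"] invertible_det_nz by blast
  qed
  \<comment> \<open>The right-hand side of the system is \<open>fst e\<close>, because passing to
    the normal part does not change x-components.\<close>
  define a where "a u = (\<chi> k. det (\<chi> i j. if j = k then fst e $ i else M u $ i $ j) / det (M u))" for u
  have Ma: "M u *v a u = fst e" if "u \<in> ?U" for u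
    using cramer[OF det[OF that]] unfolding a_def by blast
  have sm_a: "smooth_on ?U (\<lambda>u. a u $ k)" for k
    unfolding a_def vec_lambda_beta
  proof (rule smooth_on_divide[OF U(1) smooth_det smooth_det[OF entry] det])
    show "smooth_on ?U (\<lambda>u. (\<chi> i j. if j = k then fst e $ i else M u $ i $ j) $ i $ j)" for i j
      using entry smooth_on_const by (cases "j = k") simp_all
  qed
  have "smooth_on ?U (\<lambda>u. \<Sum>k\<in>UNIV. (a u $ k) *\<^sub>R \<xi> k u)"
    by (intro smooth_on_sum[OF U(1)] smooth_on_scaleR[OF U(1)] sm_a \<xi>)
  then have "smooth_on ?U
    (\<lambda>u. components A c (cinv c u) (normal (cinv c u) (tangent_vector A c (cinv c u) e)))"
  proof (rule smooth_on_cong[OF U(1)])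
    fix u assume u: "u \<in> ?U"
    then obtain q where q: "q \<in> cdom c" "q \<in> W" "u = cmap c q" by blast
    let ?a = "\<Sum>k\<in>UNIV. (a u $ k) *\<^sub>R X (f k) q"
    have ca: "components A c q ?a = (\<Sum>k\<in>UNIV. (a u $ k) *\<^sub>R \<xi> k u)" using comb[OF q(1)] q by simp
    have "normal q (tangent_vector A c q e) = ?a"
    proof (rule normal_unique[OF in_N[OF q(2)]])
      show "tangent_vector A c q e - ?a \<in> vertical S q"
        unfolding vertical_iff[OF c q(1)] linear_diff[OF linear_components[OF cA q(1)]] ca
        by (simp add: components_tangent_vector[OF cA q(1)] fst_comb Ma[OF u])
    qed
    then show "(\<Sum>k\<in>UNIV. (a u $ k) *\<^sub>R \<xi> k u) =
      components A c (cinv c u) (normal (cinv c u) (tangent_vector A c (cinv c u) e))"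
      using ca q by (simp add: cinv_cmap[OF cA])
  qed
  then show "\<exists>Y. open Y \<and> u0 \<in> Y \<and> smooth_on Y
    (\<lambda>u. components A c (cinv c u) (normal (cinv c u) (tangent_vector A c (cinv c u) e)))"
    using U by blast
qed

lemma smooth_vert:
  assumes c: "adapted_chart A S c"
  shows "smooth_on (cmap c ` cdom c)
    (\<lambda>u. components A c (cinv c u) (vert (cinv c u) (tangent_vector A c (cinv c u) e)))"
proof -
  note cA = adapted_in_atlas[OF c]
  from smooth_on_diff[OF is_chartD(2)[OF cA] smooth_on_const[of _ e] smooth_normal[OF c, of e]]
  show ?thesis
  proof (rule smooth_on_cong[OF is_chartD(2)[OF cA]])
    fix u assume "u \<in> cmap c ` cdom c"
    then have "cinv c u \<in> cdom c" by (rule cinv_in[OF cA])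
    then show "e - components A c (cinv c u) (normal (cinv c u) (tangent_vector A c (cinv c u) e)) =
      components A c (cinv c u) (vert (cinv c u) (tangent_vector A c (cinv c u) e))"
      using linear_diff[OF linear_components[OF cA]] components_tangent_vector[OF cA]
      by (simp add: vertical_part_def)
  qed
qed

end

section \<open>The operator \<open>d''\<close> on forms of type \<open>(1,0)\<close>\<close>

lemma type_component_0:
  "type_component S N 0 q \<omega> x vs = (if length vs = q then \<omega> x (map (vertical_part S N x) vs) else 0)"
proof -
  have J: "{J. J \<subseteq> {..<q} \<and> card J = 0} = {{}}"
    by (auto dest: finite_subset)
  have "map (\<lambda>i. vertical_part S N x (vs ! i)) [0..<length vs] = map (vertical_part S N x) vs"
    by (rule nth_equalityI) simp_all
  then show ?thesis unfolding type_component_def add_0 J by auto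
qed

lemma type_component_right_0:
  "type_component S N p 0 \<omega> x vs = (if length vs = p then \<omega> x (map (normal_part S N x) vs) else 0)"
proof -
  have J: "{J. J \<subseteq> {..<p} \<and> card J = p} = {{..<p}}"
    by (auto dest: card_subset_eq[rotated])
  have "map (\<lambda>i. if i \<in> {..<length vs} then normal_part S N x (vs ! i) else vertical_part S N x (vs ! i))
      [0..<length vs] = map (normal_part S N x) vs"
    by (rule nth_equalityI) simp_all
  then show ?thesis unfolding type_component_def add_0_right J by auto
qed

lemma type_component_1:
  "type_component S N 1 q \<omega> x vs =
    (if length vs = Suc q
     then \<Sum>i<Suc q. \<omega> x (map (\<lambda>j. if j = i then normal_part S N x (vs ! j) else vertical_part S N x (vs ! j)) [0..<Suc q])
     else 0)"
proof -
  have J: "{J. J \<subseteq> {..<1 + q} \<and> card J = 1} = (\<lambda>i. {i}) ` {..<Suc q}"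
    by (auto simp: card_1_singleton_iff)
  show ?thesis
    unfolding type_component_def J by (simp add: sum.reindex del: upt_Suc)
qed

lemma type_component_1_1:
  "type_component S N 1 1 \<omega> x [v, w] =
    \<omega> x [normal_part S N x v, vertical_part S N x w] + \<omega> x [vertical_part S N x v, normal_part S N x w]"
  unfolding type_component_1 by (simp add: lessThan_Suc)

lemma type_component_1_2:
  "type_component S N 1 2 \<omega> x [v, w, z] =
    \<omega> x [normal_part S N x v, vertical_part S N x w, vertical_part S N x z] +
    \<omega> x [vertical_part S N x v, normal_part S N x w, vertical_part S N x z] +
    \<omega> x [vertical_part S N x v, vertical_part S N x w, normal_part S N x z]"
  unfolding type_component_1 by (simp add: lessThan_Suc numeral_2_eq_2)

lemma type_component_length:
  "length vs \<noteq> p + q \<Longrightarrow> type_component S N p q \<omega> x vs = 0"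
  by (simp add: type_component_def)

lemma type_component_zero:
  "(\<And>vs. \<omega> x vs = 0) \<Longrightarrow> type_component S N p q \<omega> x vs = 0"
  by (simp add: type_component_def)

lemma d_vert_1_expand:
  "d_vert A S N 1 \<omega> x vs =
    type_component S N 0 2 (ext_deriv A (type_component S N 0 1 \<omega>)) x vs +
    type_component S N 1 1 (ext_deriv A (type_component S N 1 0 \<omega>)) x vs"
  by (simp add: d_vert_def numeral_2_eq_2)

lemma d_vert_2_expand:
  "d_vert A S N 2 \<omega> x vs =
    type_component S N 0 3 (ext_deriv A (type_component S N 0 2 \<omega>)) x vs +
    type_component S N 1 2 (ext_deriv A (type_component S N 1 1 \<omega>)) x vs +
    type_component S N 2 1 (ext_deriv A (type_component S N 2 0 \<omega>)) x vs"
  by (simp add: d_vert_def numeral_2_eq_2 numeral_3_eq_3)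

lemma wedge_1: "wedge (Suc 0) \<alpha> [v] = \<alpha> 0 v"
  by (simp add: wedge_def lessThan_Suc permutes_sing sign_id)

lemma wedge_2: "wedge 2 \<alpha> [v, w] = \<alpha> 0 v * \<alpha> 1 w - \<alpha> 0 w * \<alpha> 1 v"
proof -
  have 2: "{..<2} = insert 0 {1::nat}" by auto
  show ?thesis
    unfolding wedge_def 2
    by (simp add: sum_over_permutations_insert permutes_sing sign_swap_id sign_id numeral_2_eq_2)
qed

lemma wedge_length: "length vs \<noteq> k \<Longrightarrow> wedge k \<alpha> vs = 0"
  by (simp add: wedge_def)

text \<open>The line through \<open>x\<close> in the direction \<open>(0, b)\<close> is known to lie
  in \<open>X\<close> for small parameters, hence the comparison with a constant on the open
  preimage of \<open>X\<close>.\<close>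

lemma frechet_derivative_vertical_zero:
  fixes f :: "'a::euclidean_space \<times> 'b::euclidean_space \<Rightarrow> real"
  assumes "open X" "x \<in> X" "f differentiable (at x)" "\<And>y. y \<in> X \<Longrightarrow> fst y = fst x \<Longrightarrow> f y = f x"
  shows "frechet_derivative f (at x) (0, b) = 0"
proof -
  let ?g = "\<lambda>t. x + t *\<^sub>R (0, b)"
  have 1: "((\<lambda>t. f (?g t)) has_real_derivative frechet_derivative f (at (?g 0)) (0, b)) (at 0)"
    by (rule frechet_derivative_along_line) (use assms(3) in \<open>simp flip: zero_prod_def\<close>)
  have 2: "((\<lambda>t. f (?g t)) has_real_derivative 0) (at 0)"
  proof (rule has_field_derivative_transform_within_open)
    show "((\<lambda>t. f x) has_real_derivative 0) (at 0)" by simp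
    show "open (?g -` X)" by (intro open_vimage assms(1) continuous_intros)
    show "0 \<in> ?g -` X" using assms(2) by (simp flip: zero_prod_def)
    show "f x = f (?g t)" if "t \<in> ?g -` X" for t using assms(4)[of "?g t"] that by simp
  qed
  from DERIV_unique[OF 1 2] show ?thesis by (simp flip: zero_prod_def)
qed

context manifold
begin

lemma ext_deriv_zero:
  assumes "open W" "p \<in> W" "\<And>q vs. q \<in> W \<Longrightarrow> \<omega> q vs = 0"
  shows "ext_deriv A \<omega> p vs = 0"
proof -
  have "ext_deriv A \<omega> p vs = ext_deriv A (\<lambda>_ _. 0) p vs"
    by (rule ext_deriv_cong[OF assms(1,2)]) (use assms(3) in auto)
  then show ?thesis by (simp add: ext_deriv_def Let_def ext_deriv_coord_def form_rep_def)
qed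

end

context normal_bundle_mfd
begin

text \<open>Forms of type (1,0) over \<open>W\<close>, encoded by vanishing on vertical vectors:
  this avoids the wedge sums of \<open>has_type\<close> and makes no reference to \<open>N\<close>.
  The two descriptions are identified by \<open>has_type_1_0_iff\<close>.\<close>

definition transverse_form where
  "transverse_form W \<omega> \<longleftrightarrow> differential_form A 1 W \<omega> \<and> (\<forall>p\<in>W. \<forall>v\<in>vertical S p. \<omega> p [v] = 0)"

text \<open>For vertical \<open>z\<close> this is \<open>(z \<phi>\<^sub>i) w\<^sup>i\<close>, where \<open>\<omega> = \<phi>\<^sub>i dx\<^sup>i\<close>.\<close>

definition vert_deriv where
  "vert_deriv c \<omega> p z w =
    frechet_derivative (\<lambda>u. form_rep A c \<omega> u [components A c p w]) (at (cmap c p)) (components A c p z)"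

lemma transverse_formD:
  assumes "transverse_form W \<omega>"
  shows "differential_form A 1 W \<omega>" "\<And>p. p \<in> W \<Longrightarrow> alternating_form 1 (\<omega> p)"
    "\<And>p. p \<in> W \<Longrightarrow> linear (\<lambda>v. \<omega> p [v])" "\<And>p vs. p \<in> W \<Longrightarrow> length vs \<noteq> 1 \<Longrightarrow> \<omega> p vs = 0"
    "\<And>p v. p \<in> W \<Longrightarrow> v \<in> vertical S p \<Longrightarrow> \<omega> p [v] = 0"
proof -
  show *: "differential_form A 1 W \<omega>" "\<And>p v. p \<in> W \<Longrightarrow> v \<in> vertical S p \<Longrightarrow> \<omega> p [v] = 0"
    using assms by (auto simp: transverse_form_def)
  show **: "\<And>p. p \<in> W \<Longrightarrow> alternating_form 1 (\<omega> p)"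
    using *(1) unfolding differential_form_def by blast
  show "\<And>p. p \<in> W \<Longrightarrow> linear (\<lambda>v. \<omega> p [v])" "\<And>p vs. p \<in> W \<Longrightarrow> length vs \<noteq> 1 \<Longrightarrow> \<omega> p vs = 0"
    using ** unfolding alternating_form_1_iff by blast+
qed

lemma transverse_form_subset: "transverse_form W \<omega> \<Longrightarrow> W' \<subseteq> W \<Longrightarrow> transverse_form W' \<omega>"
  unfolding transverse_form_def using differential_form_subset by blast

lemma transverse_form_diff:
  "open W \<Longrightarrow> transverse_form W \<omega> \<Longrightarrow> transverse_form W \<omega>' \<Longrightarrow> transverse_form W (\<lambda>p vs. \<omega> p vs - \<omega>' p vs)"
  using differential_form_diff unfolding transverse_form_def by simp

lemma transverse_form_theta:
  "open W \<Longrightarrow> smooth_function A W L \<Longrightarrow> transverse_form W (theta A S L)"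
  unfolding transverse_form_def using differential_form_theta theta_vertical by blast

lemma has_type_1_0_iff:
  assumes "\<And>p. p \<in> W \<Longrightarrow> alternating_form 1 (\<omega> p)"
  shows "has_type S N 1 0 W \<omega> \<longleftrightarrow> (\<forall>p\<in>W. \<forall>v\<in>vertical S p. \<omega> p [v] = 0)"
proof
  assume h: "has_type S N 1 0 W \<omega>"
  show "\<forall>p\<in>W. \<forall>v\<in>vertical S p. \<omega> p [v] = 0"
  proof (intro ballI)
    fix p v assume p: "p \<in> W" and v: "v \<in> vertical S p"
    obtain m :: nat and \<alpha> where "\<forall>r<m. \<alpha> r 0 \<in> annihilator (vertical S p)"
      "\<omega> p = (\<lambda>vs. \<Sum>r<m. wedge 1 (\<alpha> r) vs)"
      using h p unfolding has_type_def by fastforce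
    with v show "\<omega> p [v] = 0" by (simp add: wedge_1 annihilator_def)
  qed
next
  assume r: "\<forall>p\<in>W. \<forall>v\<in>vertical S p. \<omega> p [v] = 0"
  show "has_type S N 1 0 W \<omega>"
    unfolding has_type_def
  proof
    fix p assume p: "p \<in> W"
    \<comment> \<open>A 1-form is its own decomposition, with one summand and one factor.\<close>
    let ?\<alpha> = "\<lambda>(r::nat) (i::nat) v. \<omega> p [v]"
    have lin: "linear (\<lambda>v. \<omega> p [v])" and len: "\<And>vs. length vs \<noteq> 1 \<Longrightarrow> \<omega> p vs = 0"
      using assms[OF p] unfolding alternating_form_1_iff by blast+
    have "\<omega> p vs = (\<Sum>r<1. wedge (1 + 0) (?\<alpha> r) vs)" for vs
    proof (cases "length vs = 1")
      case True
      then obtain v where "vs = [v]" by (auto simp: length_Suc_conv)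
      then show ?thesis by (simp add: wedge_1)
    next
      case False
      then show ?thesis using len[OF False] by (simp add: wedge_length)
    qed
    moreover have "\<forall>r<1. (\<forall>i<1. ?\<alpha> r i \<in> annihilator (vertical S p)) \<and>
        (\<forall>i\<in>{1..<1 + 0}. ?\<alpha> r i \<in> annihilator (N p))"
      using lin r p by (simp add: annihilator_def)
    ultimately show "\<exists>(m::nat) \<alpha>. (\<forall>r<m. (\<forall>i<1. \<alpha> r i \<in> annihilator (vertical S p)) \<and>
        (\<forall>i\<in>{1..<1 + 0}. \<alpha> r i \<in> annihilator (N p))) \<and>
        \<omega> p = (\<lambda>vs. \<Sum>r<m. wedge (1 + 0) (\<alpha> r) vs)"
      by (intro exI[of _ 1] exI[of _ ?\<alpha>] conjI ext)
  qed
qed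

text \<open>At all points of \<open>W\<close> the (0,1) component of \<open>\<omega>\<close>
  vanishes and the (1,0) component is \<open>\<omega>\<close> itself. Since \<open>W\<close> is
  open, both facts may be used under \<open>ext_deriv\<close>, and the (1,1) component of the
  exterior derivative remains.\<close>

lemma d_vert_1_ext_deriv:
  assumes "open W" "transverse_form W \<omega>" "p \<in> W"
  shows "d_vert A S N 1 \<omega> p [v, w] =
    ext_deriv A \<omega> p [normal p v, vert p w] + ext_deriv A \<omega> p [vert p v, normal p w]"
proof -
  note \<omega> = transverse_formD[OF assms(2)]
  have "type_component S N 0 1 \<omega> q vs = 0" if "q \<in> W" for q vs
    using \<omega>(5)[OF that vert_in] by (auto simp: type_component_0 length_Suc_conv)
  then have "ext_deriv A (type_component S N 0 1 \<omega>) p vs = 0" for vs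
    using ext_deriv_zero[OF assms(1,3)] by blast
  then have "type_component S N 0 2 (ext_deriv A (type_component S N 0 1 \<omega>)) p [v, w] = 0"
    by (rule type_component_zero)
  moreover have "type_component S N 1 0 \<omega> q = \<omega> q" if "q \<in> W" for q
  proof
    fix vs
    have "\<omega> q [normal q v] = \<omega> q [v]" for v
      using linear_diff[OF \<omega>(3)[OF that], of v "normal q v"] \<omega>(5)[OF that vert_in[of q v]]
      by (simp add: vertical_part_def)
    then show "type_component S N 1 0 \<omega> q vs = \<omega> q vs"
      using \<omega>(4)[OF that, of vs] by (auto simp: type_component_right_0 length_Suc_conv)
  qed
  then have "ext_deriv A (type_component S N 1 0 \<omega>) p vs = ext_deriv A \<omega> p vs" for vs
    using ext_deriv_cong[OF assms(1,3)] by blast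
  ultimately show ?thesis by (simp only: d_vert_1_expand type_component_1_1)
qed

lemma d_vert_1_length: "length vs \<noteq> 2 \<Longrightarrow> d_vert A S N 1 \<omega> p vs = 0"
  unfolding d_vert_1_expand by (subst (1 2) type_component_length) simp_all

section \<open>The operator d'' in a fixed adapted chart\<close>

context
  fixes c W \<omega>
  assumes c: "adapted_chart A S c" and W: "open W" and \<omega>: "transverse_form W \<omega>"
begin

lemma chart_in_atlas: "c \<in> A"
  using c by (rule adapted_in_atlas)

lemma open_chart_image: "open (cmap c ` (cdom c \<inter> W))"
  using open_image[OF chart_in_atlas W] .

lemma linear_form_rep: "u \<in> cmap c ` (cdom c \<inter> W) \<Longrightarrow> linear (\<lambda>e. form_rep A c \<omega> u [e])"
  by (rule alternating_form_1D[OF alternating_form_rep[OF transverse_formD(1)[OF \<omega>] chart_in_atlas]])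

lemma form_rep_vertical:
  assumes "u \<in> cmap c ` (cdom c \<inter> W)" "fst e = 0"
  shows "form_rep A c \<omega> u [e] = 0"
proof -
  obtain p where p: "p \<in> cdom c" "p \<in> W" "u = cmap c p" using assms(1) by blast
  then have "tangent_vector A c p e \<in> vertical S p"
    using tangent_vector_vertical_iff[OF c] assms(2) by blast
  then show ?thesis using transverse_formD(5)[OF \<omega>] p by (simp add: form_rep_def cinv_cmap[OF chart_in_atlas])
qed

lemma smooth_rep: "smooth_on (cmap c ` (cdom c \<inter> W)) (\<lambda>u. form_rep A c \<omega> u es)"
  by (rule smooth_form_rep[OF transverse_formD(1)[OF \<omega>] chart_in_atlas])

lemma form_rep_differentiable: "p \<in> cdom c \<Longrightarrow> p \<in> W \<Longrightarrow> (\<lambda>u. form_rep A c \<omega> u es) differentiable (at (cmap c p))"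
  using smooth_on_differentiable[OF smooth_rep] by blast

lemma linear_vert_deriv_left:
  assumes "p \<in> cdom c" "p \<in> W"
  shows "linear (\<lambda>z. vert_deriv c \<omega> p z w)"
  unfolding vert_deriv_def
  using linear_compose[OF linear_components[OF chart_in_atlas assms(1)] linear_frechet_derivative[OF form_rep_differentiable[OF assms]]]
  by (simp add: o_def)

lemma linear_vert_deriv_right:
  assumes p: "p \<in> cdom c" "p \<in> W"
  shows "linear (\<lambda>w. vert_deriv c \<omega> p z w)"
proof -
  let ?f = "\<lambda>e u. form_rep A c \<omega> u [e]"
  let ?D = "\<lambda>e. frechet_derivative (?f e) (at (cmap c p))"
  have D: "(?f e has_derivative ?D e) (at (cmap c p))" for e
    by (rule has_derivative_frechet_derivative[OF form_rep_differentiable[OF p]])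
  have u: "cmap c p \<in> cmap c ` (cdom c \<inter> W)" using p by blast
  have "linear (\<lambda>e. ?D e h)" for h
  proof (rule linearI)
    fix e e' r
    have "(?f (e + e') has_derivative (\<lambda>h. ?D e h + ?D e' h)) (at (cmap c p))"
      by (rule has_derivative_transform_within_open[OF has_derivative_add[OF D D] open_chart_image u])
         (simp add: linear_add[OF linear_form_rep])
    from frechet_derivative_at[OF this, symmetric] show "?D (e + e') h = ?D e h + ?D e' h"
      by simp
    have "(?f (r *\<^sub>R e) has_derivative (\<lambda>h. r *\<^sub>R ?D e h)) (at (cmap c p))"
      by (rule has_derivative_transform_within_open[OF has_derivative_scaleR_right[OF D] open_chart_image u])
         (simp add: linear_scale[OF linear_form_rep])
    from frechet_derivative_at[OF this, symmetric] show "?D (r *\<^sub>R e) h = r *\<^sub>R ?D e h"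
      by simp
  qed
  from linear_compose[OF linear_components[OF chart_in_atlas p(1)] this] show ?thesis
    by (simp add: vert_deriv_def o_def)
qed

text \<open>With its components kept constant, a vertical \<open>w\<close> stays vertical over the
  whole adapted chart, so the differentiated function is zero near \<open>p\<close>. The direction
  \<open>z\<close> may be arbitrary.\<close>

lemma vert_deriv_vertical:
  assumes p: "p \<in> cdom c" "p \<in> W" and w: "w \<in> vertical S p"
  shows "vert_deriv c \<omega> p z w = 0"
proof -
  have "frechet_derivative (\<lambda>u. form_rep A c \<omega> u [components A c p w]) (at (cmap c p)) =
      frechet_derivative (\<lambda>u. 0) (at (cmap c p))"
    by (rule frechet_derivative_cong_open[OF open_chart_image])
       (use p w vertical_iff[OF c p(1)] in \<open>auto intro!: form_rep_vertical\<close>)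
  then show ?thesis by (simp add: vert_deriv_def)
qed

lemma vert_deriv_normal:
  assumes "p \<in> cdom c" "p \<in> W"
  shows "vert_deriv c \<omega> p z (normal p w) = vert_deriv c \<omega> p z w"
  using linear_diff[OF linear_vert_deriv_right[OF assms], of z w "normal p w"]
    vert_deriv_vertical[OF assms vert_in, of z w]
  by (simp add: vertical_part_def)

text \<open>Of the four terms of the two exterior derivatives, those along a normal direction have a
  vertical argument and vanish by \<open>vert_deriv_vertical\<close>. In the other two the argument
  may be replaced by its unprojected value.\<close>

lemma d_vert_1_chart:
  assumes p: "p \<in> cdom c" "p \<in> W"
  shows "d_vert A S N 1 \<omega> p [v, w] = vert_deriv c \<omega> p (vert p v) w - vert_deriv c \<omega> p (vert p w) v"
proof -
  have "ext_deriv A \<omega> p [a, b] = vert_deriv c \<omega> p a b - vert_deriv c \<omega> p b a" for a b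
    unfolding ext_deriv_chart_1[OF W transverse_formD(1)[OF \<omega>] chart_in_atlas p] ext_deriv_coord_1 vert_deriv_def ..
  then show ?thesis
    unfolding d_vert_1_ext_deriv[OF W \<omega> p(2)]
    by (simp add: vert_deriv_normal[OF p] vert_deriv_vertical[OF p vert_in])
qed

lemma d_vert_1_form_rep:
  assumes "u \<in> cmap c ` (cdom c \<inter> W)"
  shows "form_rep A c (d_vert A S N 1 \<omega>) u [v, w] =
    frechet_derivative (\<lambda>u. form_rep A c \<omega> u [w]) (at u) (components A c (cinv c u) (vert (cinv c u) (tangent_vector A c (cinv c u) v))) -
    frechet_derivative (\<lambda>u. form_rep A c \<omega> u [v]) (at u) (components A c (cinv c u) (vert (cinv c u) (tangent_vector A c (cinv c u) w)))"
proof -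
  obtain p where p: "p \<in> cdom c" "p \<in> W" "u = cmap c p" using assms by blast
  show ?thesis
    using d_vert_1_chart[OF p(1,2), of "tangent_vector A c p v" "tangent_vector A c p w"] p
    by (simp add: form_rep_def cinv_cmap[OF chart_in_atlas] vert_deriv_def components_tangent_vector[OF chart_in_atlas])
qed

lemma alternating_form_d_vert_1:
  assumes p: "p \<in> cdom c" "p \<in> W"
  shows "alternating_form 2 (d_vert A S N 1 \<omega> p)"
proof -
  have "linear (\<lambda>v. vert_deriv c \<omega> p (vert p v) w)" for w
    using linear_compose[OF linear_vert linear_vert_deriv_left[OF p]] by (simp add: o_def)
  then have "linear (\<lambda>v. d_vert A S N 1 \<omega> p [v, w])" "linear (\<lambda>v. d_vert A S N 1 \<omega> p [w, v])" for w
    unfolding d_vert_1_chart[OF p] using linear_vert_deriv_right[OF p] by (intro linear_compose_sub; blast)+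
  moreover have "d_vert A S N 1 \<omega> p [v, v] = 0" for v unfolding d_vert_1_chart[OF p] by simp
  ultimately show ?thesis unfolding alternating_form_2_iff using d_vert_1_length by blast
qed

lemma differential_form_d_vert_1_chart: "differential_form A 2 (cdom c \<inter> W) (d_vert A S N 1 \<omega>)"
proof (rule differential_form_2I[OF chart_in_atlas open_Int[OF is_chartD(1)[OF chart_in_atlas] W]])
  fix v w
  let ?X = "cmap c ` (cdom c \<inter> W)"
  have 1: "smooth_on ?X (\<lambda>u. frechet_derivative (\<lambda>u. form_rep A c \<omega> u [w]) (at u)
     (components A c (cinv c u) (vert (cinv c u) (tangent_vector A c (cinv c u) v))))" for v w
    by (rule smooth_on_linear_family[OF open_chart_image linear_frechet_derivative[OF smooth_on_differentiable[OF smooth_rep]]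
          smooth_on_frechet_derivative[OF smooth_rep] smooth_on_subset[OF smooth_vert[OF c]]]) auto
  show "smooth_on ?X (\<lambda>u. form_rep A c (d_vert A S N 1 \<omega>) u [v, w])"
    by (rule smooth_on_cong[OF open_chart_image smooth_on_diff[OF open_chart_image 1 1]])
       (rule d_vert_1_form_rep[symmetric])
qed (use alternating_form_d_vert_1 in auto)

text \<open>Putting \<open>normal p w\<close> into the second slot makes the second term of
  \<open>d_vert_1_chart\<close> a derivative along the zero vector, which isolates the derivative
  along \<open>z\<close>.\<close>

lemma vert_deriv_eq_0:
  assumes p: "p \<in> cdom c" "p \<in> W" and 0: "\<And>v w. d_vert A S N 1 \<omega> p [v, w] = 0" and z: "z \<in> vertical S p"
  shows "vert_deriv c \<omega> p z w = 0"
proof -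
  have "d_vert A S N 1 \<omega> p [z, normal p w] = vert_deriv c \<omega> p z w"
    unfolding d_vert_1_chart[OF p] using z
    by (simp add: vert_vertical vert_N[OF normal_in] vert_deriv_normal[OF p] linear_0[OF linear_vert_deriv_left[OF p]])
  then show ?thesis using 0 by simp
qed

end

section \<open>The form d'' omega: smoothness, closedness, type and linearity in omega\<close>

lemma differential_form_d_vert_1:
  assumes "open W" "transverse_form W \<omega>"
  shows "differential_form A 2 W (d_vert A S N 1 \<omega>)"
proof (rule differential_form_local)
  fix p assume p: "p \<in> W"
  obtain c where c: "adapted_chart A S c" "p \<in> cdom c" using adapted_cover by blast
  have "open (cdom c \<inter> W)" using is_chartD(1)[OF adapted_in_atlas[OF c(1)]] assms(1) by blast
  then show "\<exists>W'. open W' \<and> p \<in> W' \<and> differential_form A 2 W' (d_vert A S N 1 \<omega>)"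
    using differential_form_d_vert_1_chart[OF c(1) assms] c p by blast
qed

text \<open>The three identities are the (0,2), (2,0) and (1,1) components of d'' omega, written as
  \<open>type_component\<close> evaluates them on two arguments.\<close>

lemma d_vert_1_normal_vert:
  assumes "open W" "transverse_form W \<omega>" "p \<in> W"
  shows "d_vert A S N 1 \<omega> p [vert p v, vert p w] = 0"
    and "d_vert A S N 1 \<omega> p [normal p v, normal p w] = 0"
    and "d_vert A S N 1 \<omega> p [normal p v, vert p w] + d_vert A S N 1 \<omega> p [vert p v, normal p w] =
      d_vert A S N 1 \<omega> p [v, w]"
proof -
  obtain c where c: "adapted_chart A S c" "p \<in> cdom c" using adapted_cover by blast
  note simps = d_vert_1_chart[OF c(1) assms(1,2) c(2) assms(3)] vert_vertical[OF vert_in] vert_N[OF normal_in]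
    vert_deriv_vertical[OF c(1) assms(1,2) c(2) assms(3) vert_in]
    vert_deriv_normal[OF c(1) assms(1,2) c(2) assms(3)]
    linear_0[OF linear_vert_deriv_left[OF c(1) assms(1,2) c(2) assms(3)]]
  show "d_vert A S N 1 \<omega> p [vert p v, vert p w] = 0"
    "d_vert A S N 1 \<omega> p [normal p v, normal p w] = 0"
    "d_vert A S N 1 \<omega> p [normal p v, vert p w] + d_vert A S N 1 \<omega> p [vert p v, normal p w] =
      d_vert A S N 1 \<omega> p [v, w]"
    by (simp_all only: simps)
qed

text \<open>
  Writing \<open>\<psi> e u = \<omega>\<^sub>u(e)\<close> for constant \<open>e\<close>, the components of \<open>d''\<omega>\<close> with a vertical argument are
  vertical derivatives of \<open>\<psi>\<close>, whatever the normal bundle is.  On two vertical arguments and a third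
  one the exterior derivative is thus a difference of mixed second derivatives of \<open>\<psi>\<close>.
\<close>

lemma ext_deriv_d_vert_1_vertical:
  assumes W: "open W" "transverse_form W \<omega>" "p \<in> W"
    and v: "v1 \<in> vertical S p \<and> v2 \<in> vertical S p \<or> v0 \<in> vertical S p \<and> v2 \<in> vertical S p \<or>
      v0 \<in> vertical S p \<and> v1 \<in> vertical S p"
  shows "ext_deriv A (d_vert A S N 1 \<omega>) p [v0, v1, v2] = 0"
proof -
  obtain c where c: "adapted_chart A S c" and p: "p \<in> cdom c" using adapted_cover by blast
  note cA = adapted_in_atlas[OF c]
  let ?X = "cmap c ` (cdom c \<inter> W)" and ?f = "form_rep A c (d_vert A S N 1 \<omega>)" and ?u = "cmap c p"
  let ?\<psi> = "\<lambda>e u. form_rep A c \<omega> u [e]"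
  define H where "H e a b = frechet_derivative (\<lambda>u. frechet_derivative (?\<psi> e) (at u) a) (at ?u) b" for e a b
  have X: "open ?X" "?u \<in> ?X" using open_image[OF cA W(1)] p W(3) by auto
  have \<psi>: "smooth_on ?X (?\<psi> e)" for e by (rule smooth_rep[OF c W(1,2)])
  have H_sym: "H e a b = H e b a" for e a b
    unfolding H_def by (rule frechet_derivative_commute[OF X \<psi>])
  have \<psi>_zero: "frechet_derivative (?\<psi> e) (at u) a = 0" if "fst e = 0" "u \<in> ?X" for e a u
    using frechet_derivative_cong_open[OF X(1) that(2), of "?\<psi> e" "\<lambda>_. 0"]
      form_rep_vertical[OF c W(1,2) _ that(1)] by simp
  have H_zero: "H e a b = 0" if "fst e = 0" for e a b
    using frechet_derivative_cong_open[OF X, of "\<lambda>u. frechet_derivative (?\<psi> e) (at u) a" "\<lambda>_. 0"] \<psi>_zero[OF that]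
    unfolding H_def by simp
  have swap: "?f u [e, e'] = - ?f u [e', e]" if "u \<in> ?X" for u e e'
    using alternating_form_rep[OF differential_form_d_vert_1[OF W(1,2)] cA that]
    by (rule alternating_form_2_swap)
  \<comment> \<open>For vertical \<open>e\<close> the projection \<open>vert\<close> fixes the first
    argument and the term with \<open>?\<psi> e\<close> is zero. The normal bundle has disappeared
    from the right-hand side, so the next derivative does not meet it.\<close>
  have left: "?f u [e, e'] = frechet_derivative (?\<psi> e') (at u) e" if u: "u \<in> ?X" and e: "fst e = 0" for u e e'
  proof -
    have q: "cinv c u \<in> cdom c" using u cinv_in[OF cA] by blast
    then have "tangent_vector A c (cinv c u) e \<in> vertical S (cinv c u)"
      using tangent_vector_vertical_iff[OF c] e by blast
    then show ?thesis
      unfolding d_vert_1_form_rep[OF c W(1,2) u] \<psi>_zero[OF e u]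
      by (simp add: vert_vertical components_tangent_vector[OF cA q])
  qed
  have dl: "frechet_derivative (\<lambda>u. ?f u [e, e']) (at ?u) h = H e' e h" if "fst e = 0" for e e' h
    using frechet_derivative_cong_open[OF X, of "\<lambda>u. ?f u [e, e']" "\<lambda>u. frechet_derivative (?\<psi> e') (at u) e"]
      left[OF _ that] unfolding H_def by simp
  have dr: "frechet_derivative (\<lambda>u. ?f u [e, e']) (at ?u) h = - H e e' h" if "fst e' = 0" for e e' h
  proof -
    have D: "((\<lambda>u. frechet_derivative (?\<psi> e) (at u) e') has_derivative H e e') (at ?u)"
      unfolding H_def
      by (intro has_derivative_frechet_derivative smooth_on_differentiable[OF smooth_on_frechet_derivative[OF \<psi>] X(2)])
    have "((\<lambda>u. ?f u [e, e']) has_derivative (\<lambda>h. - H e e' h)) (at ?u)"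
      by (rule has_derivative_transform_within_open[OF has_derivative_minus[OF D] X])
         (simp only: swap[of _ e e'] left[OF _ that])
    from frechet_derivative_at[OF this, symmetric] show ?thesis by simp
  qed
  let ?e = "components A c p"
  have fst_zero: "v \<in> vertical S p \<Longrightarrow> fst (?e v) = 0" for v using vertical_iff[OF c p] by blast
  show ?thesis
    unfolding ext_deriv_chart_2[OF W(1) differential_form_d_vert_1[OF W(1,2)] cA p W(3)] ext_deriv_coord_2
    using v
  \<comment> \<open>In each case the term that differentiates along the remaining argument has two
    vertical arguments and is zero by \<open>H_zero\<close>. The other two terms are one second
    derivative taken in both orders, with opposite signs.\<close>
  proof (elim disjE conjE)
    assume "v1 \<in> vertical S p" "v2 \<in> vertical S p"
    note z = this[THEN fst_zero]
    show "frechet_derivative (\<lambda>x. ?f x [?e v1, ?e v2]) (at ?u) (?e v0) -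
      frechet_derivative (\<lambda>x. ?f x [?e v0, ?e v2]) (at ?u) (?e v1) +
      frechet_derivative (\<lambda>x. ?f x [?e v0, ?e v1]) (at ?u) (?e v2) = 0"
      using H_sym[of "?e v0" "?e v1" "?e v2"] by (simp add: dl dr z H_zero del: One_nat_def)
  next
    assume "v0 \<in> vertical S p" "v2 \<in> vertical S p"
    note z = this[THEN fst_zero]
    show "frechet_derivative (\<lambda>x. ?f x [?e v1, ?e v2]) (at ?u) (?e v0) -
      frechet_derivative (\<lambda>x. ?f x [?e v0, ?e v2]) (at ?u) (?e v1) +
      frechet_derivative (\<lambda>x. ?f x [?e v0, ?e v1]) (at ?u) (?e v2) = 0"
      using H_sym[of "?e v1" "?e v0" "?e v2"] by (simp add: dl dr z H_zero del: One_nat_def)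
  next
    assume "v0 \<in> vertical S p" "v1 \<in> vertical S p"
    note z = this[THEN fst_zero]
    show "frechet_derivative (\<lambda>x. ?f x [?e v1, ?e v2]) (at ?u) (?e v0) -
      frechet_derivative (\<lambda>x. ?f x [?e v0, ?e v2]) (at ?u) (?e v1) +
      frechet_derivative (\<lambda>x. ?f x [?e v0, ?e v1]) (at ?u) (?e v2) = 0"
      using H_sym[of "?e v2" "?e v0" "?e v1"] by (simp add: dl dr z H_zero del: One_nat_def)
  qed
qed

text \<open>\<open>\<Theta>\<close> is compared with d'' omega on \<open>W\<close> alone, because a
  glued form has a different potential near each point. As only its (1,1) component survives, the
  exterior derivative is always evaluated on two vertical arguments and one normal argument.\<close>

lemma d_vert_2_zero:
  assumes W: "open W" "transverse_form W \<omega>" "p \<in> W"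
    and \<Theta>: "\<And>q. q \<in> W \<Longrightarrow> \<Theta> q = d_vert A S N 1 \<omega> q"
  shows "d_vert A S N 2 \<Theta> p vs = 0"
proof -
  have len: "\<Theta> q vs = 0" if "q \<in> W" "length vs \<noteq> 2" for q vs
    using that by (simp only: \<Theta> d_vert_1_length not_False_eq_True)
  note parts = d_vert_1_normal_vert[OF W(1,2)]
  have "type_component S N 0 2 \<Theta> q vs = 0" if "q \<in> W" for q vs
    using parts(1)[OF that] by (simp add: type_component_0 \<Theta>[OF that]) (auto simp: length_eq_2_conv)
  then have 0: "ext_deriv A (type_component S N 0 2 \<Theta>) p vs = 0" for vs
    by (rule ext_deriv_zero[OF W(1,3)])
  have "type_component S N 2 0 \<Theta> q vs = 0" if "q \<in> W" for q vs
    using parts(2)[OF that] by (simp add: type_component_right_0 \<Theta>[OF that]) (auto simp: length_eq_2_conv)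
  then have 2: "ext_deriv A (type_component S N 2 0 \<Theta>) p vs = 0" for vs
    by (rule ext_deriv_zero[OF W(1,3)])
  have tc: "type_component S N 1 1 \<Theta> q = d_vert A S N 1 \<omega> q" if "q \<in> W" for q
  proof
    fix vs
    show "type_component S N 1 1 \<Theta> q vs = d_vert A S N 1 \<omega> q vs"
    proof (cases "length vs = 2")
      case True
      then obtain v w where vs: "vs = [v, w]" by (auto simp: length_eq_2_conv)
      show ?thesis unfolding vs type_component_1_1 \<Theta>[OF that] by (rule parts(3)[OF that])
    next
      case False
      then show ?thesis by (simp only: d_vert_1_length type_component_length one_add_one not_False_eq_True)
    qed
  qed
  have 1: "ext_deriv A (type_component S N 1 1 \<Theta>) p vs = ext_deriv A (d_vert A S N 1 \<omega>) p vs" for vs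
    by (rule ext_deriv_cong[OF W(1,3) tc])
  have "type_component S N 1 2 (ext_deriv A (type_component S N 1 1 \<Theta>)) p vs = 0"
  proof (cases "length vs = 3")
    case True
    then obtain a b c where vs: "vs = [a, b, c]" by (auto simp: length_eq_3_conv)
    show ?thesis
      unfolding vs type_component_1_2 1 using vert_in
      by (simp only: ext_deriv_d_vert_1_vertical[OF W] simp_thms add_0)
  next
    case False
    then show ?thesis by (intro type_component_length) simp
  qed
  moreover have "type_component S N 0 3 (ext_deriv A (type_component S N 0 2 \<Theta>)) p vs = 0"
    by (rule type_component_zero) (rule 0)
  moreover have "type_component S N 2 1 (ext_deriv A (type_component S N 2 0 \<Theta>)) p vs = 0"
    by (rule type_component_zero) (rule 2)
  ultimately show ?thesis unfolding d_vert_2_expand by simp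
qed

lemma has_type_d_vert_1:
  assumes W: "open W" "transverse_form W \<omega>"
  shows "has_type S N 1 1 W (d_vert A S N 1 \<omega>)"
  unfolding has_type_def
proof
  fix p assume p: "p \<in> W"
  obtain c where c: "adapted_chart A S c" and pc: "p \<in> cdom c" using adapted_cover by blast
  let ?m = "card (Basis :: ((real^'n) \<times> (real^'n)) set)"
  let ?B = "vert_deriv c \<omega> p"
  obtain f where f: "bij_betw f {..<?m} (Basis :: ((real^'n) \<times> (real^'n)) set)"
    using ex_bij_betw_nat_finite[of "Basis :: ((real^'n) \<times> (real^'n)) set"] by (auto simp: atLeast0LessThan)
  \<comment> \<open>Expanding \<open>vert p v\<close> in the basis of the model space writes d''
    omega as a sum of products of \<open>?B (f r)\<close> with a coordinate of
    \<open>vert p\<close>. \<open>has_type\<close> lists the covector annihilating vertical vectors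
    first, and this order produces the minus sign.\<close>
  define \<alpha> where "\<alpha> r i = (if i = 0 then (\<lambda>w. - ?B (f r) w) else (\<lambda>v. vert p v \<bullet> f r))" for r and i :: nat
  have ann0: "\<alpha> r 0 \<in> annihilator (vertical S p)" for r
    using linear_compose_neg[OF linear_vert_deriv_right[OF c W pc p]] vert_deriv_vertical[OF c W pc p]
    by (simp add: \<alpha>_def annihilator_def)
  have ann1: "\<alpha> r 1 \<in> annihilator (N p)" for r
  proof -
    have "linear (\<lambda>v. vert p v \<bullet> f r)"
      using linear_vert[of p] by (intro linearI) (simp_all add: linear_add linear_scale inner_left_distrib)
    then show ?thesis by (simp add: \<alpha>_def annihilator_def vert_N)
  qed
  have sum_B: "(\<Sum>r<?m. (vert p v \<bullet> f r) * ?B (f r) w) = ?B (vert p v) w" for v w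
    using sum.reindex_bij_betw[OF f, of "\<lambda>b. (vert p v \<bullet> b) * ?B b w"]
      linear_eq_sum_Basis[OF linear_vert_deriv_left[OF c W pc p], of "vert p v" w] by simp
  have "d_vert A S N 1 \<omega> p vs = (\<Sum>r<?m. wedge (1 + 1) (\<alpha> r) vs)" for vs
  proof (cases "length vs = 2")
    case True
    then obtain v w where vs: "vs = [v, w]" by (auto simp: length_eq_2_conv)
    have "(\<Sum>r<?m. wedge (1 + 1) (\<alpha> r) vs) =
      (\<Sum>r<?m. (vert p v \<bullet> f r) * ?B (f r) w) - (\<Sum>r<?m. (vert p w \<bullet> f r) * ?B (f r) v)"
      unfolding vs one_add_one wedge_2 by (simp add: \<alpha>_def algebra_simps sum_subtractf)
    then show ?thesis unfolding sum_B vs d_vert_1_chart[OF c W pc p] by simp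
  next
    case False
    then show ?thesis by (simp only: d_vert_1_length wedge_length one_add_one not_False_eq_True sum.neutral_const)
  qed
  moreover have "\<forall>r<?m. (\<forall>i<1. \<alpha> r i \<in> annihilator (vertical S p)) \<and> (\<forall>i\<in>{1..<1 + 1}. \<alpha> r i \<in> annihilator (N p))"
    using ann0 ann1 by (auto simp: less_Suc_eq)
  ultimately show "\<exists>(m::nat) \<alpha>. (\<forall>r<m. (\<forall>i<1. \<alpha> r i \<in> annihilator (vertical S p)) \<and>
      (\<forall>i\<in>{1..<1 + 1}. \<alpha> r i \<in> annihilator (N p))) \<and>
      d_vert A S N 1 \<omega> p = (\<lambda>vs. \<Sum>r<m. wedge (1 + 1) (\<alpha> r) vs)"
    by (intro exI[of _ ?m] exI[of _ \<alpha>] conjI ext)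
qed

lemma d_vert_1_diff:
  assumes W: "open W" "transverse_form W \<omega>" "transverse_form W \<omega>'" and p: "p \<in> W"
  shows "d_vert A S N 1 (\<lambda>p vs. \<omega> p vs - \<omega>' p vs) p [v, w] =
    d_vert A S N 1 \<omega> p [v, w] - d_vert A S N 1 \<omega>' p [v, w]"
proof -
  obtain c where c: "adapted_chart A S c" and pc: "p \<in> cdom c" using adapted_cover by blast
  have "vert_deriv c (\<lambda>p vs. \<omega> p vs - \<omega>' p vs) p z w = vert_deriv c \<omega> p z w - vert_deriv c \<omega>' p z w" for z w
  proof -
    let ?e = "components A c p w"
    have "((\<lambda>u. form_rep A c \<omega> u [?e] - form_rep A c \<omega>' u [?e]) has_derivative
      (\<lambda>h. frechet_derivative (\<lambda>u. form_rep A c \<omega> u [?e]) (at (cmap c p)) h -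
           frechet_derivative (\<lambda>u. form_rep A c \<omega>' u [?e]) (at (cmap c p)) h)) (at (cmap c p))"
      by (intro has_derivative_diff has_derivative_frechet_derivative form_rep_differentiable[OF c W(1,2) pc p]
            form_rep_differentiable[OF c W(1,3) pc p])
    from frechet_derivative_at[OF this, symmetric] show ?thesis
      by (simp add: vert_deriv_def form_rep_def)
  qed
  then show ?thesis
    by (simp only: d_vert_1_chart[OF c W(1) _ pc p] W(2,3) transverse_form_diff[OF W])
qed

section \<open>Foliated forms as the kernel of d''\<close>

lemma foliated_formsD:
  assumes W: "open W" and \<omega>: "\<omega> \<in> foliated_forms A S W"
  shows "transverse_form W \<omega>" "p \<in> W \<Longrightarrow> d_vert A S N 1 \<omega> p [v, w] = 0"
proof -
  have chart: "\<exists>c \<phi>. adapted_chart A S c \<and> p \<in> cdom c \<and> cdom c \<subseteq> W \<and>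
      (\<forall>q\<in>cdom c. \<forall>v. \<omega> q [v] = (\<Sum>i\<in>UNIV. \<phi> i (fst (cmap c q)) * dx A c i q v))" if "p \<in> W" for p
    using \<omega> that unfolding foliated_forms_def by blast
  show tr: "transverse_form W \<omega>"
    unfolding transverse_form_def
  proof (intro conjI ballI)
    show "differential_form A 1 W \<omega>" using \<omega> unfolding foliated_forms_def by blast
    fix p v assume "p \<in> W" and v: "v \<in> vertical S p"
    from chart[OF this(1)] obtain c \<phi> where c: "adapted_chart A S c" "p \<in> cdom c"
      and "\<omega> p [v] = (\<Sum>i\<in>UNIV. \<phi> i (fst (cmap c p)) * dx A c i p v)" by blast
    then show "\<omega> p [v] = 0" using vertical_iff[OF c] v by (simp add: dx_def)
  qed
  assume p: "p \<in> W"
  from chart[OF this] obtain c \<phi> where c: "adapted_chart A S c" and pc: "p \<in> cdom c" and cW: "cdom c \<subseteq> W"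
    and \<phi>: "\<And>q v. q \<in> cdom c \<Longrightarrow> \<omega> q [v] = (\<Sum>i\<in>UNIV. \<phi> i (fst (cmap c q)) * dx A c i q v)" by blast
  note cA = adapted_in_atlas[OF c]
  have "vert_deriv c \<omega> p z w = 0" if "z \<in> vertical S p" for z w
  proof -
    let ?f = "\<lambda>u. form_rep A c \<omega> u [components A c p w]"
    have 1: "frechet_derivative ?f (at (cmap c p)) (0, snd (components A c p z)) = 0"
    proof (rule frechet_derivative_vertical_zero[OF is_chartD(2)[OF cA]])
      show "?f differentiable (at (cmap c p))" by (rule form_rep_differentiable[OF c W tr pc p])
      have f: "?f (cmap c q) = (\<Sum>i\<in>UNIV. \<phi> i (fst (cmap c q)) * fst (components A c p w) $ i)" if "q \<in> cdom c" for q
        by (simp add: form_rep_def cinv_cmap[OF cA that] \<phi>[OF that] dx_def components_tangent_vector[OF cA that])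
      show "?f u = ?f (cmap c p)" if "u \<in> cmap c ` cdom c" "fst u = fst (cmap c p)" for u
        using that f pc by auto
    qed (use pc in blast)
    have 2: "components A c p z = (0, snd (components A c p z))"
      using vertical_iff[OF c pc] that by (simp add: prod_eq_iff)
    show ?thesis unfolding vert_deriv_def by (subst 2) (rule 1)
  qed
  then show "d_vert A S N 1 \<omega> p [v, w] = 0"
    unfolding d_vert_1_chart[OF c W tr pc p] using vert_in by simp
qed

text \<open>Vanishing vertical derivatives make the coefficients constant along connected pieces of
  the fibres. To get functions of \<open>x\<close> the chart is shrunk to a box
  \<open>P \<times> Q\<close> with \<open>Q\<close> a ball, whose fibres are convex.\<close>

lemma foliated_formsI:
  assumes W: "open W" and tr: "transverse_form W \<omega>"
    and zero: "\<And>p v w. p \<in> W \<Longrightarrow> d_vert A S N 1 \<omega> p [v, w] = 0"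
  shows "\<omega> \<in> foliated_forms A S W"
  unfolding foliated_forms_def
proof (intro CollectI conjI ballI)
  show "differential_form A 1 W \<omega>" by (rule transverse_formD(1)[OF tr])
  fix p assume p: "p \<in> W"
  obtain c where c: "adapted_chart A S c" and pc: "p \<in> cdom c" using adapted_cover by blast
  note cA = adapted_in_atlas[OF c]
  let ?X = "cmap c ` (cdom c \<inter> W)"
  have X: "open ?X" "cmap c p \<in> ?X" using open_image[OF cA W] p pc by auto
  obtain P Q0 where PQ0: "open P" "open Q0" "cmap c p \<in> P \<times> Q0" "P \<times> Q0 \<subseteq> ?X"
    by (rule open_prod_elim[OF X])
  then have "snd (cmap c p) \<in> Q0" by (simp add: mem_Times_iff)
  then obtain r where r: "r > 0" "ball (snd (cmap c p)) r \<subseteq> Q0" using openE[OF PQ0(2)] by blast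
  define Q where "Q = ball (snd (cmap c p)) r"
  have PQ: "open (P \<times> Q)" "cmap c p \<in> P \<times> Q" "P \<times> Q \<subseteq> ?X" "convex Q" "snd (cmap c p) \<in> Q"
    using PQ0 r by (auto simp: Q_def open_Times mem_Times_iff)
  let ?W = "cdom c \<inter> cmap c -` (P \<times> Q)"
  have "continuous_on (cdom c) (cmap c)" using is_chartD(3)[OF cA] by (simp add: homeomorphism_def)
  then have W': "open ?W" by (rule continuous_open_preimage[OF _ is_chartD(1)[OF cA] PQ(1)])
  have W'W: "?W \<subseteq> W"
  proof
    fix q assume q: "q \<in> ?W"
    then have "cmap c q \<in> ?X" using subsetD[OF PQ(3)] by simp
    then obtain q' where q': "q' \<in> cdom c" "q' \<in> W" "cmap c q = cmap c q'" by (elim imageE IntE)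
    have "q = cinv c (cmap c q)" using cinv_cmap[OF cA, of q] q by simp
    also have "\<dots> = q'" unfolding q'(3) by (rule cinv_cmap[OF cA q'(1)])
    finally show "q \<in> W" using q' by simp
  qed
  let ?f = "\<lambda>e u. form_rep A c \<omega> u [e]"
  have deriv_zero: "frechet_derivative (?f e) (at u) (0, b) = 0" if u: "u \<in> ?X" for u e b
  proof -
    obtain q where q: "q \<in> cdom c" "q \<in> W" "u = cmap c q" using u by blast
    have "vert_deriv c \<omega> q (tangent_vector A c q (0, b)) (tangent_vector A c q e) = 0"
      by (rule vert_deriv_eq_0[OF c W tr q(1,2) zero[OF q(2)]])
         (simp add: tangent_vector_vertical_iff[OF c q(1)])
    then show ?thesis by (simp add: vert_deriv_def components_tangent_vector[OF cA q(1)] q(3))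
  qed
  have const: "?f e (x, y) = ?f e (x, snd (cmap c p))" if "x \<in> P" "y \<in> Q" for e x y
  proof -
    have "\<exists>k. \<forall>y\<in>Q. ?f e (x, y) = k"
    proof (rule has_derivative_zero_constant[OF PQ(4)])
      fix y assume "y \<in> Q"
      then have u: "(x, y) \<in> ?X" using that subsetD[OF PQ(3), of "(x, y)"] by simp
      have "((\<lambda>y. ?f e (x, y)) has_derivative (\<lambda>h. frechet_derivative (?f e) (at (x, y)) (0, h))) (at y)"
        using diff_chain_at[OF has_derivative_Pair[OF has_derivative_const has_derivative_ident]
            has_derivative_frechet_derivative[OF smooth_on_differentiable[OF smooth_rep[OF c W tr] u]]]
        by (simp add: o_def)
      then show "((\<lambda>y. ?f e (x, y)) has_derivative (\<lambda>h. 0)) (at y within Q)"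
        unfolding deriv_zero[OF u] by (rule has_derivative_at_withinI)
    qed
    then show ?thesis using that(2) PQ(5) by metis
  qed
  let ?c = "(cdom c \<inter> ?W, cmap c)"
  \<comment> \<open>The coefficients are read off on the slice of the box at the height of
    \<open>p\<close>; by \<open>const\<close> they are the coefficients on the whole box.\<close>
  let ?\<phi> = "\<lambda>i x. ?f (axis i 1, 0) (x, snd (cmap c p))"
  have "\<omega> q [v] = (\<Sum>i\<in>UNIV. ?\<phi> i (fst (cmap c q)) * dx A ?c i q v)" if q: "q \<in> ?W" for q v
  proof -
    have u: "cmap c q \<in> ?X" using q W'W by blast
    let ?e = "components A c q v"
    interpret linear "\<lambda>e. ?f e (cmap c q)" by (rule linear_form_rep[OF c W tr u])
    have "?e = (\<Sum>i\<in>UNIV. (fst ?e $ i) *\<^sub>R (axis i 1, 0)) + (0, snd ?e)"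
      using Pair_0_eq_sum_axis[of "fst ?e"] by (simp add: prod_eq_iff fst_sum snd_sum)
    then have "?f ?e (cmap c q) = ?f ((\<Sum>i\<in>UNIV. (fst ?e $ i) *\<^sub>R (axis i 1, 0)) + (0, snd ?e)) (cmap c q)"
      by simp
    also have "\<dots> = (\<Sum>i\<in>UNIV. fst ?e $ i * ?f (axis i 1, 0) (cmap c q))"
      by (simp only: add sum scale form_rep_vertical[OF c W tr u] real_scaleR_def fst_conv add_0_right)
    also have "\<dots> = (\<Sum>i\<in>UNIV. fst ?e $ i * ?\<phi> i (fst (cmap c q)))"
      using const[of "fst (cmap c q)" "snd (cmap c q)"] q by (simp add: mem_Times_iff)
    finally show ?thesis
      using q form_rep_components[OF cA, of q \<omega> "[v]"] restrict_chart_vectors(2)[OF cA W', of q]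
      by (simp add: dx_def mult.commute)
  qed
  then show "\<exists>c \<phi>. adapted_chart A S c \<and> p \<in> cdom c \<and> cdom c \<subseteq> W \<and>
      (\<forall>q\<in>cdom c. \<forall>v. \<omega> q [v] = (\<Sum>i\<in>UNIV. \<phi> i (fst (cmap c q)) * dx A c i q v))"
    using adapted_restrict[OF c W'] pc PQ(2) W'W
    by (intro exI[of _ ?c] exI[of _ ?\<phi>]) auto
qed

end

section \<open>The first Lagrangian obstruction\<close>

text \<open>The zero cocycle on the covering by \<open>UNIV\<close> belongs to its own class. If the
  classes are equal as sets, it also belongs to the class of \<open>z\<close>, which says that
  \<open>z\<close> becomes a coboundary on a refinement.\<close>

lemma trivial_class_imp_coboundary:
  fixes F :: "'m::topological_space set \<Rightarrow> ('m, 'e) dform set"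
  assumes "(\<lambda>_ _. 0) \<in> F UNIV" "cohomology_class F I U z = trivial_class F"
  shows "\<exists>K \<sigma> b. open_covering K (\<lambda>W. W) \<and> (\<forall>W\<in>K. \<sigma> W \<in> I \<and> W \<subseteq> U (\<sigma> W) \<and> b W \<in> F W) \<and>
    (\<forall>W\<in>K. \<forall>W'\<in>K. \<forall>x\<in>W \<inter> W'. \<forall>vs. z (\<sigma> W) (\<sigma> W') x vs = b W' x vs - b W x vs)"
proof -
  let ?K = "{UNIV :: 'm set}"
  have cov: "open_covering ?K (\<lambda>W. W)" by (simp add: open_covering_def)
  have "cohomologous F ?K (\<lambda>W. W) (\<lambda>_ _ _ _. 0) ?K (\<lambda>W. W) (\<lambda>_ _ _ _. 0)"
    unfolding cohomologous_def using cov assms(1)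
    by (intro exI[of _ ?K] exI[of _ "\<lambda>W. W"] exI[of _ "\<lambda>_ _ _. 0"]) simp
  then have "(?K, \<lambda>_ _ _ _. 0) \<in> trivial_class F"
    using cov assms(1) by (simp add: trivial_class_def cohomology_class_def cocycle_def)
  then have "cohomologous F I U z ?K (\<lambda>W. W) (\<lambda>_ _ _ _. 0)"
    unfolding assms(2)[symmetric] by (simp add: cohomology_class_def)
  then obtain K \<sigma> \<tau> b where "open_covering K (\<lambda>W. W)"
    "\<forall>W\<in>K. \<sigma> W \<in> I \<and> W \<subseteq> U (\<sigma> W) \<and> \<tau> W \<in> ?K \<and> W \<subseteq> \<tau> W" "\<forall>W\<in>K. b W \<in> F W"
    "\<forall>W\<in>K. \<forall>W'\<in>K. \<forall>x\<in>W \<inter> W'. \<forall>vs. z (\<sigma> W) (\<sigma> W') x vs - 0 = b W' x vs - b W x vs"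
    unfolding cohomologous_def by (elim exE conjE)
  then show ?thesis by (intro exI[of _ K] exI[of _ \<sigma>] exI[of _ b]) simp
qed

text \<open>Classes are compared as sets, so for every \<open>y\<close> a cobounding cochain between
  \<open>z\<close> and \<open>y\<close> has to be turned into one between zero and \<open>y\<close>,
  and back. The given cochain \<open>b\<close> is subtracted in one direction and added in the
  other.\<close>

lemma coboundary_imp_trivial_class:
  fixes F :: "'m::topological_space set \<Rightarrow> ('m, 'e) dform set"
  assumes diff: "\<And>W \<omega> \<omega>'. open W \<Longrightarrow> \<omega> \<in> F W \<Longrightarrow> \<omega>' \<in> F W \<Longrightarrow> (\<lambda>x vs. \<omega> x vs - \<omega>' x vs) \<in> F W"
    and add: "\<And>W \<omega> \<omega>'. open W \<Longrightarrow> \<omega> \<in> F W \<Longrightarrow> \<omega>' \<in> F W \<Longrightarrow> (\<lambda>x vs. \<omega> x vs + \<omega>' x vs) \<in> F W"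
    and restrict: "\<And>W W' \<omega>. open W \<Longrightarrow> open W' \<Longrightarrow> W' \<subseteq> W \<Longrightarrow> \<omega> \<in> F W \<Longrightarrow> \<omega> \<in> F W'"
    and U: "open_covering I U" and b: "\<And>i. i \<in> I \<Longrightarrow> b i \<in> F (U i)"
    and z: "\<And>i j x vs. i \<in> I \<Longrightarrow> j \<in> I \<Longrightarrow> x \<in> U i \<inter> U j \<Longrightarrow> z i j x vs = b j x vs - b i x vs"
  shows "cohomology_class F I U z = trivial_class F"
proof -
  let ?Z = "\<lambda>_ _ _ _. 0 :: real"
  have "cohomologous F I U z J V y \<longleftrightarrow> cohomologous F {UNIV} (\<lambda>W. W) ?Z J V y"
    for J :: "'m set set" and V y
  proof
    assume "cohomologous F I U z J V y"
    then obtain K \<sigma> \<tau> b' where K: "open_covering K (\<lambda>W. W)"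
      and st: "\<forall>W\<in>K. \<sigma> W \<in> I \<and> W \<subseteq> U (\<sigma> W) \<and> \<tau> W \<in> J \<and> W \<subseteq> V (\<tau> W)"
      and b': "\<forall>W\<in>K. b' W \<in> F W"
      and eq: "\<forall>W\<in>K. \<forall>W'\<in>K. \<forall>x\<in>W \<inter> W'. \<forall>vs.
        z (\<sigma> W) (\<sigma> W') x vs - y (\<tau> W) (\<tau> W') x vs = b' W' x vs - b' W x vs"
      unfolding cohomologous_def by (elim exE conjE)
    note st = bspec[OF st] and b' = bspec[OF b'] and eq = eq[rule_format]
    let ?b = "\<lambda>W x vs. b' W x vs - b (\<sigma> W) x vs"
    have "?b W \<in> F W" if "W \<in> K" for W
    proof -
      have o: "open W" "open (U (\<sigma> W))" using K U st that by (auto simp: open_covering_def)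
      then have "b (\<sigma> W) \<in> F W" using restrict[OF o(2,1)] b st that by blast
      then show ?thesis using diff o b' that by blast
    qed
    moreover have "0 - y (\<tau> W) (\<tau> W') x vs = ?b W' x vs - ?b W x vs"
      if "W \<in> K" "W' \<in> K" "x \<in> W \<inter> W'" for W W' x vs
    proof -
      have "x \<in> U (\<sigma> W) \<inter> U (\<sigma> W')" using st[OF that(1)] st[OF that(2)] that(3) by blast
      then show ?thesis using eq[OF that, of vs] z[of "\<sigma> W" "\<sigma> W'" x vs] st that by simp
    qed
    ultimately show "cohomologous F {UNIV} (\<lambda>W. W) ?Z J V y"
      unfolding cohomologous_def using K st
      by (intro exI[of _ K] exI[of _ "\<lambda>_. UNIV"] exI[of _ \<tau>] exI[of _ ?b]) simp
  next
    assume "cohomologous F {UNIV} (\<lambda>W. W) ?Z J V y"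
    then obtain K \<sigma> \<tau> b' where K: "open_covering K (\<lambda>W. W)"
      and st: "\<forall>W\<in>K. \<sigma> W \<in> {UNIV} \<and> W \<subseteq> \<sigma> W \<and> \<tau> W \<in> J \<and> W \<subseteq> V (\<tau> W)"
      and b': "\<forall>W\<in>K. b' W \<in> F W"
      and eq: "\<forall>W\<in>K. \<forall>W'\<in>K. \<forall>x\<in>W \<inter> W'. \<forall>vs.
        0 - y (\<tau> W) (\<tau> W') x vs = b' W' x vs - b' W x vs"
      unfolding cohomologous_def by (elim exE conjE)
    note st = bspec[OF st] and b' = bspec[OF b'] and eq = eq[rule_format]
    \<comment> \<open>The sets of \<open>K\<close> need not lie in members of \<open>U\<close>,
      hence the intersections. Cochains are indexed by the bare set, and one set may be such an
      intersection in several ways, so a pair of indices is chosen for each.\<close>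
    define K' where "K' = {W \<inter> U i | W i. W \<in> K \<and> i \<in> I}"
    have "\<forall>X\<in>K'. \<exists>W i. X = W \<inter> U i \<and> W \<in> K \<and> i \<in> I" unfolding K'_def by blast
    then obtain w \<iota> where w: "\<And>X. X \<in> K' \<Longrightarrow> X = w X \<inter> U (\<iota> X) \<and> w X \<in> K \<and> \<iota> X \<in> I"
      by (auto simp: bchoice_iff)
    have o: "open X" "open (w X)" "open (U (\<iota> X))" "X \<subseteq> w X" "X \<subseteq> U (\<iota> X)" if "X \<in> K'" for X
    proof -
      show 1: "open (w X)" "open (U (\<iota> X))" using K U w[OF that] by (auto simp: open_covering_def)
      have "X = w X \<inter> U (\<iota> X)" using w[OF that] by blast
      then show "open X" "X \<subseteq> w X" "X \<subseteq> U (\<iota> X)" using open_Int[OF 1] by auto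
    qed
    have "x \<in> \<Union> K'" for x
    proof -
      obtain W i where "x \<in> W" "W \<in> K" "x \<in> U i" "i \<in> I"
        using K U unfolding open_covering_def by blast
      then show ?thesis unfolding K'_def by blast
    qed
    then have K': "open_covering K' (\<lambda>W. W)" using o(1) by (auto simp: open_covering_def)
    let ?b = "\<lambda>X x vs. b' (w X) x vs + b (\<iota> X) x vs"
    have "?b X \<in> F X" if "X \<in> K'" for X
      using add[OF o(1)[OF that] restrict[OF o(2,1,4)[OF that] b'] restrict[OF o(3,1,5)[OF that] b]] w[OF that]
      by blast
    moreover have "z (\<iota> X) (\<iota> X') x vs - y (\<tau> (w X)) (\<tau> (w X')) x vs = ?b X' x vs - ?b X x vs"
      if "X \<in> K'" "X' \<in> K'" "x \<in> X \<inter> X'" for X X' x vs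
    proof -
      have "x \<in> w X \<inter> w X'" "x \<in> U (\<iota> X) \<inter> U (\<iota> X')"
        using o(4,5)[OF that(1)] o(4,5)[OF that(2)] that(3) by blast+
      then show ?thesis
        using eq[of "w X" "w X'" x vs] z[of "\<iota> X" "\<iota> X'" x vs] w[OF that(1)] w[OF that(2)] by simp
    qed
    moreover have "\<iota> X \<in> I \<and> X \<subseteq> U (\<iota> X) \<and> \<tau> (w X) \<in> J \<and> X \<subseteq> V (\<tau> (w X))" if "X \<in> K'" for X
      using w[OF that] o[OF that] st[of "w X"] by blast
    ultimately show "cohomologous F I U z J V y"
      unfolding cohomologous_def using K'
      by (intro exI[of _ K'] exI[of _ \<iota>] exI[of _ "\<lambda>X. \<tau> (w X)"] exI[of _ ?b]) simp
  qed
  then show ?thesis unfolding trivial_class_def cohomology_class_def by simp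
qed

section \<open>Sections of the sheaf of foliated forms, and d'' of
  \<open>theta A S L\<close>\<close>

context normal_bundle_mfd
begin

lemma zero_foliated: "(\<lambda>_ _. 0) \<in> foliated_forms A S UNIV"
proof -
  have tr: "transverse_form UNIV (\<lambda>_ _. 0)"
    unfolding transverse_form_def differential_form_def alternating_form_def form_rep_def
    by (auto intro: smooth_on_const linear_zero)
  have "d_vert A S N 1 (\<lambda>_ _. 0) p [v, w] = 0" for p v w
    unfolding d_vert_1_ext_deriv[OF open_UNIV tr UNIV_I]
    by (subst (1 2) ext_deriv_zero[OF open_UNIV UNIV_I]) simp_all
  then show ?thesis by (intro foliated_formsI tr open_UNIV)
qed

text \<open>Here and for differences membership is tested by d'' rather than by charts: two foliated
  forms come with unrelated adapted charts, whereas the vanishing of d'' restricts and is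
  linear.\<close>

lemma foliated_forms_restrict:
  assumes "open W" "open W'" "W' \<subseteq> W" "\<omega> \<in> foliated_forms A S W"
  shows "\<omega> \<in> foliated_forms A S W'"
  using foliated_formsD[OF assms(1,4)] transverse_form_subset[OF _ assms(3)] assms(2,3)
  by (intro foliated_formsI) auto

lemma foliated_forms_diff:
  assumes "open W" "\<omega> \<in> foliated_forms A S W" "\<omega>' \<in> foliated_forms A S W"
  shows "(\<lambda>x vs. \<omega> x vs - \<omega>' x vs) \<in> foliated_forms A S W"
proof (rule foliated_formsI[OF assms(1)])
  note f = foliated_formsD[OF assms(1,2)] and f' = foliated_formsD[OF assms(1,3)]
  show "transverse_form W (\<lambda>x vs. \<omega> x vs - \<omega>' x vs)" using transverse_form_diff[OF assms(1) f(1) f'(1)] .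
  show "d_vert A S N 1 (\<lambda>x vs. \<omega> x vs - \<omega>' x vs) p [v, w] = 0" if "p \<in> W" for p v w
    unfolding d_vert_1_diff[OF assms(1) f(1) f'(1) that] f(2)[OF that] f'(2)[OF that] by simp
qed

lemma foliated_forms_add:
  assumes "open W" "\<omega> \<in> foliated_forms A S W" "\<omega>' \<in> foliated_forms A S W"
  shows "(\<lambda>x vs. \<omega> x vs + \<omega>' x vs) \<in> foliated_forms A S W"
proof -
  have "(\<lambda>_ _. 0) \<in> foliated_forms A S W"
    using foliated_forms_restrict[OF open_UNIV assms(1) subset_UNIV zero_foliated] .
  \<comment> \<open>The sum is written as \<open>\<omega> - (0 - \<omega>')\<close>.\<close>
  from foliated_forms_diff[OF assms(1,2) foliated_forms_diff[OF assms(1) this assms(3)]]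
  show ?thesis by simp
qed

lemma d_vert_1_cong:
  assumes "open W" "transverse_form W \<omega>" "p \<in> W" "\<And>q. q \<in> W \<Longrightarrow> \<omega> q = \<omega>' q"
  shows "d_vert A S N 1 \<omega> p vs = d_vert A S N 1 \<omega>' p vs"
proof (cases "length vs = 2")
  case True
  then obtain v w where vs: "vs = [v, w]" by (auto simp: length_eq_2_conv)
  have "transverse_form W \<omega>'"
    using assms(2,4) differential_form_cong[OF assms(1) _ assms(4)] unfolding transverse_form_def by auto
  then show ?thesis
    unfolding vs d_vert_1_ext_deriv[OF assms(1,2,3)]
    by (simp only: d_vert_1_ext_deriv[OF assms(1) _ assms(3)] ext_deriv_cong[OF assms(1,3,4)])
next
  case False
  then show ?thesis by (simp only: d_vert_1_length not_False_eq_True)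
qed

text \<open>\<open>S\<close> identifies the transversal space with the vertical one, so a vertical
  direction enters the Hessian through a preimage \<open>z\<close> under \<open>S\<close>. The chart
  is the one in which \<open>vertical_hessian\<close> is computed.\<close>

lemma vert_deriv_theta:
  assumes W: "open W" "smooth_function A W L" and p: "p \<in> W"
  shows "vert_deriv (adapted_chart_at A S p) (theta A S L) p (S p z) w = vertical_hessian A S L p z w"
proof -
  let ?c = "adapted_chart_at A S p"
  note c = adapted_chart_at[of p]
  note cA = adapted_in_atlas[OF c(1)]
  let ?X = "cmap ?c ` (cdom ?c \<inter> W)" and ?f = "\<lambda>u. L (cinv ?c u)" and ?u = "cmap ?c p"
  let ?w = "components A ?c p w" and ?z = "components A ?c p z"
  have X: "open ?X" "?u \<in> ?X" using open_image[OF cA W(1)] c p by auto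
  have sm: "smooth_on ?X ?f" by (rule smooth_functionD[OF W(2) cA])
  have dp: "partial_y j ?f differentiable (at ?u)" for j
    using smooth_on_differentiable[OF smooth_on_frechet_derivative[OF sm] X(2)] by (simp add: partial_y_def[abs_def])
  have rep: "form_rep A ?c (theta A S L) u [?w] = (\<Sum>j\<in>UNIV. partial_y j ?f u * fst ?w $ j)" if "u \<in> ?X" for u
    unfolding form_rep_theta[OF W c(1) that] sum_partial_y[OF smooth_on_differentiable[OF sm that]] ..
  have "((\<lambda>u. \<Sum>j\<in>UNIV. partial_y j ?f u * fst ?w $ j) has_derivative
    (\<lambda>h. \<Sum>j\<in>UNIV. frechet_derivative (partial_y j ?f) (at ?u) h * fst ?w $ j)) (at ?u)"
    by (intro has_derivative_sum has_derivative_mult_left has_derivative_frechet_derivative dp)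
  then have "((\<lambda>u. form_rep A ?c (theta A S L) u [?w]) has_derivative
    (\<lambda>h. \<Sum>j\<in>UNIV. frechet_derivative (partial_y j ?f) (at ?u) h * fst ?w $ j)) (at ?u)"
    by (rule has_derivative_transform_within_open[OF _ X]) (simp add: rep)
  from frechet_derivative_at[OF this, symmetric]
  have "vert_deriv ?c (theta A S L) p (S p z) w =
    (\<Sum>j\<in>UNIV. frechet_derivative (partial_y j ?f) (at ?u) (0, fst ?z) * fst ?w $ j)"
    by (simp add: vert_deriv_def components_S[OF c])
  also have "\<dots> = (\<Sum>j\<in>UNIV. \<Sum>i\<in>UNIV. partial_y i (partial_y j ?f) ?u * fst ?z $ i * fst ?w $ j)"
    by (simp add: sum_partial_y[OF dp, symmetric] sum_distrib_right)
  also have "\<dots> = vertical_hessian A S L p z w"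
    unfolding vertical_hessian_def Let_def dx_def o_def by (rule sum.swap)
  finally show ?thesis .
qed

lemma d_vert_1_theta:
  assumes W: "open W" "smooth_function A W L" and p: "p \<in> W"
    and v: "S p v' = vert p v" "S p w' = vert p w"
  shows "d_vert A S N 1 (theta A S L) p [v, w] = vertical_hessian A S L p v' w - vertical_hessian A S L p w' v"
  unfolding d_vert_1_chart[OF adapted_chart_at(1) W(1) transverse_form_theta[OF W] adapted_chart_at(2) p] v[symmetric]
    vert_deriv_theta[OF W p] ..

end

section \<open>Gluing and non-degeneracy of Theta, and the criterion for the vanishing of the
  obstruction\<close>

theorem proposition2p4:
  fixes A :: "('m::{t2_space, second_countable_topology}, (real^'n) \<times> (real^'n)) chart set"
    and S :: "'m \<Rightarrow> (real^'n) \<times> (real^'n) \<Rightarrow> (real^'n) \<times> (real^'n)"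
    and g :: "'m \<Rightarrow> (real^'n) \<times> (real^'n) \<Rightarrow> (real^'n) \<times> (real^'n) \<Rightarrow> real"
    and I :: "'i set" and U :: "'i \<Rightarrow> 'm set" and L :: "'i \<Rightarrow> 'm \<Rightarrow> real"
    and N :: "'m \<Rightarrow> ((real^'n) \<times> (real^'n)) set"
  assumes "locally_lagrange A S g I U L"
    and "normal_bundle A S N"
  shows "\<exists>!\<Theta>. (\<forall>\<alpha>\<in>I. \<forall>p\<in>U \<alpha>. \<Theta> p = d_vert A S N 1 (theta A S (L \<alpha>)) p) \<and>
     almost_symplectic A \<Theta> \<and>
     has_type S N 1 1 UNIV \<Theta> \<and>
     (\<forall>p vs. d_vert A S N 2 \<Theta> p vs = 0) \<and>
     (first_obstruction A S I U L = trivial_class (foliated_forms A S) \<longleftrightarrow>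
       (\<exists>\<Lambda>. differential_form A 1 UNIV \<Lambda> \<and> has_type S N 1 0 UNIV \<Lambda> \<and>
            (\<forall>p. \<Theta> p = d_vert A S N 1 \<Lambda> p)))"
proof -
  note ll = assms(1)[unfolded locally_lagrange_def]
  have cover: "(\<Union>\<alpha>\<in>I. U \<alpha>) = UNIV" using ll by blast
  have chart: "\<exists>c. adapted_chart A S c \<and> cdom c = U \<alpha>" if "\<alpha> \<in> I" for \<alpha> using ll that by blast
  have smooth_L: "smooth_function A (U \<alpha>) (L \<alpha>)" if "\<alpha> \<in> I" for \<alpha>
    using ll that unfolding regular_lagrangian_def by blast
  have g_hess: "g p = vertical_hessian A S (L \<alpha>) p" if "\<alpha> \<in> I" "p \<in> U \<alpha>" for \<alpha> p
    using ll that by blast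
  have nondeg: "v \<in> vertical S p" if "\<And>w. g p v w = 0" for p v
    using ll that unfolding transverse_nondegenerate_def by blast
  have g_sym: "g p v w = g p w v" and g_vert: "v \<in> vertical S p \<Longrightarrow> g p v w = 0" for p v w
    using ll unfolding transverse_symmetric_form_def by blast+
  have S2: "S p (S p v) = 0" and ker_S: "S p v = 0" if "v \<in> vertical S p" for p v
    using ll that unfolding tangent_manifold_def vertical_def by blast+
  interpret normal_bundle_mfd A S N
  proof
    show "smooth_manifold A" "endomorphism_field A S" using ll unfolding tangent_manifold_def by blast+
    show "\<exists>c. adapted_chart A S c \<and> p \<in> cdom c" for p
    proof -
      obtain \<alpha> where "\<alpha> \<in> I" "p \<in> U \<alpha>" using cover by blast
      then show ?thesis using chart by metis
    qed
  qed (rule assms(2))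
  let ?\<theta> = "\<lambda>\<alpha>. theta A S (L \<alpha>)" and ?F = "foliated_forms A S"
  have openU: "open (U \<alpha>)" if "\<alpha> \<in> I" for \<alpha>
    using chart[OF that] is_chartD(1)[OF adapted_in_atlas] by metis
  have \<theta>: "transverse_form (U \<alpha>) (?\<theta> \<alpha>)" if "\<alpha> \<in> I" for \<alpha>
    using transverse_form_theta openU smooth_L that by blast
  \<comment> \<open>The preimage is determined up to vertical vectors; the formulas below hold for
    every choice.\<close>
  have lift: "\<exists>v'. S p v' = vert p v" for p v
    using vert_in[of p v] unfolding vertical_def by (metis rangeE)
  have d\<theta>: "d_vert A S N 1 (?\<theta> \<alpha>) p [v, w] = g p v' w - g p w' v"
    if "\<alpha> \<in> I" "p \<in> U \<alpha>" "S p v' = vert p v" "S p w' = vert p w" for \<alpha> p v w v' w'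
    unfolding g_hess[OF that(1,2)] by (rule d_vert_1_theta[OF openU smooth_L]) (use that in auto)
  have glue: "d_vert A S N 1 (?\<theta> \<alpha>) p = d_vert A S N 1 (?\<theta> \<beta>) p"
    if "\<alpha> \<in> I" "\<beta> \<in> I" "p \<in> U \<alpha>" "p \<in> U \<beta>" for \<alpha> \<beta> p
  proof
    fix vs
    show "d_vert A S N 1 (?\<theta> \<alpha>) p vs = d_vert A S N 1 (?\<theta> \<beta>) p vs"
    proof (cases "length vs = 2")
      case True
      then obtain v w where vs: "vs = [v, w]" by (auto simp: length_eq_2_conv)
      obtain v' w' where l: "S p v' = vert p v" "S p w' = vert p w" using lift by metis
      show ?thesis unfolding vs d\<theta>[OF that(1,3) l] d\<theta>[OF that(2,4) l] ..
    next
      case False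
      then show ?thesis by (simp only: d_vert_1_length not_False_eq_True)
    qed
  qed
  \<comment> \<open>The index is chosen pointwise, with no continuity in \<open>p\<close>. By
    \<open>glue\<close> the value does not depend on it, so a single index may be used over a whole
    neighbourhood.\<close>
  define a where "a p = (SOME \<alpha>. \<alpha> \<in> I \<and> p \<in> U \<alpha>)" for p
  have a: "a p \<in> I" "p \<in> U (a p)" for p
  proof -
    have "\<exists>\<alpha>. \<alpha> \<in> I \<and> p \<in> U \<alpha>" using cover by blast
    from someI_ex[OF this] show "a p \<in> I" "p \<in> U (a p)" unfolding a_def by blast+
  qed
  define \<Theta> where "\<Theta> p = d_vert A S N 1 (?\<theta> (a p)) p" for p
  have \<Theta>: "\<Theta> p = d_vert A S N 1 (?\<theta> \<alpha>) p" if "\<alpha> \<in> I" "p \<in> U \<alpha>" for \<alpha> p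
    unfolding \<Theta>_def using glue a that by blast
  have form: "differential_form A 2 UNIV \<Theta>"
  proof (rule differential_form_local)
    fix p
    have "differential_form A 2 (U (a p)) \<Theta>"
      by (rule differential_form_cong[OF openU[OF a(1)] differential_form_d_vert_1[OF openU[OF a(1)] \<theta>[OF a(1)]]])
         (rule \<Theta>[OF a(1), symmetric])
    then show "\<exists>W'. open W' \<and> p \<in> W' \<and> differential_form A 2 W' \<Theta>" using openU a by blast
  qed
  have \<Theta>_eq: "\<Theta> p [v, w] = g p v' w - g p w' v" if "S p v' = vert p v" "S p w' = vert p w" for p v w v' w'
    unfolding \<Theta>_def by (rule d\<theta>[OF a that])
  have symplectic: "almost_symplectic A \<Theta>"
    unfolding almost_symplectic_def
  proof (intro conjI allI impI form)
    fix p v assume v: "\<forall>w. \<Theta> p [v, w] = 0"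
    obtain v' where v': "S p v' = vert p v" using lift by blast
    \<comment> \<open>Testing with \<open>S p u\<close> evaluates \<open>g p v'\<close> on a
      vertical vector, where it vanishes. What remains is \<open>- g p u v\<close>, so
      \<open>v\<close> lies in the radical of \<open>g p\<close> and is vertical.\<close>
    have "g p v u = 0" for u
    proof -
      have Su: "S p u \<in> vertical S p" by (simp add: vertical_def)
      have "\<Theta> p [v, S p u] = g p v' (S p u) - g p u v"
        by (rule \<Theta>_eq[OF v']) (simp add: vert_vertical[OF Su])
      moreover have "g p v' (S p u) = 0" using g_vert[OF Su] g_sym by simp
      ultimately show ?thesis using v g_sym by simp
    qed
    then have vv: "v \<in> vertical S p" by (rule nondeg)
    \<comment> \<open>For vertical \<open>v\<close> the other term of \<open>\<Theta>_eq\<close>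
      vanishes, so now the preimage \<open>v'\<close> lies in the radical and is vertical; then
      \<open>v = S p v' = 0\<close>.\<close>
    have "g p v' w = 0" for w
    proof -
      obtain w' where w': "S p w' = vert p w" using lift by blast
      show ?thesis using \<Theta>_eq[OF v' w'] v g_vert[OF vv, of w'] g_sym[of p w' v] by simp
    qed
    then have "v' \<in> vertical S p" by (rule nondeg)
    then show "v = 0" using ker_S v' vert_vertical[OF vv] by simp
  qed
  have type: "has_type S N 1 1 UNIV \<Theta>"
    unfolding has_type_def
  proof
    fix p
    show "\<exists>(m::nat) \<alpha>. (\<forall>r<m. (\<forall>i<1. \<alpha> r i \<in> annihilator (vertical S p)) \<and>
      (\<forall>i\<in>{1..<1 + 1}. \<alpha> r i \<in> annihilator (N p))) \<and> \<Theta> p = (\<lambda>vs. \<Sum>r<m. wedge (1 + 1) (\<alpha> r) vs)"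
      unfolding \<Theta>_def
      using has_type_d_vert_1[OF openU[OF a(1)] \<theta>[OF a(1)], of p] a(2)[of p] unfolding has_type_def by blast
  qed
  have closed: "d_vert A S N 2 \<Theta> p vs = 0" for p vs
    by (rule d_vert_2_zero[OF openU[OF a(1)] \<theta>[OF a(1)] a(2) \<Theta>[OF a(1)]])
  have exact: "first_obstruction A S I U L = trivial_class ?F \<longleftrightarrow>
       (\<exists>\<Lambda>. differential_form A 1 UNIV \<Lambda> \<and> has_type S N 1 0 UNIV \<Lambda> \<and> (\<forall>p. \<Theta> p = d_vert A S N 1 \<Lambda> p))"
  proof
    assume "first_obstruction A S I U L = trivial_class ?F"
    from trivial_class_imp_coboundary[OF zero_foliated this[unfolded first_obstruction_def]]
    obtain K \<sigma> b where K: "open_covering K (\<lambda>W. W)"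
      and \<sigma>: "\<forall>W\<in>K. \<sigma> W \<in> I \<and> W \<subseteq> U (\<sigma> W) \<and> b W \<in> ?F W"
      and eq: "\<forall>W\<in>K. \<forall>W'\<in>K. \<forall>x\<in>W \<inter> W'. \<forall>vs.
        ?\<theta> (\<sigma> W') x vs - ?\<theta> (\<sigma> W) x vs = b W' x vs - b W x vs"
      by (elim exE conjE)
    note \<sigma> = bspec[OF \<sigma>] and eq = eq[rule_format]
    have openK: "open W" if "W \<in> K" for W using K that by (simp add: open_covering_def)
    define k where "k p = (SOME W. W \<in> K \<and> p \<in> W)" for p
    have k: "k p \<in> K" "p \<in> k p" for p
    proof -
      have "p \<in> (\<Union>W\<in>K. W)" using conjunct2[OF K[unfolded open_covering_def]] by (simp only: UNIV_I)
      then have "\<exists>W. W \<in> K \<and> p \<in> W" by (elim UN_E) blast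
      from someI_ex[OF this] show "k p \<in> K" "p \<in> k p" unfolding k_def by blast+
    qed
    let ?l = "\<lambda>W p vs. ?\<theta> (\<sigma> W) p vs - b W p vs"
    \<comment> \<open>\<open>K\<close> refines the given covering, so the Lagrangian over
      \<open>W\<close> is the one with index \<open>\<sigma> W\<close>. The coboundary relation says
      exactly that the value does not depend on the chosen member of \<open>K\<close>.\<close>
    define \<Lambda> where "\<Lambda> p = ?l (k p) p" for p
    have \<Lambda>: "\<Lambda> p = ?l W p" if "W \<in> K" "p \<in> W" for W p
    proof
      fix vs
      show "\<Lambda> p vs = ?l W p vs" using eq[OF k(1) that(1), of p p vs] k(2)[of p] that(2) by (simp add: \<Lambda>_def)
    qed
    have tr\<theta>: "transverse_form W (?\<theta> (\<sigma> W))" and trb: "transverse_form W (b W)" if "W \<in> K" for W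
      using transverse_form_subset[OF \<theta>] foliated_formsD(1)[OF openK[OF that]] \<sigma>[OF that] by blast+
    have trl: "transverse_form W (?l W)" if "W \<in> K" for W
      using transverse_form_diff[OF openK tr\<theta> trb] that by blast
    have form\<Lambda>: "differential_form A 1 UNIV \<Lambda>"
    proof (rule differential_form_local)
      fix p
      have "differential_form A 1 (k p) \<Lambda>"
        by (rule differential_form_cong[OF openK[OF k(1)] transverse_formD(1)[OF trl[OF k(1)]]])
           (rule \<Lambda>[OF k(1), symmetric])
      then show "\<exists>W'. open W' \<and> p \<in> W' \<and> differential_form A 1 W' \<Lambda>" using openK k by blast
    qed
    have alt: "alternating_form 1 (\<Lambda> p)" for p
      using form\<Lambda> unfolding differential_form_def by blast
    have "has_type S N 1 0 UNIV \<Lambda>"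
      unfolding has_type_1_0_iff[OF alt] \<Lambda>_def using transverse_formD(5)[OF trl[OF k(1)] k(2)] by blast
    moreover have "\<Theta> p = d_vert A S N 1 \<Lambda> p" for p
    proof
      fix vs
      show "\<Theta> p vs = d_vert A S N 1 \<Lambda> p vs"
      proof (cases "length vs = 2")
        case True
        then obtain v w where vs: "vs = [v, w]" by (auto simp: length_eq_2_conv)
        have "d_vert A S N 1 \<Lambda> p vs = d_vert A S N 1 (?l (k p)) p vs"
          by (rule d_vert_1_cong[OF openK[OF k(1)] trl[OF k(1)] k(2) \<Lambda>[OF k(1), symmetric], symmetric])
        also have "\<dots> = d_vert A S N 1 (?\<theta> (\<sigma> (k p))) p vs - d_vert A S N 1 (b (k p)) p vs"
          unfolding vs by (rule d_vert_1_diff[OF openK[OF k(1)] tr\<theta>[OF k(1)] trb[OF k(1)] k(2)])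
        also have "d_vert A S N 1 (b (k p)) p vs = 0"
          unfolding vs using \<sigma>[OF k(1)] foliated_formsD(2)[OF openK[OF k(1)] _ k(2)] by blast
        also have "d_vert A S N 1 (?\<theta> (\<sigma> (k p))) p = \<Theta> p"
          using \<Theta>[of "\<sigma> (k p)" p] \<sigma>[OF k(1)[of p]] k(2)[of p] by auto
        finally show ?thesis by simp
      next
        case False
        then show ?thesis unfolding \<Theta>_def by (simp only: d_vert_1_length not_False_eq_True)
      qed
    qed
    ultimately show "\<exists>\<Lambda>. differential_form A 1 UNIV \<Lambda> \<and> has_type S N 1 0 UNIV \<Lambda> \<and> (\<forall>p. \<Theta> p = d_vert A S N 1 \<Lambda> p)"
      using form\<Lambda> by blast
  next
    assume "\<exists>\<Lambda>. differential_form A 1 UNIV \<Lambda> \<and> has_type S N 1 0 UNIV \<Lambda> \<and> (\<forall>p. \<Theta> p = d_vert A S N 1 \<Lambda> p)"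
    then obtain \<Lambda> where \<Lambda>: "differential_form A 1 UNIV \<Lambda>" "has_type S N 1 0 UNIV \<Lambda>"
      "\<And>p. \<Theta> p = d_vert A S N 1 \<Lambda> p" by blast
    have alt: "alternating_form 1 (\<Lambda> p)" for p
      using \<Lambda>(1) unfolding differential_form_def by blast
    have tr: "transverse_form W \<Lambda>" for W
      using \<Lambda>(2) differential_form_subset[OF \<Lambda>(1)] unfolding has_type_1_0_iff[OF alt] transverse_form_def by blast
    \<comment> \<open>The global \<open>\<Lambda>\<close> cancels in differences, so the coboundary
      of this cochain is the obstruction cocycle on the original covering.\<close>
    let ?b = "\<lambda>\<alpha> p vs. ?\<theta> \<alpha> p vs - \<Lambda> p vs"
    show "first_obstruction A S I U L = trivial_class ?F"
      unfolding first_obstruction_def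
    proof (rule coboundary_imp_trivial_class[OF foliated_forms_diff foliated_forms_add foliated_forms_restrict])
      show "open_covering I U" using openU cover by (simp add: open_covering_def)
      show "?b \<alpha> \<in> ?F (U \<alpha>)" if \<alpha>: "\<alpha> \<in> I" for \<alpha>
      proof (rule foliated_formsI[OF openU[OF \<alpha>] transverse_form_diff[OF openU[OF \<alpha>] \<theta>[OF \<alpha>] tr]])
        fix p v w assume p: "p \<in> U \<alpha>"
        show "d_vert A S N 1 (?b \<alpha>) p [v, w] = 0"
          unfolding d_vert_1_diff[OF openU[OF \<alpha>] \<theta>[OF \<alpha>] tr p] \<Theta>[OF \<alpha> p, symmetric] \<Lambda>(3) by simp
      qed
    qed simp_all
  qed
  show ?thesis
  proof (rule ex1I[of _ \<Theta>])
    show "(\<forall>\<alpha>\<in>I. \<forall>p\<in>U \<alpha>. \<Theta> p = d_vert A S N 1 (theta A S (L \<alpha>)) p) \<and>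
     almost_symplectic A \<Theta> \<and> has_type S N 1 1 UNIV \<Theta> \<and> (\<forall>p vs. d_vert A S N 2 \<Theta> p vs = 0) \<and>
     (first_obstruction A S I U L = trivial_class (foliated_forms A S) \<longleftrightarrow>
       (\<exists>\<Lambda>. differential_form A 1 UNIV \<Lambda> \<and> has_type S N 1 0 UNIV \<Lambda> \<and> (\<forall>p. \<Theta> p = d_vert A S N 1 \<Lambda> p)))"
      by (intro conjI ballI allI \<Theta> symplectic type closed exact)
  next
    fix \<Theta>'
    assume "(\<forall>\<alpha>\<in>I. \<forall>p\<in>U \<alpha>. \<Theta>' p = d_vert A S N 1 (theta A S (L \<alpha>)) p) \<and>
     almost_symplectic A \<Theta>' \<and> has_type S N 1 1 UNIV \<Theta>' \<and> (\<forall>p vs. d_vert A S N 2 \<Theta>' p vs = 0) \<and>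
     (first_obstruction A S I U L = trivial_class (foliated_forms A S) \<longleftrightarrow>
       (\<exists>\<Lambda>. differential_form A 1 UNIV \<Lambda> \<and> has_type S N 1 0 UNIV \<Lambda> \<and> (\<forall>p. \<Theta>' p = d_vert A S N 1 \<Lambda> p)))"
    then have "\<forall>\<alpha>\<in>I. \<forall>p\<in>U \<alpha>. \<Theta>' p = d_vert A S N 1 (theta A S (L \<alpha>)) p" by (rule conjunct1)
    then have "\<Theta>' p = \<Theta> p" for p unfolding \<Theta>_def using a by blast
    then show "\<Theta>' = \<Theta>" by (rule ext)
  qed
qed

end
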